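(* Let $\mathcal H$ be a complex Hilbert space, $H\ge0$ a self-adjoint operator in $\mathcal H$, $n\geq 1$, and let $P_1,\dots,P_n$ be densely defined closed operators in $\mathcal H$ such that for every $j$ there is some $a_j\in(0,1)$ with $P_j(H+1)^{-a_j}\in\mathcal L(\mathcal H)$. Then: a) The map $[0,\infty)\ni t\mapsto\Phi^H_t(P_1,\dots,P_n)\in\mathcal L(\mathcal H)$ is smooth on $(0,\infty)$ and norm continuous at $t=0$. b) For all $t\ge0$ one has $\mathrm{Ran}\big(\Phi^H_t(P_1,\dots,P_n)\big)\subset\mathrm{Dom}(H)$, and for all $t>0$ $$\frac{d}{dt}\Phi^H_t(P_1,\dots,P_n)=-H\,\Phi^H_t(P_1,\dots,P_n)+P_1\,\Phi^H_t(P_2,\dots,P_n),$$ where for $n=1$ the second summand is understood to be $P_1\mathrm e^{-tH}$.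
   Context: $\mathcal L(\mathcal H)$ denotes the bounded operators on $\mathcal H$ with the operator norm (smoothness is meant in norm). For $t>0$, with $t\sigma_n=\{s\in\mathbb R^n:0\le s_1\le\dots\le s_n\le t\}$, $$\Phi^H_t(P_1,\dots,P_n)=\int_{t\sigma_n}\mathrm e^{-s_1H}P_1\mathrm e^{-(s_2-s_1)H}P_2\cdots\mathrm e^{-(s_n-s_{n-1})H}P_n\mathrm e^{-(t-s_n)H}\,ds_1\cdots ds_n$$ as a Bochner integral in $\mathcal L(\mathcal H)$ (which exists under the assumption), and $\Phi^H_0(P_1,\dots,P_n)=0$. *)

theory Defs
  imports "HOL-Analysis.Analysis"
begin

section \<open>Complex Hilbert spaces\<close>

(* The inner product is antilinear in the first argument and linear in the second. *)
class chilbert_space = banach +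
  fixes scaleC :: "complex \<Rightarrow> 'a \<Rightarrow> 'a"  (infixr \<open>*\<^sub>C\<close> 75)
    and cinner :: "'a \<Rightarrow> 'a \<Rightarrow> complex"
  assumes scaleC_add_right: "c *\<^sub>C (x + y) = c *\<^sub>C x + c *\<^sub>C y"
    and scaleC_add_left: "(c + d) *\<^sub>C x = c *\<^sub>C x + d *\<^sub>C x"
    and scaleC_scaleC: "c *\<^sub>C (d *\<^sub>C x) = (c * d) *\<^sub>C x"
    and scaleR_scaleC: "r *\<^sub>R x = complex_of_real r *\<^sub>C x"
    and cinner_commute: "cinner x y = cnj (cinner y x)"
    and cinner_add_right: "cinner x (y + z) = cinner x y + cinner x z"
    and cinner_scaleC_right: "cinner x (c *\<^sub>C y) = c * cinner x y"
    and cinner_self: "cinner x x = complex_of_real ((norm x)\<^sup>2)"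


section \<open>The normed space of bounded operators\<close>

(* The library type of bounded linear maps is real-linear; the bounded complex-linear maps form
   a subtype, which inherits the operator norm. *)
typedef (overloaded) 'a cblinfun =
  "{A :: 'a::chilbert_space \<Rightarrow>\<^sub>L 'a. \<forall>c x. blinfun_apply A (c *\<^sub>C x) = c *\<^sub>C blinfun_apply A x}"
  morphisms blinfun_of_cblinfun cblinfun_of_blinfun
proof
  show "id_blinfun \<in> {A :: 'a \<Rightarrow>\<^sub>L 'a. \<forall>c x. A (c *\<^sub>C x) = c *\<^sub>C A x}"
    by simp
qed

setup_lifting type_definition_cblinfun

lemma scaleC_zero_right [simp]: "c *\<^sub>C (0 :: 'a::chilbert_space) = 0"
  using scaleC_add_right[of c 0 0] by simp

lemma scaleC_minus_right: "c *\<^sub>C (- x) = - (c *\<^sub>C (x :: 'a::chilbert_space))"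
  using scaleC_add_right[of c x "- x"] by (simp add: eq_neg_iff_add_eq_0 add.commute)

lemma scaleC_diff_right: "c *\<^sub>C (x - y) = c *\<^sub>C x - c *\<^sub>C (y :: 'a::chilbert_space)"
  using scaleC_add_right[of c x "- y"] by (simp add: scaleC_minus_right)

instantiation cblinfun :: (chilbert_space) real_normed_vector
begin

lift_definition zero_cblinfun :: "'a cblinfun" is 0
  by simp
lift_definition plus_cblinfun :: "'a cblinfun \<Rightarrow> 'a cblinfun \<Rightarrow> 'a cblinfun" is "(+)"
  by (simp add: blinfun.add_left scaleC_add_right)
lift_definition minus_cblinfun :: "'a cblinfun \<Rightarrow> 'a cblinfun \<Rightarrow> 'a cblinfun" is "(-)"
  by (simp add: blinfun.diff_left scaleC_diff_right)
lift_definition uminus_cblinfun :: "'a cblinfun \<Rightarrow> 'a cblinfun" is "uminus"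
  by (simp add: blinfun.minus_left scaleC_minus_right)
lift_definition scaleR_cblinfun :: "real \<Rightarrow> 'a cblinfun \<Rightarrow> 'a cblinfun" is "(*\<^sub>R)"
  by (simp add: blinfun.scaleR_left scaleR_scaleC scaleC_scaleC mult.commute)
lift_definition norm_cblinfun :: "'a cblinfun \<Rightarrow> real" is norm .
definition dist_cblinfun :: "'a cblinfun \<Rightarrow> 'a cblinfun \<Rightarrow> real"
  where "dist_cblinfun A B = norm (A - B)"
definition sgn_cblinfun :: "'a cblinfun \<Rightarrow> 'a cblinfun"
  where "sgn_cblinfun A = inverse (norm A) *\<^sub>R A"
definition uniformity_cblinfun :: "('a cblinfun \<times> 'a cblinfun) filter"
  where "uniformity_cblinfun = (INF e\<in>{0<..}. principal {(A, B). dist A B < e})"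
definition open_cblinfun :: "'a cblinfun set \<Rightarrow> bool"
  where "open_cblinfun U = (\<forall>A\<in>U. \<forall>\<^sub>F (A', B) in uniformity. A' = A \<longrightarrow> B \<in> U)"

instance
proof
  show "uniformity = (INF e\<in>{0<..}. principal {(A :: 'a cblinfun, B). dist A B < e})"
    by (rule uniformity_cblinfun_def)
  show "open U = (\<forall>A\<in>U. \<forall>\<^sub>F (A', B) in uniformity. A' = A \<longrightarrow> B \<in> U)"
    for U :: "'a cblinfun set"
    by (rule open_cblinfun_def)
qed (unfold dist_cblinfun_def sgn_cblinfun_def,
     (transfer; auto simp: algebra_simps norm_triangle_ineq)+)

end

definition cblinfun_apply :: "'a::chilbert_space cblinfun \<Rightarrow> 'a \<Rightarrow> 'a"
  where "cblinfun_apply A = blinfun_apply (blinfun_of_cblinfun A)"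


section \<open>Unbounded operators\<close>

(* An operator is identified with its graph {(x, T x) | x in Dom T}; its domain is then
   Domain T from the theory of relations. *)
type_synonym 'a opgraph = "('a \<times> 'a) set"

definition linear_operator :: "'a::chilbert_space opgraph \<Rightarrow> bool"
  where "linear_operator T \<longleftrightarrow>
    single_valued T \<and> (0, 0) \<in> T \<and>
    (\<forall>x y x' y'. (x, y) \<in> T \<and> (x', y') \<in> T \<longrightarrow> (x + x', y + y') \<in> T) \<and>
    (\<forall>c x y. (x, y) \<in> T \<longrightarrow> (c *\<^sub>C x, c *\<^sub>C y) \<in> T)"

definition densely_defined :: "'a::chilbert_space opgraph \<Rightarrow> bool"
  where "densely_defined T \<longleftrightarrow> closure (Domain T) = UNIV"

definition closed_operator :: "'a::chilbert_space opgraph \<Rightarrow> bool"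
  where "closed_operator T \<longleftrightarrow> linear_operator T \<and> closed T"

definition adjoint_operator :: "'a::chilbert_space opgraph \<Rightarrow> 'a opgraph"
  where "adjoint_operator T = {(y, z). \<forall>(x, w)\<in>T. cinner w y = cinner x z}"

definition self_adjoint :: "'a::chilbert_space opgraph \<Rightarrow> bool"
  where "self_adjoint T \<longleftrightarrow>
    linear_operator T \<and> densely_defined T \<and> adjoint_operator T = T"

definition nonneg_operator :: "'a::chilbert_space opgraph \<Rightarrow> bool"
  where "nonneg_operator T \<longleftrightarrow> (\<forall>(x, y)\<in>T. cinner x y \<in> \<real>\<^sub>\<ge>\<^sub>0)"

(* The operator product S T, on its natural domain {x in Dom T | T x in Dom S}. *)
definition op_comp :: "'a opgraph \<Rightarrow> 'a opgraph \<Rightarrow> 'a opgraph"  (infixr \<open>\<odot>\<close> 75)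
  where "S \<odot> T = T O S"

definition graph_of :: "'a::chilbert_space cblinfun \<Rightarrow> 'a opgraph"
  where "graph_of A = {(x, y). y = cblinfun_apply A x}"

definition is_bounded :: "'a::chilbert_space opgraph \<Rightarrow> bool"
  where "is_bounded T \<longleftrightarrow> (\<exists>A. graph_of A = T)"

definition bounded_part :: "'a::chilbert_space opgraph \<Rightarrow> 'a cblinfun"
  where "bounded_part T = (if is_bounded T then THE A. graph_of A = T else 0)"


section \<open>Spectral calculus\<close>

definition orthogonal_projection :: "'a::chilbert_space cblinfun \<Rightarrow> bool"
  where "orthogonal_projection p \<longleftrightarrow>
    (\<forall>x. cblinfun_apply p (cblinfun_apply p x) = cblinfun_apply p x) \<and>
    (\<forall>x y. cinner (cblinfun_apply p x) y = cinner x (cblinfun_apply p y))"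

definition projection_valued_measure :: "(real set \<Rightarrow> 'a::chilbert_space cblinfun) \<Rightarrow> bool"
  where "projection_valued_measure E \<longleftrightarrow>
    (\<forall>S\<in>sets borel. orthogonal_projection (E S)) \<and>
    (\<forall>x. cblinfun_apply (E UNIV) x = x) \<and>
    (\<forall>S :: nat \<Rightarrow> real set. range S \<subseteq> sets borel \<and> disjoint_family S \<longrightarrow>
      (\<forall>x. (\<lambda>i. cblinfun_apply (E (S i)) x) sums cblinfun_apply (E (\<Union>i. S i)) x))"

definition diagonal_measure ::
    "(real set \<Rightarrow> 'a::chilbert_space cblinfun) \<Rightarrow> 'a \<Rightarrow> real measure"
  where "diagonal_measure E x =
    measure_of UNIV (sets borel) (\<lambda>S. ennreal (Re (cinner x (cblinfun_apply (E S) x))))"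

(* T is the integral of f with respect to E. The quadratic form determines T by complex
   polarization, since the square-integrability domain is dense. *)
definition has_spectral_integral ::
    "(real set \<Rightarrow> 'a::chilbert_space cblinfun) \<Rightarrow> (real \<Rightarrow> real) \<Rightarrow> 'a opgraph \<Rightarrow> bool"
  where "has_spectral_integral E f T \<longleftrightarrow>
    linear_operator T \<and>
    Domain T = {x. (\<integral>\<^sup>+ l. ennreal ((f l)\<^sup>2) \<partial>diagonal_measure E x) < \<infinity>} \<and>
    (\<forall>(x, y)\<in>T. cinner x y = complex_of_real (\<integral> l. f l \<partial>diagonal_measure E x))"

(* By the spectral theorem the spectral measure of a self-adjoint operator exists and is unique
   on Borel sets; the choice operator only leaves its values on other sets open, and these are
   never used. *)
definition spectral_measure ::
    "'a::chilbert_space opgraph \<Rightarrow> real set \<Rightarrow> 'a cblinfun"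
  where "spectral_measure H =
    (SOME E. projection_valued_measure E \<and> has_spectral_integral E (\<lambda>l. l) H)"

definition spectral_calculus ::
    "'a::chilbert_space opgraph \<Rightarrow> (real \<Rightarrow> real) \<Rightarrow> 'a opgraph"
  where "spectral_calculus H f = (THE T. has_spectral_integral (spectral_measure H) f T)"

definition heat_semigroup :: "'a::chilbert_space opgraph \<Rightarrow> real \<Rightarrow> 'a opgraph"
  where "heat_semigroup H t = spectral_calculus H (\<lambda>l. exp (- t * l))"

(* (H + 1)^b; for nonnegative H the spectral measure lives on {0..}, so the values of
   (l + 1) powr b at negative l are irrelevant. *)
definition shifted_power :: "'a::chilbert_space opgraph \<Rightarrow> real \<Rightarrow> 'a opgraph"
  where "shifted_power H b = spectral_calculus H (\<lambda>l. (l + 1) powr b)"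


section \<open>Bochner integral\<close>

(* The library's Bochner integral is restricted to second-countable codomains, which excludes
   operator norms on infinite-dimensional spaces. Almost everywhere approximation by simple
   functions makes f strongly measurable. *)
definition has_bochner :: "'b measure \<Rightarrow> ('b \<Rightarrow> 'c::real_normed_vector) \<Rightarrow> 'c \<Rightarrow> bool"
  where "has_bochner M f y \<longleftrightarrow>
    (\<exists>s :: nat \<Rightarrow> 'b \<Rightarrow> 'c.
      (\<forall>i. Bochner_Integration.simple_bochner_integrable M (s i)) \<and>
      (AE x in M. (\<lambda>i. s i x) \<longlonglongrightarrow> f x) \<and>
      (\<lambda>i. \<integral>\<^sup>+ x. ennreal (norm (f x - s i x)) \<partial>M) \<longlonglongrightarrow> 0 \<and>
      (\<lambda>i. Bochner_Integration.simple_bochner_integral M (s i)) \<longlonglongrightarrow> y)"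

definition bochner :: "'b measure \<Rightarrow> ('b \<Rightarrow> 'c::real_normed_vector) \<Rightarrow> 'c"
  where "bochner M f = (THE y. has_bochner M f y)"


section \<open>The iterated heat integrals\<close>

(* Coordinates are indexed from 0, so s_(k+1) is s k. *)
definition simplex_at :: "nat \<Rightarrow> real \<Rightarrow> (nat \<Rightarrow> real) set"
  where "simplex_at n t =
    {s. (\<forall>i<n. 0 \<le> s i \<and> s i \<le> t) \<and> (\<forall>i j. i \<le> j \<and> j < n \<longrightarrow> s i \<le> s j)}"

(* heat_word H t s u k [P, ..., Q] is
   e^(-(s k - u) H) P e^(-(s (k+1) - s k) H) ... Q e^(-(t - s m) H), s m the last time used. *)
fun heat_word :: "'a::chilbert_space opgraph \<Rightarrow> real \<Rightarrow> (nat \<Rightarrow> real) \<Rightarrow> real \<Rightarrow> nat \<Rightarrow>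
    'a opgraph list \<Rightarrow> 'a opgraph"
  where
    "heat_word H t s u k [] = heat_semigroup H (t - u)"
  | "heat_word H t s u k (P # Ps) =
       heat_semigroup H (s k - u) \<odot> P \<odot> heat_word H t s (s k) (Suc k) Ps"

(* The integrand is an everywhere defined bounded operator on the interior of the simplex, whose
   complement in the simplex is a null set; the value 0 that bounded_part may take there is
   irrelevant. *)
definition Phi :: "'a::chilbert_space opgraph \<Rightarrow> real \<Rightarrow> 'a opgraph list \<Rightarrow> 'a cblinfun"
  where "Phi H t Ps =
    (if t > 0
     then bochner (Pi\<^sub>M {..<length Ps} (\<lambda>_. lborel))
       (\<lambda>s. indicator (simplex_at (length Ps) t) s *\<^sub>R bounded_part (heat_word H t s 0 0 Ps))
     else 0)"

definition smooth_on :: "real set \<Rightarrow> (real \<Rightarrow> 'b::real_normed_vector) \<Rightarrow> bool"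
  where "smooth_on U f \<longleftrightarrow>
    (\<exists>g :: nat \<Rightarrow> real \<Rightarrow> 'b. g 0 = f \<and>
      (\<forall>k. \<forall>t\<in>U. (g k has_vector_derivative g (Suc k) t) (at t)))"

end

theory Submission
  imports Defs "HOL-Probability.Probability"
begin

text \<open>For a bounded operator \<open>0 \<le> A \<le> 1\<close> the numbers \<open>\<langle>x, A\<^sup>m x\<rangle>\<close> are completely monotone, hence
  moments of a measure on \<open>[0, 1]\<close> (Hausdorff; the measure is a weak limit of Bernstein weights), and
  polarization turns these measures into projections. Applied to \<open>A = (H + 1)\<^sup>-\<^sup>1\<close> this gives the
  spectral theorem for \<open>H\<close>.

  With \<open>B\<^sub>j = P\<^sub>j (H + 1)\<^bsup>-a\<^esup>\<close> bounded, the integrand of \<open>\<Phi>\<close> is a product of kernels \<open>W\<^sub>j(r) = B\<^sub>j (H + 1)\<^sup>a e\<^sup>-\<^sup>r\<^sup>H\<close>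
  evaluated at the successive gaps, with \<open>\<parallel>W\<^sub>j(r)\<parallel> \<le> C r\<^bsup>-a\<^esup>\<close>, so \<open>\<Phi>\<close> is the iterated convolution
  \<open>e\<^sup>-\<^sup>r\<^sup>H * W\<^sub>1 * \<dots> * W\<^sub>n\<close>. The class of functions \<open>F\<close> all of whose iterated Euler derivatives
  \<open>(r d/dr)\<^sup>k F\<close> are \<open>O(r\<^bsup>-a\<^esup>)\<close> at 0 is closed under convolution, which gives smoothness. Integration by
  parts against \<open>(H + 1)\<^sup>-\<^sup>1 e\<^sup>-\<^sup>q\<^sup>H\<close> yields \<open>\<Phi> = (H + 1)\<^sup>-\<^sup>1 (\<Phi> + G - \<Phi>')\<close> with \<open>G = W\<^sub>1 * \<dots> * W\<^sub>n\<close>; hence \<open>\<Phi>\<close>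
  maps into \<open>Dom H\<close> and \<open>H \<Phi> = G - \<Phi>'\<close>.\<close>

section \<open>Hilbert space geometry\<close>

text \<open>The objects of the statement come from choice and description operators:
  \<open>spectral_measure\<close> is some measure representing \<open>H\<close>, and
  \<open>bochner\<close> is whatever value fits. Nothing is known about them before existence and
  uniqueness are proved. Identities between operators are reduced throughout to real integrals of
  matrix entries. Three obstacles shape the rest. Kernels of size r^-a have derivatives that need
  not be integrable at 0; substituting q = r \<sigma> in a convolution turns d/dr into Euler
  derivatives of the factors, which are no more singular. In general the semigroup is not norm
  continuous at 0, and H under the integral has no meaning a priori; the resolvent R = (H + 1)^-1
  cures both, and an identity of the form \<Phi> = R (...) gives the range and the equation at once,
  as R maps into Dom H. Finally, the integrand multiplies unbounded operators and is known to be
  everywhere defined only at strictly increasing times; splitting (H + 1)^-a off the semigroup to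
  the right of each P_j makes all factors bounded there, and the remaining times form a null
  set.\<close>

lemma cinner_add_left: "cinner (x + y) z = cinner x z + cinner y (z :: 'a::chilbert_space)"
  by (metis cinner_commute cinner_add_right complex_cnj_add)

lemma cinner_scaleC_left: "cinner (c *\<^sub>C x) y = cnj c * cinner x (y :: 'a::chilbert_space)"
  by (metis cinner_commute cinner_scaleC_right complex_cnj_mult)

lemma cinner_scaleR_right: "cinner x (r *\<^sub>R y) = of_real r * cinner x (y :: 'a::chilbert_space)"
  by (simp add: scaleR_scaleC cinner_scaleC_right)

lemma cinner_scaleR_left: "cinner (r *\<^sub>R x) y = of_real r * cinner x (y :: 'a::chilbert_space)"
  by (simp add: scaleR_scaleC cinner_scaleC_left)

lemma scaleC_one [simp]: "1 *\<^sub>C x = (x :: 'a::chilbert_space)"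
  by (metis of_real_1 scaleR_one scaleR_scaleC)

lemma scaleC_minus_one: "(- 1) *\<^sub>C x = - (x :: 'a::chilbert_space)"
  by (metis of_real_1 of_real_minus scaleR_minus1_left scaleR_scaleC)

lemma cinner_zero_right [simp]: "cinner x 0 = (0 :: complex)"
  by (metis cinner_scaleR_right mult_zero_left of_real_0 scaleR_zero_left)

lemma cinner_zero_left [simp]: "cinner 0 x = (0 :: complex)"
  by (metis cinner_commute cinner_zero_right complex_cnj_zero)

lemma cinner_minus_right: "cinner x (- y) = - cinner x (y :: 'a::chilbert_space)"
  by (metis add.right_inverse cinner_add_right cinner_zero_right neg_eq_iff_add_eq_0)

lemma cinner_minus_left: "cinner (- x) y = - cinner x (y :: 'a::chilbert_space)"
  by (metis cinner_commute cinner_minus_right complex_cnj_minus)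

lemma cinner_diff_right: "cinner x (y - z) = cinner x y - cinner x (z :: 'a::chilbert_space)"
  using cinner_add_right[of x y "- z"] by (simp add: cinner_minus_right)

lemma cinner_diff_left: "cinner (x - y) z = cinner x z - cinner y (z :: 'a::chilbert_space)"
  using cinner_add_left[of x "- y" z] by (simp add: cinner_minus_left)

lemmas cinner_simps = cinner_add_left cinner_add_right cinner_diff_left cinner_diff_right
  cinner_minus_left cinner_minus_right cinner_scaleC_left cinner_scaleC_right
  cinner_scaleR_left cinner_scaleR_right

lemma Re_cinner_self: "Re (cinner x x) = (norm (x :: 'a::chilbert_space))\<^sup>2"
  by (simp add: cinner_self)

lemma Im_cinner_self [simp]: "Im (cinner x (x :: 'a::chilbert_space)) = 0"
  by (simp add: cinner_self)

lemma Re_cinner_commute: "Re (cinner x y) = Re (cinner y (x :: 'a::chilbert_space))"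
  by (metis cinner_commute complex_cnj(1) complex.sel(1) complex_surj)

lemma norm_scaleC: "norm (c *\<^sub>C x) = cmod c * norm (x :: 'a::chilbert_space)"
proof -
  have "complex_of_real ((norm (c *\<^sub>C x))\<^sup>2) = of_real ((cmod c * norm x)\<^sup>2)"
    using complex_norm_square[of c]
    by (simp only: cinner_self[symmetric] cinner_simps power_mult_distrib of_real_mult)
       (simp add: cinner_self mult_ac)
  then have "(norm (c *\<^sub>C x))\<^sup>2 = (cmod c * norm x)\<^sup>2"
    using of_real_eq_iff by blast
  then show ?thesis
    by (simp add: power2_eq_iff_nonneg)
qed

lemma norm_add_sq:
  "(norm (x + y))\<^sup>2 = (norm x)\<^sup>2 + 2 * Re (cinner x y) + (norm (y :: 'a::chilbert_space))\<^sup>2"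
  using Re_cinner_commute[of x y] by (simp add: Re_cinner_self[symmetric] cinner_simps)

lemma norm_diff_sq:
  "(norm (x - y))\<^sup>2 = (norm x)\<^sup>2 - 2 * Re (cinner x y) + (norm (y :: 'a::chilbert_space))\<^sup>2"
  using Re_cinner_commute[of x y] by (simp add: Re_cinner_self[symmetric] cinner_simps)

lemma parallelogram:
  "(norm (x + y))\<^sup>2 + (norm (x - y))\<^sup>2 = 2 * (norm x)\<^sup>2 + 2 * (norm (y :: 'a::chilbert_space))\<^sup>2"
  by (simp add: norm_add_sq norm_diff_sq)

lemma Re_cinner_le: "Re (cinner x y) \<le> norm x * norm (y :: 'a::chilbert_space)"
proof (cases "x = 0 \<or> y = 0")
  case False
  \<comment> \<open>Stretching \<open>x\<close> to the length of \<open>y\<close> makes the expanded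
    square equal to the claim up to the factor 2 \<open>a\<close>.\<close>
  define a where "a = norm y / norm x"
  have "a > 0" using False by (simp add: a_def)
  have "0 \<le> (norm (a *\<^sub>R x - y))\<^sup>2" by simp
  also have "\<dots> = 2 * (norm y)\<^sup>2 - 2 * (a * Re (cinner x y))"
    using False by (simp add: norm_diff_sq cinner_simps a_def power_mult_distrib power_divide)
  finally have "a * Re (cinner x y) \<le> (norm y)\<^sup>2" by simp
  also have "(norm y)\<^sup>2 = a * (norm x * norm y)"
    using False by (simp add: a_def power2_eq_square)
  finally show ?thesis using \<open>a > 0\<close> by simp
qed auto

lemma norm_cinner_le: "cmod (cinner x y) \<le> norm x * norm (y :: 'a::chilbert_space)"
proof -
  \<comment> \<open>A phase rotating \<open>cinner x y\<close> onto the nonnegative real axis. If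
    \<open>cinner x y = 0\<close>, then \<open>sgn\<close> is 0 as well, so \<open>c\<close>
    satisfies only \<open>cmod c \<le> 1\<close>.\<close>
  define c where "c = cnj (sgn (cinner x y))"
  have "cmod z = Re (cnj (sgn z) * z)" for z
  proof (cases "z = 0")
    case False
    then show ?thesis
      using arg_cong[OF complex_norm_square[of z], of Re]
      by (simp add: sgn_eq power2_eq_square mult.commute field_simps flip: of_real_mult)
  qed simp
  then have "cmod (cinner x y) = Re (c * cinner x y)"
    by (simp add: c_def)
  also have "\<dots> = Re (cinner x (c *\<^sub>C y))" by (simp add: cinner_simps)
  also have "\<dots> \<le> norm x * (cmod c * norm y)"
    using Re_cinner_le[of x "c *\<^sub>C y"] by (simp add: norm_scaleC)
  also have "\<dots> \<le> norm x * norm y"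
    by (auto simp: c_def norm_sgn intro!: mult_left_mono mult_left_le_one_le)
  finally show ?thesis .
qed

lemma bounded_bilinear_cinner:
  "bounded_bilinear (cinner :: 'a::chilbert_space \<Rightarrow> 'a \<Rightarrow> complex)"
proof
  show "\<exists>K. \<forall>a b. cmod (cinner a (b :: 'a)) \<le> norm a * norm b * K"
    by (rule exI[of _ 1]) (simp add: norm_cinner_le)
qed (simp_all add: cinner_simps scaleR_conv_of_real)

lemmas tendsto_cinner [tendsto_intros] = bounded_bilinear.tendsto[OF bounded_bilinear_cinner]

lemma tendsto_scaleC [tendsto_intros]:
  assumes "(f \<longlongrightarrow> l) F"
  shows "((\<lambda>n. c *\<^sub>C f n) \<longlongrightarrow> c *\<^sub>C (l :: 'a::chilbert_space)) F"
proof -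
  have "bounded_linear (\<lambda>x :: 'a. c *\<^sub>C x)"
    by (rule bounded_linear_intro[where K = "cmod c"])
      (simp_all add: scaleC_add_right scaleR_scaleC scaleC_scaleC norm_scaleC mult.commute)
  then show ?thesis using assms by (rule bounded_linear.tendsto)
qed

lemma cinner_eqI:
  assumes "\<And>x. cinner x y = cinner x z"
  shows "y = (z :: 'a::chilbert_space)"
proof -
  have "(norm (y - z))\<^sup>2 = 0"
    using assms[of "y - z"] by (simp add: Re_cinner_self[symmetric] cinner_diff_right)
  then show ?thesis by simp
qed

lemma Re_cinner_eqI:
  assumes "\<And>x. Re (cinner x y) = Re (cinner x z)"
  shows "y = (z :: 'a::chilbert_space)"
proof -
  have "(norm (y - z))\<^sup>2 = 0"
    using assms[of "y - z"] by (simp add: Re_cinner_self[symmetric] cinner_diff_right)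
  then show ?thesis by simp
qed

section \<open>Projection onto closed subspaces and the Riesz representation\<close>

definition clinear_on :: "'a::chilbert_space set \<Rightarrow> bool" where
  "clinear_on V \<longleftrightarrow> 0 \<in> V \<and> (\<forall>x\<in>V. \<forall>y\<in>V. x + y \<in> V) \<and> (\<forall>c. \<forall>x\<in>V. c *\<^sub>C x \<in> V)"

lemma clinear_on_scaleR: "clinear_on V \<Longrightarrow> x \<in> V \<Longrightarrow> r *\<^sub>R x \<in> V"
  unfolding clinear_on_def by (metis scaleR_scaleC)

text \<open>The midpoint of two near-minimizers lies in \<open>V\<close> again and cannot be much
  closer to \<open>v\<close>; by the parallelogram law the two are then close to each other, so a
  minimizing sequence is Cauchy.\<close>

lemma closest_point_ex:
  fixes V :: "'a::chilbert_space set"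
  assumes V: "clinear_on V" and cl: "closed V"
  shows "\<exists>p\<in>V. \<forall>q\<in>V. norm (v - p) \<le> norm (v - q)"
proof -
  define d where "d = (INF q\<in>V. (norm (v - q))\<^sup>2)"
  have ne: "V \<noteq> {}" using V by (auto simp: clinear_on_def)
  have bdd: "bdd_below ((\<lambda>q. (norm (v - q))\<^sup>2) ` V)" by (rule bdd_belowI[of _ 0]) auto
  have dle: "d \<le> (norm (v - q))\<^sup>2" if "q \<in> V" for q
    unfolding d_def using bdd that by (rule cINF_lower)
  have "\<exists>q\<in>V. (norm (v - q))\<^sup>2 < d + e" if "e > 0" for e
    using cINF_less_iff[OF ne bdd, of "d + e"] that by (auto simp: d_def)
  then have "\<forall>n. \<exists>q\<in>V. (norm (v - q))\<^sup>2 < d + 1 / real (Suc n)" by simp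
  then obtain q where q: "\<And>n. q n \<in> V" "\<And>n. (norm (v - q n))\<^sup>2 < d + 1 / real (Suc n)"
    by metis
  have est: "(norm (q m - q n))\<^sup>2 \<le> 2 / real (Suc m) + 2 / real (Suc n)" for m n
  proof -
    have mid: "(1/2) *\<^sub>R (q m + q n) \<in> V"
      using V q by (auto simp: clinear_on_def intro: clinear_on_scaleR)
    have "(v - q m) + (v - q n) = 2 *\<^sub>R (v - (1/2) *\<^sub>R (q m + q n))"
      by (simp add: algebra_simps scaleR_2)
    then have "(norm ((v - q m) + (v - q n)))\<^sup>2 = 4 * (norm (v - (1/2) *\<^sub>R (q m + q n)))\<^sup>2"
      by (simp add: power_mult_distrib)
    then have "(norm ((v - q m) + (v - q n)))\<^sup>2 \<ge> 4 * d"
      using dle[OF mid] by simp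
    moreover have "(norm ((v - q m) - (v - q n)))\<^sup>2 = (norm (q m - q n))\<^sup>2"
      by (simp add: norm_minus_commute)
    ultimately show ?thesis
      using parallelogram[of "v - q m" "v - q n"] q(2)[of m] q(2)[of n] by simp
  qed
  have "Cauchy q"
  proof (rule metric_CauchyI)
    fix e :: real assume "e > 0"
    then obtain N where N: "4 / e\<^sup>2 < real N" using reals_Archimedean2 by blast
    have "dist (q m) (q n) < e" if "m \<ge> N" "n \<ge> N" for m n
    proof -
      have N0: "real N > 0" using N \<open>e > 0\<close> by (smt (verit) divide_pos_pos zero_less_power)
      have 1: "2 / real (Suc k) < 2 / real N" if "k \<ge> N" for k
        using that N0 by (intro divide_strict_left_mono) auto
      have "(norm (q m - q n))\<^sup>2 < 4 / real N"
        using est[of m n] 1[OF that(1)] 1[OF that(2)] by simp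
      also have "\<dots> < e\<^sup>2"
        using N N0 \<open>e > 0\<close> by (simp add: field_simps)
      finally show ?thesis
        using \<open>e > 0\<close> by (simp add: dist_norm power_less_imp_less_base)
    qed
    then show "\<exists>M. \<forall>m\<ge>M. \<forall>n\<ge>M. dist (q m) (q n) < e" by blast
  qed
  then obtain p where p: "q \<longlonglongrightarrow> p" using Cauchy_convergent convergent_def by blast
  have "p \<in> V" using closed_sequentially[OF cl _ p] q by blast
  have "(\<lambda>n. (norm (v - q n))\<^sup>2) \<longlonglongrightarrow> (norm (v - p))\<^sup>2" by (intro tendsto_intros p)
  moreover have "(\<lambda>n. d + 1 / real (Suc n)) \<longlonglongrightarrow> d + 0"
    by (intro tendsto_add tendsto_const LIMSEQ_Suc[OF lim_1_over_n])
  ultimately have "(norm (v - p))\<^sup>2 \<le> d + 0"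
    using q(2) by (intro LIMSEQ_le[of _ _ "\<lambda>n. d + 1 / real (Suc n)"]) (auto intro: less_imp_le)
  then have "norm (v - p) \<le> norm (v - r)" if "r \<in> V" for r
    by (rule power2_le_imp_le[OF order_trans]) (use dle[OF that] in auto)
  with \<open>p \<in> V\<close> show ?thesis by auto
qed

text \<open>Moving the nearest point \<open>p\<close> along \<open>q\<close> by the coefficient of
  \<open>v - p\<close> on \<open>q\<close> would lower the squared distance by |cinner q (v - p)|^2
  / |q|^2, so this quantity vanishes.\<close>

lemma orthogonal_decomposition:
  fixes V :: "'a::chilbert_space set"
  assumes V: "clinear_on V" and cl: "closed V"
  obtains p where "p \<in> V" "\<And>q. q \<in> V \<Longrightarrow> cinner q (v - p) = 0"
proof -
  obtain p where p: "p \<in> V" "\<And>q. q \<in> V \<Longrightarrow> norm (v - p) \<le> norm (v - q)"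
    using closest_point_ex[OF V cl] by blast
  have "cinner q (v - p) = 0" if q: "q \<in> V" for q
  proof (cases "q = 0")
    case False
    define c where "c = cinner q (v - p) / of_real ((norm q)\<^sup>2)"
    have "p + c *\<^sub>C q \<in> V" using V p(1) q by (auto simp: clinear_on_def)
    from p(2)[OF this] have "(norm (v - p))\<^sup>2 \<le> (norm ((v - p) - c *\<^sub>C q))\<^sup>2"
      by (simp add: diff_diff_add)
    also have "\<dots> = (norm (v - p))\<^sup>2 - 2 * Re (c * cinner (v - p) q) + (cmod c)\<^sup>2 * (norm q)\<^sup>2"
      by (simp add: norm_diff_sq cinner_simps norm_scaleC power_mult_distrib)
    also have "c * cinner (v - p) q = of_real ((cmod (cinner q (v - p)))\<^sup>2 / (norm q)\<^sup>2)"
      using cinner_commute[of "v - p" q] complex_norm_square[of "cinner q (v - p)"]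
      by (simp add: c_def)
    also have "(cmod c)\<^sup>2 * (norm q)\<^sup>2 = (cmod (cinner q (v - p)))\<^sup>2 / (norm q)\<^sup>2"
      using False by (simp add: c_def norm_divide power_divide norm_power power2_eq_square norm_mult)
    finally have "(cmod (cinner q (v - p)))\<^sup>2 / (norm q)\<^sup>2 \<le> 0" by simp
    then have "(cmod (cinner q (v - p)))\<^sup>2 \<le> 0"
      using False by (simp add: divide_le_0_iff)
    then show ?thesis by simp
  qed simp
  with p(1) show ?thesis using that by blast
qed

text \<open>Off the kernel of \<open>f\<close> there is a vector \<open>w\<close> orthogonal to the
  kernel, and every \<open>x\<close> is a multiple of \<open>w\<close> up to a kernel element. Hence
  \<open>z\<close> need only be \<open>w\<close> rescaled so that both functionals agree on
  \<open>w\<close>.\<close>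

lemma riesz_representation:
  fixes f :: "'a::chilbert_space \<Rightarrow> complex"
  assumes add: "\<And>x y. f (x + y) = f x + f y" and scale: "\<And>c x. f (c *\<^sub>C x) = c * f x"
    and bound: "\<And>x. cmod (f x) \<le> K * norm x"
  shows "\<exists>z. \<forall>x. f x = cinner z x"
proof (cases "\<forall>x. f x = 0")
  case True then show ?thesis by (auto intro: exI[of _ 0])
next
  case False
  then obtain v where v: "f v \<noteq> 0" by blast
  have bl: "bounded_linear f"
    by (rule bounded_linear_intro[where K = K])
      (simp_all add: add scale scaleR_scaleC scaleR_conv_of_real bound mult.commute)
  define V where "V = {x. f x = 0}"
  have "clinear_on V"
    using bl by (auto simp: clinear_on_def V_def add scale linear_0 bounded_linear.linear)
  moreover have "closed V"
    unfolding V_def by (intro closed_Collect_eq bounded_linear.continuous_on[OF bl]) auto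
  ultimately obtain p where p: "p \<in> V" "\<And>q. q \<in> V \<Longrightarrow> cinner q (v - p) = 0"
    using orthogonal_decomposition by blast
  define w where "w = v - p"
  have fw: "f w = f v"
    using p(1) bl by (simp add: w_def V_def linear_diff bounded_linear.linear)
  then have w0: "w \<noteq> 0" using v linear_0[OF bounded_linear.linear[OF bl]] by auto
  have ww: "cinner w w \<noteq> 0" using w0 by (simp add: cinner_self)
  define z where "z = cnj (f w / cinner w w) *\<^sub>C w"
  have "f x = cinner z x" for x
  proof -
    have "f (x - (f x / f w) *\<^sub>C w) = 0"
      using fw v by (simp add: linear_diff[OF bounded_linear.linear[OF bl]] scale)
    then have "cinner (x - (f x / f w) *\<^sub>C w) w = 0"
      using p(2) by (simp add: V_def w_def)
    then have "cinner w (x - (f x / f w) *\<^sub>C w) = 0"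
      by (metis cinner_commute complex_cnj_zero)
    then have "cinner w x = f x / f w * cinner w w" by (simp add: cinner_simps)
    then show ?thesis using fw v ww by (simp add: z_def cinner_simps)
  qed
  then show ?thesis by blast
qed


section \<open>Bounded operators\<close>

notation cblinfun_apply (infixr \<open>\<rhd>\<close> 90)

lemma cblinfun_eqI: "(\<And>x. A \<rhd> x = B \<rhd> x) \<Longrightarrow> A = B"
  unfolding cblinfun_apply_def by transfer (auto intro: blinfun_eqI)

lemma cblinfun_add_right: "A \<rhd> (x + y) = A \<rhd> x + A \<rhd> y"
  by (simp add: cblinfun_apply_def blinfun.add_right)

lemma cblinfun_scaleC_right: "A \<rhd> (c *\<^sub>C x) = c *\<^sub>C A \<rhd> x"
  unfolding cblinfun_apply_def by transfer auto

lemma cblinfun_add_left: "(A + B) \<rhd> x = A \<rhd> x + B \<rhd> x"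
  unfolding cblinfun_apply_def by transfer (simp add: blinfun.add_left)

lemma cblinfun_scaleR_left: "(r *\<^sub>R A) \<rhd> x = r *\<^sub>R A \<rhd> x"
  unfolding cblinfun_apply_def by transfer (simp add: blinfun.scaleR_left)

lemma cblinfun_zero_left [simp]: "0 \<rhd> x = 0"
  unfolding cblinfun_apply_def by transfer simp

lemma norm_cblinfun: "norm (A \<rhd> x) \<le> norm A * norm x"
  unfolding cblinfun_apply_def by transfer (rule norm_blinfun)

lemma norm_cblinfun_bound: "0 \<le> b \<Longrightarrow> (\<And>x. norm (A \<rhd> x) \<le> b * norm x) \<Longrightarrow> norm A \<le> b"
  unfolding cblinfun_apply_def by transfer (rule norm_blinfun_bound)

lemma bounded_bilinear_cblinfun_apply: "bounded_bilinear cblinfun_apply"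
proof
  show "\<exists>K. \<forall>a b. norm (a \<rhd> b) \<le> norm a * norm b * K"
    by (rule exI[of _ 1]) (simp add: norm_cblinfun)
qed (simp_all add: cblinfun_add_left cblinfun_add_right cblinfun_scaleR_left scaleR_scaleC
    cblinfun_scaleC_right)

interpretation cblinfun: bounded_bilinear cblinfun_apply
  by (rule bounded_bilinear_cblinfun_apply)

lemmas tendsto_cblinfun [tendsto_intros] = cblinfun.tendsto

lemmas cblinfun_simps = cblinfun.add_left cblinfun.add_right cblinfun.diff_left cblinfun.diff_right
  cblinfun.minus_left cblinfun.minus_right cblinfun.scaleR_left cblinfun.scaleR_right
  cblinfun_scaleC_right cblinfun.sum_left

lemma cblinfun_exI:
  fixes f :: "'a::chilbert_space \<Rightarrow> 'a"
  assumes "\<And>x y. f (x + y) = f x + f y" and "\<And>c x. f (c *\<^sub>C x) = c *\<^sub>C f x"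
    and "\<And>x. norm (f x) \<le> K * norm x"
  shows "\<exists>A. \<forall>x. A \<rhd> x = f x"
proof -
  have bl: "bounded_linear f"
    by (rule bounded_linear_intro[where K = K]) (simp_all add: assms scaleR_scaleC mult.commute)
  have "cblinfun_of_blinfun (Blinfun f) \<rhd> x = f x" for x
    unfolding cblinfun_apply_def
    by (subst cblinfun_of_blinfun_inverse) (auto simp: bounded_linear_Blinfun_apply[OF bl] assms)
  then show ?thesis by blast
qed

instantiation cblinfun :: (chilbert_space) real_normed_algebra
begin

lift_definition times_cblinfun :: "'a cblinfun \<Rightarrow> 'a cblinfun \<Rightarrow> 'a cblinfun" is
  "\<lambda>A B. blinfun_compose A B"
  by simp

lemma times_cblinfun_apply: "(A * B) \<rhd> x = A \<rhd> B \<rhd> x"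
  unfolding cblinfun_apply_def by transfer simp

instance
proof
  show "(A * B) * C = A * (B * C)" "(A + B) * C = A * C + B * C" "A * (B + C) = A * B + A * C"
    "(r *\<^sub>R A) * B = r *\<^sub>R (A * B)" "A * (r *\<^sub>R B) = r *\<^sub>R (A * B)"
    for A B C :: "'a cblinfun" and r
    by (auto intro!: cblinfun_eqI simp: times_cblinfun_apply cblinfun_simps)
  show "norm (A * B) \<le> norm A * norm B" for A B :: "'a cblinfun"
  proof (rule norm_cblinfun_bound)
    fix x
    have "norm (A \<rhd> B \<rhd> x) \<le> norm A * norm (B \<rhd> x)" by (rule norm_cblinfun)
    also have "\<dots> \<le> norm A * (norm B * norm x)"
      by (intro mult_left_mono norm_cblinfun) auto
    finally show "norm ((A * B) \<rhd> x) \<le> norm A * norm B * norm x"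
      by (simp add: times_cblinfun_apply mult.assoc)
  qed simp
qed

end

text \<open>The identity is kept apart from the class constant \<open>1\<close>: on the zero space
  its norm is 0, so the axioms of a normed algebra with unit would fail.\<close>

lift_definition cid :: "'a::chilbert_space cblinfun" is id_blinfun
  by simp

lemma cid_apply [simp]: "cid \<rhd> x = x"
  unfolding cblinfun_apply_def by transfer simp

lemma cid_left [simp]: "cid * A = A" and cid_right [simp]: "A * cid = A"
  by (auto intro!: cblinfun_eqI simp: times_cblinfun_apply)

instance cblinfun :: (chilbert_space) banach
proof
  fix X :: "nat \<Rightarrow> 'a cblinfun" assume "Cauchy X"
  define Y where "Y n = blinfun_of_cblinfun (X n)" for n
  have d: "dist (Y m) (Y n) = dist (X m) (X n)" for m n
    by (simp add: Y_def dist_norm norm_cblinfun.rep_eq minus_cblinfun.rep_eq)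
  have "Cauchy Y" using \<open>Cauchy X\<close> by (simp add: Cauchy_def d)
  then obtain L where L: "Y \<longlonglongrightarrow> L" using Cauchy_convergent convergent_def by blast
  have "blinfun_apply L (c *\<^sub>C x) = c *\<^sub>C blinfun_apply L x" for c x
  proof (rule LIMSEQ_unique)
    show "(\<lambda>n. Y n (c *\<^sub>C x)) \<longlonglongrightarrow> L (c *\<^sub>C x)"
      by (intro blinfun.tendsto L tendsto_const)
    have "(\<lambda>n. c *\<^sub>C Y n x) \<longlonglongrightarrow> c *\<^sub>C L x"
      by (intro tendsto_scaleC blinfun.tendsto L tendsto_const)
    then show "(\<lambda>n. Y n (c *\<^sub>C x)) \<longlonglongrightarrow> c *\<^sub>C L x"
      using cblinfun_scaleC_right[of "X _" c x] by (simp add: Y_def cblinfun_apply_def)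
  qed
  then have "blinfun_of_cblinfun (cblinfun_of_blinfun L) = L"
    by (intro cblinfun_of_blinfun_inverse) auto
  then have "dist (X n) (cblinfun_of_blinfun L) = dist (Y n) L" for n
    by (simp add: Y_def dist_norm norm_cblinfun.rep_eq minus_cblinfun.rep_eq)
  then have "X \<longlonglongrightarrow> cblinfun_of_blinfun L"
    using L by (simp add: tendsto_iff)
  then show "convergent X" by (auto simp: convergent_def)
qed

lemma graph_of_iff: "(x, y) \<in> graph_of A \<longleftrightarrow> y = A \<rhd> x"
  by (simp add: graph_of_def)

lemma graph_of_inject: "graph_of A = graph_of B \<longleftrightarrow> A = B"
  by (metis cblinfun_eqI graph_of_iff)

lemma graph_of_op_comp: "graph_of A \<odot> graph_of B = graph_of (A * B)"
  by (auto simp: graph_of_def op_comp_def times_cblinfun_apply relcomp_unfold)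

lemma bounded_part_graph_of [simp]: "bounded_part (graph_of A) = A"
  unfolding bounded_part_def is_bounded_def graph_of_inject by auto

lemma linear_operator_graph_of: "linear_operator (graph_of A)"
  by (auto simp: linear_operator_def graph_of_def single_valued_def cblinfun_simps cblinfun.zero_right)


section \<open>Sesquilinear forms\<close>

definition sesqui :: "('a::chilbert_space \<Rightarrow> 'a \<Rightarrow> complex) \<Rightarrow> bool" where
  "sesqui b \<longleftrightarrow>
    (\<forall>x y z. b x (y + z) = b x y + b x z) \<and> (\<forall>c x y. b x (c *\<^sub>C y) = c * b x y) \<and>
    (\<forall>x y z. b (x + y) z = b x z + b y z) \<and> (\<forall>c x y. b (c *\<^sub>C x) y = cnj c * b x y)"

lemma sesqui_polarization:
  assumes "sesqui b"
  shows "b x y = (\<Sum>k<4. \<i>^k * b (\<i>^k *\<^sub>C x + y) (\<i>^k *\<^sub>C x + y)) / 4"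
proof -
  have "{..<4::nat} = {0,1,2,3}" by auto
  moreover have "\<i>^3 = - \<i>" by (simp add: power3_eq_cube)
  ultimately show ?thesis
    using assms by (simp add: sesqui_def algebra_simps)
qed

lemma sesqui_eqI:
  assumes "sesqui b" "sesqui b'" "\<And>x. b x x = b' x x"
  shows "b x y = b' x y"
  by (subst (1 2) sesqui_polarization) (use assms in auto)

text \<open>Polarization and the parallelogram law give K (|x|^2 + |y|^2); since \<open>b\<close> is
  unchanged when \<open>x\<close> is stretched by r and \<open>y\<close> by 1/r, the sum of squares
  can be optimized to 2 |x| |y|. This factor 2 persists in all norm estimates of the
  calculus.\<close>

lemma sesqui_bound:
  assumes b: "sesqui b" and K: "\<And>x. cmod (b x x) \<le> K * (norm x)\<^sup>2" "K \<ge> 0"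
  shows "cmod (b x y) \<le> 2 * K * norm x * norm y"
proof -
  have 1: "cmod (b x y) \<le> K * ((norm x)\<^sup>2 + (norm y)\<^sup>2)" for x y
  proof -
    have "cmod (\<Sum>k<4. \<i>^k * b (\<i>^k *\<^sub>C x + y) (\<i>^k *\<^sub>C x + y))
        \<le> (\<Sum>k<4. K * (norm (\<i>^k *\<^sub>C x + y))\<^sup>2)"
      by (rule order_trans[OF norm_sum]) (auto intro!: sum_mono simp: norm_mult norm_power K)
    also have "\<dots> = K * (4 * ((norm x)\<^sup>2 + (norm y)\<^sup>2))"
    proof -
      have "{..<4::nat} = {0,1,2,3}" by auto
      moreover have "\<i>^3 = - \<i>" by (simp add: power3_eq_cube)
      ultimately have "(\<Sum>k<4. K * (norm (\<i>^k *\<^sub>C x + y))\<^sup>2) =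
          K * ((norm (y + x))\<^sup>2 + (norm (y - x))\<^sup>2)
            + K * ((norm (y + \<i> *\<^sub>C x))\<^sup>2 + (norm (y - \<i> *\<^sub>C x))\<^sup>2)"
        using scaleC_scaleC[of "- 1" \<i> x, symmetric]
        by (simp add: scaleC_minus_one add.commute distrib_left)
      then show ?thesis
        by (simp only: parallelogram) (simp add: norm_scaleC algebra_simps)
    qed
    finally show ?thesis
      by (subst sesqui_polarization[OF b]) (simp add: norm_divide algebra_simps)
  qed
  have z: "b 0 y = 0" "b x 0 = 0" for x y
    using b unfolding sesqui_def by (metis add_cancel_right_left)+
  show ?thesis
  proof (cases "x = 0 \<or> y = 0")
    case False
    \<comment> \<open>The scaling for which r \<open>x\<close> and \<open>y\<close> / r have equal
      length, which minimizes the sum of squares.\<close>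
    define r where "r = sqrt (norm y / norm x)"
    have r: "r > 0" "r\<^sup>2 = norm y / norm x" using False by (auto simp: r_def)
    have "b x y = b (of_real r *\<^sub>C x) (of_real (1 / r) *\<^sub>C y)"
      using b r by (simp add: sesqui_def)
    also have "cmod \<dots> \<le> K * ((norm (of_real r *\<^sub>C x))\<^sup>2 + (norm (of_real (1 / r) *\<^sub>C y))\<^sup>2)"
      by (rule 1)
    also have "\<dots> = K * (r\<^sup>2 * (norm x)\<^sup>2 + (norm y)\<^sup>2 / r\<^sup>2)"
      by (simp add: norm_scaleC power_mult_distrib power_divide norm_divide)
    also have "\<dots> = 2 * K * norm x * norm y"
      unfolding r(2) using False by (simp add: power2_eq_square field_simps)
    finally show ?thesis .
  qed (auto simp: z)
qed

lemma sesqui_cinner_apply: "sesqui (\<lambda>x y. cinner x (A \<rhd> y))" "sesqui (\<lambda>x y. cinner (A \<rhd> x) y)"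
  by (auto simp: sesqui_def cinner_simps cblinfun_simps)

lemma cblinfun_eq_quadratic:
  assumes "\<And>x. cinner x (A \<rhd> x) = cinner x (B \<rhd> x)"
  shows "A = B"
proof (rule cblinfun_eqI, rule cinner_eqI)
  show "cinner y (A \<rhd> x) = cinner y (B \<rhd> x)" for x y
    by (rule sesqui_eqI[OF sesqui_cinner_apply(1) sesqui_cinner_apply(1)]) (rule assms)
qed

lemma cblinfun_symmetric_quadratic:
  assumes "\<And>x. cinner x (A \<rhd> x) \<in> \<real>"
  shows "cinner (A \<rhd> x) y = cinner x (A \<rhd> y)"
proof (rule sesqui_eqI[OF sesqui_cinner_apply(2) sesqui_cinner_apply(1)])
  show "cinner (A \<rhd> x) x = cinner x (A \<rhd> x)" for x
    using assms[of x] by (metis Reals_cnj_iff cinner_commute)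
qed

text \<open>Obtained from \<open>sesqui_bound\<close> by testing with \<open>A \<rhd> x\<close>
  itself. No symmetry of \<open>A\<close> enters, so the numerical radius controls the norm up to
  the factor 2.\<close>

lemma norm_le_quadratic:
  assumes "\<And>x. cmod (cinner x (A \<rhd> x)) \<le> K * (norm x)\<^sup>2" "K \<ge> 0"
  shows "norm A \<le> 2 * K"
proof (rule norm_cblinfun_bound)
  show "norm (A \<rhd> x) \<le> 2 * K * norm x" for x
  proof (cases "A \<rhd> x = 0")
    case False
    have "cmod (cinner (A \<rhd> x) (A \<rhd> x)) \<le> 2 * K * norm (A \<rhd> x) * norm x"
      by (rule sesqui_bound[OF sesqui_cinner_apply(1) assms])
    then have "norm (A \<rhd> x) * norm (A \<rhd> x) \<le> norm (A \<rhd> x) * (2 * K * norm x)"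
      by (simp add: cinner_self power2_eq_square norm_mult mult_ac)
    then show ?thesis using False by simp
  qed (use assms in simp)
qed (use assms in simp)

text \<open>For fixed \<open>y\<close> the form is antilinear in \<open>x\<close>, so the Riesz
  representation is applied to its complex conjugate.\<close>

lemma sesqui_operator:
  assumes b: "sesqui b" and K: "\<And>x. cmod (b x x) \<le> K * (norm x)\<^sup>2" "K \<ge> 0"
  shows "\<exists>B. \<forall>x y. b x y = cinner x (B \<rhd> y)"
proof -
  have "\<exists>z. \<forall>x. b x y = cinner x z" for y
  proof -
    have "\<exists>z. \<forall>x. cnj (b x y) = cinner z x"
      using b sesqui_bound[OF b K]
      by (intro riesz_representation[where K = "2 * K * norm y"])
        (auto simp: sesqui_def mult_ac)
    then show ?thesis by (metis cinner_commute complex_cnj_cnj)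
  qed
  then obtain f where f: "\<And>x y. b x y = cinner x (f y)" by metis
  have "\<exists>B. \<forall>y. B \<rhd> y = f y"
  proof (rule cblinfun_exI)
    show "f (x + y) = f x + f y" for x y
      using b by (intro cinner_eqI) (simp add: cinner_simps f[symmetric] sesqui_def)
    show "f (c *\<^sub>C x) = c *\<^sub>C f x" for c x
      using b by (intro cinner_eqI) (simp add: cinner_simps f[symmetric] sesqui_def)
    show "norm (f y) \<le> 2 * K * norm y" for y
    proof (cases "f y = 0")
      case False
      have "cmod (b (f y) y) \<le> 2 * K * norm (f y) * norm y" by (rule sesqui_bound[OF b K])
      then have "norm (f y) * norm (f y) \<le> norm (f y) * (2 * K * norm y)"
        by (simp add: f cinner_self power2_eq_square norm_mult mult_ac)
      then show ?thesis using False by simp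
    qed (use K in simp)
  qed
  then show ?thesis using f by metis
qed


section \<open>Bounded Borel calculus of a projection-valued measure\<close>

definition bounded_borel :: "(real \<Rightarrow> real) \<Rightarrow> bool" where
  "bounded_borel f \<longleftrightarrow> f \<in> borel_measurable borel \<and> bounded (range f)"

lemma bounded_borelI:
  "f \<in> borel_measurable borel \<Longrightarrow> (\<And>l. \<bar>f l\<bar> \<le> K) \<Longrightarrow> bounded_borel f"
  by (auto simp: bounded_borel_def bounded_iff)

lemma bounded_borelD:
  assumes "bounded_borel f"
  shows "f \<in> borel_measurable borel" "\<exists>K\<ge>0. \<forall>l. \<bar>f l\<bar> \<le> K"
proof -
  show "f \<in> borel_measurable borel" using assms by (simp add: bounded_borel_def)
  obtain K where "\<forall>l. \<bar>f l\<bar> \<le> K"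
    using assms by (auto simp: bounded_borel_def bounded_iff)
  then show "\<exists>K\<ge>0. \<forall>l. \<bar>f l\<bar> \<le> K" by (meson abs_ge_zero order_trans)
qed

lemma bounded_borel_intros [intro]:
  "bounded_borel (\<lambda>_. c)"
  "S \<in> sets borel \<Longrightarrow> bounded_borel (indicator S)"
  "bounded_borel f \<Longrightarrow> bounded_borel g \<Longrightarrow> bounded_borel (\<lambda>l. f l + g l)"
  "bounded_borel f \<Longrightarrow> bounded_borel g \<Longrightarrow> bounded_borel (\<lambda>l. f l - g l)"
  "bounded_borel f \<Longrightarrow> bounded_borel g \<Longrightarrow> bounded_borel (\<lambda>l. f l * g l)"
proof -
  show "bounded_borel (\<lambda>_. c)" by (rule bounded_borelI[of _ "\<bar>c\<bar>"]) auto
  show "S \<in> sets borel \<Longrightarrow> bounded_borel (indicator S)"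
    by (rule bounded_borelI[of _ 1]) (auto simp: indicator_def)
  assume f: "bounded_borel f" and g: "bounded_borel g"
  note [measurable] = bounded_borelD(1)[OF f] bounded_borelD(1)[OF g]
  obtain K L where KL: "K \<ge> 0" "L \<ge> 0" "\<And>l. \<bar>f l\<bar> \<le> K" "\<And>l. \<bar>g l\<bar> \<le> L"
    using bounded_borelD(2)[OF f] bounded_borelD(2)[OF g] by blast
  have "\<bar>f l + g l\<bar> \<le> K + L" "\<bar>f l - g l\<bar> \<le> K + L" for l
    using KL(3)[of l] KL(4)[of l] by linarith+
  moreover have "\<bar>f l * g l\<bar> \<le> K * L" for l
    using KL by (simp add: abs_mult mult_mono)
  ultimately show "bounded_borel (\<lambda>l. f l + g l)" "bounded_borel (\<lambda>l. f l - g l)"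
    "bounded_borel (\<lambda>l. f l * g l)"
    by (auto intro!: bounded_borelI)
qed

text \<open>Rounding \<open>f\<close> down to multiples of 1/(n + 1) gives simple functions, with
  finitely many values because \<open>f\<close> is bounded. The limit case may assume this explicit
  uniform rate, which is what makes the corresponding operators a Cauchy sequence in norm.\<close>

lemma bounded_borel_induct [consumes 1, case_names indicator scale add limit]:
  assumes f: "bounded_borel f"
    and ind: "\<And>S. S \<in> sets borel \<Longrightarrow> P (indicator S)"
    and scale: "\<And>c f. bounded_borel f \<Longrightarrow> P f \<Longrightarrow> P (\<lambda>l. c * f l)"
    and add: "\<And>f g. bounded_borel f \<Longrightarrow> bounded_borel g \<Longrightarrow> P f \<Longrightarrow> P g \<Longrightarrow> P (\<lambda>l. f l + g l)"
    and lim: "\<And>f g. (\<And>n. bounded_borel (g n)) \<Longrightarrow> (\<And>n. P (g n)) \<Longrightarrow> bounded_borel f \<Longrightarrow>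
      (\<And>n l. \<bar>g n l - f l\<bar> \<le> 1 / real (Suc n)) \<Longrightarrow> P f"
  shows "P f"
proof -
  note [measurable] = bounded_borelD(1)[OF f]
  obtain K where K: "K \<ge> 0" "\<And>l. \<bar>f l\<bar> \<le> K" using bounded_borelD(2)[OF f] by blast
  define N where "N n = {- \<lceil>real (Suc n) * K\<rceil> - 1 .. \<lceil>real (Suc n) * K\<rceil> + 1}" for n
  define S where "S n k = {l. \<lfloor>real (Suc n) * f l\<rfloor> = k}" for n k
  have S [measurable]: "S n k \<in> sets borel" for n k
    unfolding S_def by measurable
  define g where "g n l = (\<Sum>k\<in>N n. (of_int k / real (Suc n)) * indicator (S n k) l)" for n l
  have geq: "g n l = of_int \<lfloor>real (Suc n) * f l\<rfloor> / real (Suc n)" for n l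
  proof -
    have "\<bar>real (Suc n) * f l\<bar> \<le> real (Suc n) * K"
      using K(2)[of l] by (simp add: abs_mult)
    then have "\<lfloor>real (Suc n) * f l\<rfloor> \<in> N n"
      unfolding N_def by (simp only: atLeastAtMost_iff) linarith
    moreover have "g n l = (\<Sum>k\<in>N n. if k = \<lfloor>real (Suc n) * f l\<rfloor> then of_int k / real (Suc n) else 0)"
      unfolding g_def by (intro sum.cong) (auto simp: S_def indicator_def)
    ultimately show ?thesis by (simp add: N_def)
  qed
  have fin: "bounded_borel (\<lambda>l. \<Sum>k\<in>I. c k * indicator (T k) l) \<and> P (\<lambda>l. \<Sum>k\<in>I. c k * indicator (T k) l)"
    if "finite I" "\<And>k. T k \<in> sets borel" for I :: "int set" and c T
    using that(1)
  proof induction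
    case empty
    have "P (\<lambda>l. 0 * indicator {} l)" by (intro scale ind bounded_borel_intros) auto
    then show ?case by auto
  next
    case (insert k I)
    have "bounded_borel (\<lambda>l. c k * indicator (T k) l)" by (intro bounded_borel_intros that)
    moreover have "P (\<lambda>l. c k * indicator (T k) l)"
      by (intro scale ind bounded_borel_intros that)
    ultimately show ?case
      using insert(3) unfolding sum.insert[OF insert(1,2)] by (intro conjI add bounded_borel_intros that) auto
  qed
  have "bounded_borel (g n) \<and> P (g n)" for n
    unfolding g_def[abs_def] by (intro fin S) (simp add: N_def)
  then show ?thesis
  proof (intro lim[of g f])
    show "\<bar>g n l - f l\<bar> \<le> 1 / real (Suc n)" for n l
    proof -
      have "g n l - f l = (of_int \<lfloor>real (Suc n) * f l\<rfloor> - real (Suc n) * f l) / real (Suc n)"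
        unfolding geq by (simp add: diff_divide_distrib)
      moreover have "\<bar>of_int \<lfloor>real (Suc n) * f l\<rfloor> - real (Suc n) * f l\<bar> \<le> 1" by linarith
      ultimately show ?thesis by (simp add: divide_right_mono)
    qed
  qed (use f in auto)
qed

lemma integrable_bounded_borel:
  assumes "bounded_borel f" "sets M = sets borel" "finite_measure M"
  shows "integrable M f"
proof -
  interpret finite_measure M by fact
  obtain K where "\<And>l. \<bar>f l\<bar> \<le> K" using bounded_borelD(2)[OF assms(1)] by blast
  moreover have "f \<in> borel_measurable M"
    using bounded_borelD(1)[OF assms(1)] assms(2) by (simp cong: measurable_cong_sets)
  ultimately show ?thesis by (intro integrable_const_bound[where B = K]) auto
qed

section \<open>Algebra of the spectral projections\<close>

locale pvm =
  fixes E :: "real set \<Rightarrow> 'a::chilbert_space cblinfun"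
  assumes pvm: "projection_valued_measure E"
begin

lemma E_idem: "S \<in> sets borel \<Longrightarrow> E S * E S = E S"
  using pvm by (intro cblinfun_eqI)
    (auto simp: projection_valued_measure_def orthogonal_projection_def times_cblinfun_apply)

lemma E_sym: "S \<in> sets borel \<Longrightarrow> cinner (E S \<rhd> x) y = cinner x (E S \<rhd> y)"
  using pvm by (auto simp: projection_valued_measure_def orthogonal_projection_def)

lemma cinner_E: "S \<in> sets borel \<Longrightarrow> cinner x (E S \<rhd> x) = of_real ((norm (E S \<rhd> x))\<^sup>2)"
  using E_sym[of S x "E S \<rhd> x"] E_idem[of S]
  by (simp add: cinner_self times_cblinfun_apply[symmetric])

lemma E_UNIV [simp]: "E UNIV = cid"
  using pvm by (intro cblinfun_eqI) (auto simp: projection_valued_measure_def)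

lemma E_sums:
  "range S \<subseteq> sets borel \<Longrightarrow> disjoint_family S \<Longrightarrow> (\<lambda>i. E (S i) \<rhd> x) sums (E (\<Union>i. S i) \<rhd> x)"
  for S :: "nat \<Rightarrow> real set"
  using pvm unfolding projection_valued_measure_def by blast

lemma E_empty [simp]: "E {} = 0"
proof (rule cblinfun_eqI)
  fix x
  have "(\<lambda>i::nat. E {} \<rhd> x) sums (E {} \<rhd> x)"
    using E_sums[of "\<lambda>_. {}" x] by (simp add: disjoint_family_on_def)
  then have "(\<lambda>i::nat. E {} \<rhd> x) \<longlonglongrightarrow> 0" by (intro summable_LIMSEQ_zero sums_summable)
  then show "E {} \<rhd> x = 0 \<rhd> x" by (simp add: LIMSEQ_const_iff)
qed

lemma E_Un:
  assumes "S \<in> sets borel" "T \<in> sets borel" "S \<inter> T = {}"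
  shows "E (S \<union> T) = E S + E T"
proof (rule cblinfun_eqI)
  fix x
  have "(\<lambda>i. E (binaryset S T i) \<rhd> x) sums (E (\<Union>i. binaryset S T i) \<rhd> x)"
    using assms by (intro E_sums) (auto simp: range_binaryset_eq disjoint_family_on_def binaryset_def)
  moreover have "(\<lambda>i. E (binaryset S T i) \<rhd> x) sums (E S \<rhd> x + E T \<rhd> x)"
    by (rule binaryset_sums) simp
  ultimately show "E (S \<union> T) \<rhd> x = (E S + E T) \<rhd> x"
    by (simp add: sums_unique2 UN_binaryset_eq cblinfun_simps)
qed

text \<open>Idempotence of the sum gives E S E T + E T E S = 0. Multiplying by \<open>E S\<close> on
  either side shows that the two projections commute, so twice their product is 0.\<close>

lemma E_disjoint:
  assumes "S \<in> sets borel" "T \<in> sets borel" "S \<inter> T = {}"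
  shows "E S * E T = 0"
proof -
  have "(E S + E T) * (E S + E T) = E S + E T"
    using E_idem[of "S \<union> T"] assms by (simp add: E_Un)
  then have *: "E S * E T + E T * E S = 0"
    using assms by (simp add: distrib_left distrib_right E_idem add_ac)
  have "E S * (E S * E T + E T * E S) = 0" "(E S * E T + E T * E S) * E S = 0"
    by (simp_all add: *)
  then have "E S * E T + E S * E T * E S = 0" "E S * E T * E S + E T * E S = 0"
    using assms E_idem[of S]
    by (simp_all add: distrib_left distrib_right mult.assoc[symmetric])
      (simp add: mult.assoc)
  then have "E S * E T = E T * E S" by (metis add.commute add_left_cancel)
  with * have "2 *\<^sub>R (E S * E T) = 0" by (simp add: scaleR_2)
  then show ?thesis by simp
qed

lemma E_Int:
  assumes [measurable]: "S \<in> sets borel" "T \<in> sets borel"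
  shows "E S * E T = E (S \<inter> T)"
proof -
  have "S = (S \<inter> T) \<union> (S - T)" "T = (S \<inter> T) \<union> (T - S)" by auto
  then have "E S = E (S \<inter> T) + E (S - T)" "E T = E (S \<inter> T) + E (T - S)"
    by (metis E_Un Diff_disjoint Int_Diff assms sets.Diff sets.Int Int_commute)+
  moreover have "E (S \<inter> T) * E (T - S) = 0" "E (S - T) * E (S \<inter> T) = 0" "E (S - T) * E (T - S) = 0"
    by (rule E_disjoint; auto)+
  ultimately show ?thesis by (simp add: distrib_left distrib_right E_idem)
qed

section \<open>Scalar spectral measures and the calculus they determine\<close>

abbreviation \<mu> :: "'a \<Rightarrow> real measure" where "\<mu> \<equiv> diagonal_measure E"

lemma sets_\<mu> [simp, measurable_cong]: "sets (\<mu> x) = sets borel"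
  and space_\<mu> [simp]: "space (\<mu> x) = UNIV"
  using sets.sigma_sets_eq[of "borel :: real measure"]
  by (simp_all add: diagonal_measure_def space_measure_of_conv sets_measure_of_conv)

text \<open>The set function under \<open>diagonal_measure\<close> is a squared norm by
  \<open>cinner_E\<close>, hence nonnegative, and inherits countable additivity from the strong
  convergence of \<open>E\<close>; only then does \<open>measure_of\<close> return it.\<close>

lemma emeasure_\<mu>:
  assumes "S \<in> sets borel"
  shows "emeasure (\<mu> x) S = ennreal ((norm (E S \<rhd> x))\<^sup>2)"
proof -
  have "emeasure (\<mu> x) S = ennreal (Re (cinner x (E S \<rhd> x)))"
    unfolding diagonal_measure_def
  proof (rule emeasure_measure_of_sigma)
    show "sigma_algebra UNIV (sets (borel :: real measure))"
      using sets.sigma_algebra_axioms[of "borel :: real measure"] by simp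
    show "positive (sets borel) (\<lambda>S. ennreal (Re (cinner x (E S \<rhd> x))))"
      by (simp add: positive_def)
    show "countably_additive (sets borel) (\<lambda>S. ennreal (Re (cinner x (E S \<rhd> x))))"
    proof (rule countably_additiveI)
      fix A :: "nat \<Rightarrow> real set"
      assume A: "range A \<subseteq> sets borel" "disjoint_family A" "\<Union> (range A) \<in> sets borel"
      have "(\<lambda>i. cinner x (E (A i) \<rhd> x)) sums cinner x (E (\<Union>i. A i) \<rhd> x)"
        using E_sums[OF A(1,2), of x]
        by (intro bounded_linear.sums[OF bounded_bilinear.bounded_linear_right[OF bounded_bilinear_cinner]])
      then have "(\<lambda>i. Re (cinner x (E (A i) \<rhd> x))) sums Re (cinner x (E (\<Union>i. A i) \<rhd> x))"
        by (rule sums_Re)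
      then show "(\<Sum>i. ennreal (Re (cinner x (E (A i) \<rhd> x))))
          = ennreal (Re (cinner x (E (\<Union> (range A)) \<rhd> x)))"
        using A(1) by (intro suminf_ennreal_eq) (auto simp: cinner_E image_subset_iff)
    qed
  qed (rule assms)
  then show ?thesis using assms by (simp add: cinner_E)
qed

lemma measure_\<mu>: "S \<in> sets borel \<Longrightarrow> measure (\<mu> x) S = (norm (E S \<rhd> x))\<^sup>2"
  by (simp add: measure_def emeasure_\<mu>)

lemma finite_measure_\<mu> [simp, intro]: "finite_measure (\<mu> x)"
  by (rule finite_measureI) (simp add: emeasure_\<mu>)

lemma integrable_\<mu> [simp, intro]: "bounded_borel f \<Longrightarrow> integrable (\<mu> x) f"
  by (rule integrable_bounded_borel) auto

lemma integral_\<mu>_le: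
  assumes "bounded_borel f" "\<And>l. \<bar>f l\<bar> \<le> K"
  shows "\<bar>\<integral>l. f l \<partial>\<mu> x\<bar> \<le> K * (norm x)\<^sup>2"
proof -
  have "\<bar>\<integral>l. f l \<partial>\<mu> x\<bar> \<le> (\<integral>l. \<bar>f l\<bar> \<partial>\<mu> x)" by (rule integral_abs_bound)
  also have "\<dots> \<le> (\<integral>l. K \<partial>\<mu> x)"
    using assms by (intro integral_mono) auto
  also have "\<dots> = K * (norm x)\<^sup>2" using measure_\<mu>[of UNIV x] by simp
  finally show ?thesis .
qed

text \<open>\<open>S = UNIV\<close> alone would determine the operator. Testing against every
  \<open>E S\<close> in addition makes the product with a spectral projection immediate, which
  starts the induction in \<open>has_op_exists_mult\<close>.\<close>

definition has_op :: "(real \<Rightarrow> real) \<Rightarrow> 'a cblinfun \<Rightarrow> bool" where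
  "has_op f A \<longleftrightarrow> bounded_borel f \<and>
    (\<forall>x. \<forall>S\<in>sets borel. cinner x (E S \<rhd> A \<rhd> x) = of_real (\<integral>l. indicator S l * f l \<partial>\<mu> x))"

lemma has_opD:
  assumes "has_op f A"
  shows "bounded_borel f" "cinner x (A \<rhd> x) = of_real (\<integral>l. f l \<partial>\<mu> x)"
proof -
  show "bounded_borel f" using assms by (simp add: has_op_def)
  show "cinner x (A \<rhd> x) = of_real (\<integral>l. f l \<partial>\<mu> x)"
    using assms[unfolded has_op_def, THEN conjunct2, rule_format, of UNIV x] by simp
qed

lemma has_op_add: "has_op f A \<Longrightarrow> has_op g B \<Longrightarrow> has_op (\<lambda>l. f l + g l) (A + B)"
  unfolding has_op_def
  by (auto simp: cblinfun_simps cinner_simps distrib_left Bochner_Integration.integral_add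
      bounded_borel_intros)

lemma has_op_diff: "has_op f A \<Longrightarrow> has_op g B \<Longrightarrow> has_op (\<lambda>l. f l - g l) (A - B)"
  unfolding has_op_def
  by (auto simp: cblinfun_simps cinner_simps right_diff_distrib Bochner_Integration.integral_diff
      bounded_borel_intros)

lemma has_op_scale: "has_op f A \<Longrightarrow> has_op (\<lambda>l. c * f l) (c *\<^sub>R A)"
  unfolding has_op_def
  by (auto simp: cblinfun_simps cinner_simps mult.left_commute[of _ c])

lemma has_op_indicator: "S \<in> sets borel \<Longrightarrow> has_op (indicator S) (E S)"
  unfolding has_op_def
  by (auto simp: times_cblinfun_apply[symmetric] E_Int cinner_E indicator_inter_arith[symmetric]
      measure_\<mu>)

lemma has_op_norm_le: "has_op f A \<Longrightarrow> (\<And>l. \<bar>f l\<bar> \<le> K) \<Longrightarrow> norm A \<le> 2 * K"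
  using integral_\<mu>_le[of f K]
  by (intro norm_le_quadratic) (auto simp: has_opD intro: order_trans[OF abs_ge_zero])

lemma has_op_unique: "has_op f A \<Longrightarrow> has_op f B \<Longrightarrow> A = B"
  by (rule cblinfun_eq_quadratic) (simp add: has_opD)

lemma has_op_limit:
  assumes g: "\<And>n. has_op (g n) (A n)" and f: "bounded_borel f"
    and d: "\<And>n l. \<bar>g n l - f l\<bar> \<le> 1 / real (Suc n)" and A: "A \<longlonglongrightarrow> B"
  shows "has_op f B"
  unfolding has_op_def
proof (intro conjI allI ballI f)
  fix x S assume S: "S \<in> sets (borel :: real measure)"
  have "(\<lambda>n. cinner x (E S \<rhd> A n \<rhd> x)) \<longlonglongrightarrow> cinner x (E S \<rhd> B \<rhd> x)"
    by (intro tendsto_intros A)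
  moreover have "(\<lambda>n. \<integral>l. indicator S l * g n l \<partial>\<mu> x) \<longlonglongrightarrow> (\<integral>l. indicator S l * f l \<partial>\<mu> x)"
  proof (rule LIM_zero_cancel, rule Lim_null_comparison)
    have "norm ((\<integral>l. indicator S l * g n l \<partial>\<mu> x) - (\<integral>l. indicator S l * f l \<partial>\<mu> x))
        \<le> 1 / real (Suc n) * (norm x)\<^sup>2" for n
    proof -
      have gb: "bounded_borel (g n)" using g has_opD by blast
      have "(\<integral>l. indicator S l * g n l \<partial>\<mu> x) - (\<integral>l. indicator S l * f l \<partial>\<mu> x)
          = (\<integral>l. indicator S l * (g n l - f l) \<partial>\<mu> x)"
        using S gb f by (subst Bochner_Integration.integral_diff[symmetric])
          (auto simp: right_diff_distrib)
      moreover have "\<bar>\<integral>l. indicator S l * (g n l - f l) \<partial>\<mu> x\<bar> \<le> 1 / real (Suc n) * (norm x)\<^sup>2"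
        using S gb f
        by (intro integral_\<mu>_le bounded_borel_intros) (use d[of n] in \<open>auto simp: indicator_def\<close>)
      ultimately show ?thesis by simp
    qed
    then show "\<forall>\<^sub>F n in sequentially. norm ((\<integral>l. indicator S l * g n l \<partial>\<mu> x)
        - (\<integral>l. indicator S l * f l \<partial>\<mu> x)) \<le> 1 / real (Suc n) * (norm x)\<^sup>2" by simp
    show "(\<lambda>n. 1 / real (Suc n) * (norm x)\<^sup>2) \<longlonglongrightarrow> 0"
      by (intro tendsto_mult_left_zero LIMSEQ_Suc[OF lim_1_over_n])
  qed
  then have "(\<lambda>n. cinner x (E S \<rhd> A n \<rhd> x)) \<longlonglongrightarrow> of_real (\<integral>l. indicator S l * f l \<partial>\<mu> x)"
    using g S by (auto simp: has_op_def intro: tendsto_of_real)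
  ultimately show "cinner x (E S \<rhd> B \<rhd> x) = of_real (\<integral>l. indicator S l * f l \<partial>\<mu> x)"
    by (rule LIMSEQ_unique)
qed

lemma has_op_Cauchy:
  assumes g: "\<And>n. has_op (g n) (A n)" and d: "\<And>n l. \<bar>g n l - f l\<bar> \<le> 1 / real (Suc n)"
  shows "convergent A"
proof (rule Cauchy_convergent, rule metric_CauchyI)
  fix e :: real assume "e > 0"
  then obtain N where N: "4 / e < real N" using reals_Archimedean2 by blast
  have N0: "real N > 0" using N \<open>e > 0\<close> by (smt (verit) divide_pos_pos)
  have "dist (A m) (A n) < e" if "m \<ge> N" "n \<ge> N" for m n
  proof -
    have "\<bar>g m l - g n l\<bar> \<le> 1 / real (Suc m) + 1 / real (Suc n)" for l
      using d[of m l] d[of n l] by linarith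
    then have "norm (A m - A n) \<le> 2 * (1 / real (Suc m) + 1 / real (Suc n))"
      by (intro has_op_norm_le[OF has_op_diff[OF g g]])
    also have "\<dots> < 2 * (1 / real N + 1 / real N)"
      using that N0 by (intro mult_strict_left_mono add_strict_mono divide_strict_left_mono) auto
    also have "\<dots> < e" using N N0 \<open>e > 0\<close> by (simp add: field_simps)
    finally show ?thesis by (simp add: dist_norm)
  qed
  then show "\<exists>M. \<forall>m\<ge>M. \<forall>n\<ge>M. dist (A m) (A n) < e" by blast
qed

text \<open>Existence and multiplicativity share one induction because the operator is at first only
  its witness; \<open>has_op_unique\<close> later extracts \<open>calc_mult\<close> from the second
  half.\<close>

lemma has_op_exists_mult:
  assumes "bounded_borel f"
  shows "\<exists>A. has_op f A \<and> (\<forall>g B. has_op g B \<longrightarrow> has_op (\<lambda>l. f l * g l) (A * B))"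
  using assms
proof (induction rule: bounded_borel_induct)
  case (indicator S)
  have "has_op (\<lambda>l. indicator S l * g l) (E S * B)" if B: "has_op g B" for g B
    unfolding has_op_def
  proof (intro conjI allI ballI)
    show "bounded_borel (\<lambda>l. indicator S l * g l)"
      using has_opD(1)[OF B] indicator by auto
    fix x T assume T: "T \<in> sets (borel :: real measure)"
    have "E T \<rhd> (E S * B) \<rhd> x = E (T \<inter> S) \<rhd> B \<rhd> x"
      using T indicator by (simp add: E_Int[symmetric] times_cblinfun_apply)
    then show "cinner x (E T \<rhd> (E S * B) \<rhd> x)
        = of_real (\<integral>l. indicator T l * (indicator S l * g l) \<partial>\<mu> x)"
      using B T indicator by (simp add: has_op_def indicator_inter_arith mult.assoc)
  qed
  then show ?case using has_op_indicator[OF indicator] by blast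
next
  case (scale c f)
  then obtain A where "has_op f A" "\<forall>g B. has_op g B \<longrightarrow> has_op (\<lambda>l. f l * g l) (A * B)" by blast
  then have "has_op (\<lambda>l. c * f l) (c *\<^sub>R A)"
    "\<forall>g B. has_op g B \<longrightarrow> has_op (\<lambda>l. c * f l * g l) (c *\<^sub>R A * B)"
    by (auto simp: mult.assoc intro: has_op_scale)
  then show ?case by blast
next
  case (add f g)
  then obtain A B where "has_op f A" "\<forall>h C. has_op h C \<longrightarrow> has_op (\<lambda>l. f l * h l) (A * C)"
    "has_op g B" "\<forall>h C. has_op h C \<longrightarrow> has_op (\<lambda>l. g l * h l) (B * C)" by blast
  then have "has_op (\<lambda>l. f l + g l) (A + B)"
    "\<forall>h C. has_op h C \<longrightarrow> has_op (\<lambda>l. (f l + g l) * h l) ((A + B) * C)"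
    by (auto simp: distrib_right intro: has_op_add)
  then show ?case by blast
next
  case (limit f h)
  then obtain A where A: "\<And>n. has_op (h n) (A n)"
    "\<And>n g B. has_op g B \<Longrightarrow> has_op (\<lambda>l. h n l * g l) (A n * B)" by metis
  obtain L where L: "A \<longlonglongrightarrow> L" using has_op_Cauchy[OF A(1) limit(3)] by (auto simp: convergent_def)
  have "has_op (\<lambda>l. f l * g l) (L * B)" if B: "has_op g B" for g B
  proof -
    obtain K where K: "\<And>l. \<bar>g l\<bar> \<le> K" using bounded_borelD(2)[OF has_opD(1)[OF B]] by blast
    \<comment> \<open>Multiplication by \<open>g\<close> spoils the rate 1/(n + 1) that
      \<open>has_op_limit\<close> asks for. Dividing by a bound of \<open>g\<close> restores it, and
      the result is scaled back afterwards; the maximum with 1 avoids division by 0.\<close>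
    define K' where "K' = max K 1"
    have K': "K' > 0" "\<And>l. \<bar>g l\<bar> \<le> K'" using K by (auto simp: K'_def le_max_iff_disj)
    have 1: "has_op (\<lambda>l. (1 / K') * (h n l * g l)) ((1 / K') *\<^sub>R (A n * B))" for n
      by (intro has_op_scale A B)
    have 2: "(\<lambda>n. (1 / K') *\<^sub>R (A n * B)) \<longlonglongrightarrow> (1 / K') *\<^sub>R (L * B)"
      by (intro tendsto_intros L)
    have 3: "\<bar>1 / K' * (h n l * g l) - 1 / K' * (f l * g l)\<bar> \<le> 1 / real (Suc n)" for n l
    proof -
      have "1 / K' * (h n l * g l) - 1 / K' * (f l * g l) = (h n l - f l) * (g l / K')"
        by (simp add: algebra_simps)
      moreover have "\<bar>g l / K'\<bar> \<le> 1" using K' by simp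
      ultimately show ?thesis
        using mult_mono[OF limit(3)[of n l], of "\<bar>g l / K'\<bar>" 1] by (simp add: abs_mult)
    qed
    have "has_op (\<lambda>l. (1 / K') * (f l * g l)) ((1 / K') *\<^sub>R (L * B))"
      using limit(2) has_opD(1)[OF B] by (intro has_op_limit[OF 1 _ 3 2] bounded_borel_intros)
    then have "has_op (\<lambda>l. K' * ((1 / K') * (f l * g l))) (K' *\<^sub>R ((1 / K') *\<^sub>R (L * B)))"
      by (rule has_op_scale)
    then show ?thesis using K'(1) by simp
  qed
  moreover have "has_op f L" using has_op_limit[OF A(1) limit(2,3) L] .
  ultimately show ?case by blast
qed

definition calc :: "(real \<Rightarrow> real) \<Rightarrow> 'a cblinfun" where
  "calc f = (THE A. has_op f A)"

lemma has_op_calc: "bounded_borel f \<Longrightarrow> has_op f (calc f)"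
  unfolding calc_def using has_op_exists_mult has_op_unique by (metis the_equality)

lemma calcI: "has_op f A \<Longrightarrow> calc f = A"
  using has_op_calc has_opD(1) has_op_unique by blast

lemma cinner_calc: "bounded_borel f \<Longrightarrow> cinner x (calc f \<rhd> x) = of_real (\<integral>l. f l \<partial>\<mu> x)"
  using has_op_calc has_opD by blast

lemma calc_indicator: "S \<in> sets borel \<Longrightarrow> calc (indicator S) = E S"
  by (intro calcI has_op_indicator)

lemma calc_one: "calc (\<lambda>_. 1) = cid"
  using calc_indicator[of UNIV] by (simp add: indicator_def)

lemma calc_diff: "bounded_borel f \<Longrightarrow> bounded_borel g \<Longrightarrow> calc (\<lambda>l. f l - g l) = calc f - calc g"
  by (intro calcI has_op_diff has_op_calc)

lemma calc_scale: "bounded_borel f \<Longrightarrow> calc (\<lambda>l. c * f l) = c *\<^sub>R calc f"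
  by (intro calcI has_op_scale has_op_calc)

lemma calc_mult: "bounded_borel f \<Longrightarrow> bounded_borel g \<Longrightarrow> calc (\<lambda>l. f l * g l) = calc f * calc g"
  by (intro calcI) (metis has_op_calc has_op_exists_mult has_op_unique)

lemma norm_calc_le: "bounded_borel f \<Longrightarrow> (\<And>l. \<bar>f l\<bar> \<le> K) \<Longrightarrow> norm (calc f) \<le> 2 * K"
  by (rule has_op_norm_le[OF has_op_calc])

lemma calc_sym: "bounded_borel f \<Longrightarrow> cinner (calc f \<rhd> x) y = cinner x (calc f \<rhd> y)"
  by (rule cblinfun_symmetric_quadratic) (simp add: cinner_calc)

lemma norm_calc_sq:
  assumes "bounded_borel f"
  shows "(norm (calc f \<rhd> x))\<^sup>2 = (\<integral>l. (f l)\<^sup>2 \<partial>\<mu> x)"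
proof -
  have "of_real ((norm (calc f \<rhd> x))\<^sup>2) = cinner x (calc (\<lambda>l. f l * f l) \<rhd> x)"
    unfolding cinner_self[symmetric]
    using assms by (simp add: calc_sym calc_mult times_cblinfun_apply)
  also have "\<dots> = of_real (\<integral>l. f l * f l \<partial>\<mu> x)" using assms by (intro cinner_calc) auto
  finally show ?thesis by (simp add: power2_eq_square del: of_real_mult of_real_power)
qed

text \<open>This transports integrability questions between vectors: for
  \<open>x = calc f \<rhd> v\<close>, integrals at \<open>x\<close> become weighted integrals at
  \<open>v\<close>.\<close>

lemma \<mu>_calc:
  assumes f: "bounded_borel f"
  shows "\<mu> (calc f \<rhd> x) = density (\<mu> x) (\<lambda>l. ennreal ((f l)\<^sup>2))"
proof (rule measure_eqI)
  fix S assume "S \<in> sets (\<mu> (calc f \<rhd> x))"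
  then have S: "S \<in> sets borel" by simp
  have [measurable]: "f \<in> borel_measurable borel" using f by (rule bounded_borelD)
  have bb: "bounded_borel (\<lambda>l. indicator S l * f l)" using S f by auto
  have "emeasure (\<mu> (calc f \<rhd> x)) S = ennreal ((norm (calc (\<lambda>l. indicator S l * f l) \<rhd> x))\<^sup>2)"
    using S f by (simp add: emeasure_\<mu> calc_mult bounded_borel_intros calc_indicator
        times_cblinfun_apply)
  also have "\<dots> = ennreal (\<integral>l. (indicator S l * f l)\<^sup>2 \<partial>\<mu> x)" using norm_calc_sq[OF bb] by simp
  also have "\<dots> = (\<integral>\<^sup>+ l. ennreal ((indicator S l * f l)\<^sup>2) \<partial>\<mu> x)"
    using bb by (intro nn_integral_eq_integral[symmetric]) (auto simp: power2_eq_square)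
  also have "\<dots> = (\<integral>\<^sup>+ l. ennreal ((f l)\<^sup>2) * indicator S l \<partial>\<mu> x)"
    by (intro nn_integral_cong) (auto simp: indicator_def)
  also have "\<dots> = emeasure (density (\<mu> x) (\<lambda>l. ennreal ((f l)\<^sup>2))) S"
    using S by (subst emeasure_density) auto
  finally show "emeasure (\<mu> (calc f \<rhd> x)) S = emeasure (density (\<mu> x) (\<lambda>l. ennreal ((f l)\<^sup>2))) S" .
qed simp

text \<open>By \<open>norm_calc_sq\<close> the strong convergence is L2 convergence for the finite
  measure \<open>\<mu> x\<close>, where dominated convergence applies.\<close>

lemma calc_tendsto:
  assumes f: "\<And>n. bounded_borel (f n)" "bounded_borel g"
    and K: "\<And>n l. \<bar>f n l\<bar> \<le> K" and lim: "\<And>l. (\<lambda>n. f n l) \<longlonglongrightarrow> g l"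
  shows "(\<lambda>n. calc (f n) \<rhd> x) \<longlonglongrightarrow> calc g \<rhd> x"
proof (rule LIM_zero_cancel)
  note [measurable] = bounded_borelD(1)[OF f(1)] bounded_borelD(1)[OF f(2)]
  have gK: "\<bar>g l\<bar> \<le> K" for l
    using K by (intro LIMSEQ_le_const2[OF tendsto_rabs[OF lim]]) auto
  have "(\<lambda>n. \<integral>l. (f n l - g l)\<^sup>2 \<partial>\<mu> x) \<longlonglongrightarrow> (\<integral>l. 0 \<partial>\<mu> x)"
  proof (rule integral_dominated_convergence[where w = "\<lambda>_. (2 * K)\<^sup>2"])
    show "AE l in \<mu> x. (\<lambda>n. (f n l - g l)\<^sup>2) \<longlonglongrightarrow> 0"
      using tendsto_power[OF LIM_zero[OF lim], where n = 2] by simp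
    show "AE l in \<mu> x. norm ((f n l - g l)\<^sup>2) \<le> (2 * K)\<^sup>2" for n
    proof (rule AE_I2)
      fix l
      have "\<bar>f n l - g l\<bar> \<le> 2 * K" using K[of n l] gK[of l] by linarith
      then have "\<bar>f n l - g l\<bar>\<^sup>2 \<le> (2 * K)\<^sup>2" by (intro power_mono) auto
      then show "norm ((f n l - g l)\<^sup>2) \<le> (2 * K)\<^sup>2" by simp
    qed
  qed auto
  moreover have "(\<integral>l. (f n l - g l)\<^sup>2 \<partial>\<mu> x) = (norm (calc (f n) \<rhd> x - calc g \<rhd> x))\<^sup>2" for n
    using f by (simp add: norm_calc_sq[symmetric] bounded_borel_intros calc_diff cblinfun_simps)
  ultimately have "(\<lambda>n. sqrt ((norm (calc (f n) \<rhd> x - calc g \<rhd> x))\<^sup>2)) \<longlonglongrightarrow> sqrt 0"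
    by (intro tendsto_real_sqrt) simp
  then show "(\<lambda>n. calc (f n) \<rhd> x - calc g \<rhd> x) \<longlonglongrightarrow> 0"
    by (simp add: tendsto_norm_zero_iff)
qed

end


section \<open>The Hausdorff moment problem\<close>

definition unit_measure :: "real measure \<Rightarrow> bool" where
  "unit_measure M \<longleftrightarrow> finite_measure M \<and> sets M = sets borel \<and> (AE r in M. r \<in> {0..1})"

lemma unit_measure_AE:
  assumes "unit_measure M" "\<And>r. r \<in> {0..1} \<Longrightarrow> P r"
  shows "AE r in M. P r"
proof -
  have "AE r in M. r \<in> {0..1}" using assms(1) unfolding unit_measure_def by blast
  then show ?thesis by (rule AE_mp) (use assms(2) in auto)
qed

text \<open>With \<open>w k j\<close> read as the integral of r^k (1 - r)^j, the hypothesis is r +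
  (1 - r) = 1 and the conclusion inserts (r + (1 - r))^N into the integral of r^m (1 - r)^j.\<close>

lemma completely_monotone_binomial:
  fixes w :: "nat \<Rightarrow> nat \<Rightarrow> real"
  assumes rec: "\<And>k j. w k j = w (Suc k) j + w k (Suc j)"
  shows "w m j = (\<Sum>i\<le>N. real (N choose i) * w (m + i) (j + (N - i)))"
proof (induction N arbitrary: m j)
  case (Suc N)
  define a where "a i = w (m + i) (j + (Suc N - i))" for i
  have "w m j = (\<Sum>i\<le>N. real (N choose i) * w (Suc m + i) (j + (N - i)))
      + (\<Sum>i\<le>N. real (N choose i) * w (m + i) (Suc j + (N - i)))"
    by (subst rec) (metis Suc.IH)
  also have "(\<Sum>i\<le>N. real (N choose i) * w (Suc m + i) (j + (N - i)))
      = (\<Sum>i\<le>N. real (N choose i) * a (Suc i))"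
    by (simp add: a_def)
  also have "(\<Sum>i\<le>N. real (N choose i) * w (m + i) (Suc j + (N - i)))
      = (\<Sum>i\<le>N. real (N choose i) * a i)"
    by (intro sum.cong) (auto simp: a_def Suc_diff_le)
  also have "(\<Sum>i\<le>N. real (N choose i) * a i) = (\<Sum>i\<le>Suc N. real (N choose i) * a i)"
    by simp
  also have "\<dots> = a 0 + (\<Sum>i\<le>N. real (N choose Suc i) * a (Suc i))"
    by (subst sum.atMost_Suc_shift) simp
  also have "(\<Sum>i\<le>N. real (N choose i) * a (Suc i)) + \<dots>
      = a 0 + (\<Sum>i\<le>N. real (Suc N choose Suc i) * a (Suc i))"
    by (simp add: sum.distrib[symmetric] algebra_simps)
  also have "\<dots> = (\<Sum>i\<le>Suc N. real (Suc N choose i) * a i)"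
    by (simp add: sum.atMost_Suc_shift del: sum.atMost_Suc)
  finally show ?case by (simp add: a_def)
qed simp

text \<open>The quotient is a product of \<open>m\<close> factors (k - i)/(n - i), all of absolute
  value at most 1, so it may be compared with (k/n)^m factor by factor. It links binomial moments,
  which are exact for the Bernstein weights, to power moments.\<close>

lemma choose_quotient_approx:
  assumes "k \<le> n" "2 * m < n"
  shows "\<bar>real (k choose m) / real (n choose m) - (real k / real n) ^ m\<bar> \<le> real m * (real m / (real n - real m))"
proof -
  have 1: "real (k choose m) / real (n choose m) = (\<Prod>i\<in>{0..<m}. (real k - real i) / (real n - real i))"
    by (simp add: binomial_gbinomial gbinomial_prod_rev prod_dividef)
  have b: "\<bar>real k - real i\<bar> \<le> real n - real i" if "i < m" for i
    using that assms by (auto simp: abs_if)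
  have "norm ((\<Prod>i\<in>{0..<m}. (real k - real i) / (real n - real i)) - (\<Prod>i\<in>{0..<m}. real k / real n))
      \<le> (\<Sum>i\<in>{0..<m}. norm ((real k - real i) / (real n - real i) - real k / real n))"
    using assms b by (intro norm_prod_diff) (auto simp: divide_simps)
  also have "\<dots> \<le> (\<Sum>i\<in>{0..<m}. real m / (real n - real m))"
  proof (rule sum_mono)
    fix i assume i: "i \<in> {0..<m}"
    have "(real k - real i) / (real n - real i) - real k / real n
        = - (real i * (real n - real k)) / (real n * (real n - real i))"
      using i assms by (simp add: field_simps)
    then have "norm ((real k - real i) / (real n - real i) - real k / real n)
        = (real i * (real n - real k)) / (real n * (real n - real i))"
      using i assms by (simp add: abs_mult)
    also have "\<dots> \<le> (real m * real n) / (real n * (real n - real m))"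
      using i assms by (intro frac_le mult_mono mult_left_mono mult_pos_pos) auto
    finally show "norm ((real k - real i) / (real n - real i) - real k / real n)
        \<le> real m / (real n - real m)" using assms by simp
  qed
  finally show ?thesis by (simp add: 1)
qed

text \<open>The Bernstein weights \<open>p n k\<close>, placed at k/n, form probability measures.
  Their moments equal \<open>w m 0\<close> exactly when r^m is replaced by a quotient of binomial
  coefficients, hence asymptotically for r^m itself, and a weak limit inherits them.\<close>

lemma hausdorff_moment_prob:
  fixes w :: "nat \<Rightarrow> nat \<Rightarrow> real"
  assumes nonneg: "\<And>k j. 0 \<le> w k j" and rec: "\<And>k j. w k j = w (Suc k) j + w k (Suc j)"
    and one: "w 0 0 = 1"
  shows "\<exists>M. unit_measure M \<and> (\<forall>m. (\<integral>r. r ^ m \<partial>M) = w m 0)"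
proof -
  define p where "p n k = real (n choose k) * w k (n - k)" for n k
  have p0: "0 \<le> p n k" for n k by (simp add: p_def nonneg)
  have p1: "(\<Sum>k\<le>n. p n k) = 1" for n
    using completely_monotone_binomial[of w 0 0 n, OF rec] one by (simp add: p_def)
  \<comment> \<open>After regrouping the product of binomial coefficients, the sum is the expansion
    of \<open>w m 0\<close> at level n - m.\<close>
  have pm: "(\<Sum>k\<le>n. p n k * (real (k choose m) / real (n choose m))) = w m 0" if "m \<le> n" for n m
  proof -
    have "(\<Sum>k\<le>n. p n k * (real (k choose m) / real (n choose m)))
        = (\<Sum>k\<in>{m..n}. p n k * (real (k choose m) / real (n choose m)))"
      by (intro sum.mono_neutral_right) (auto simp: binomial_eq_0)
    also have "\<dots> = (\<Sum>k\<in>{m..n}. real ((n - m) choose (k - m)) * w k (n - k))"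
    proof (intro sum.cong refl)
      fix k assume k: "k \<in> {m..n}"
      have "real (n choose k) * real (k choose m) = real (n choose m) * real ((n - m) choose (k - m))"
        using k choose_mult[of m k n] by (metis atLeastAtMost_iff of_nat_mult)
      moreover have "real (n choose m) \<noteq> 0" using that by simp
      ultimately show "p n k * (real (k choose m) / real (n choose m))
          = real ((n - m) choose (k - m)) * w k (n - k)"
        by (simp add: p_def field_simps)
    qed
    also have "\<dots> = (\<Sum>i\<le>n - m. real ((n - m) choose i) * w (m + i) (n - m - i))"
      using that by (intro sum.reindex_bij_witness[of _ "\<lambda>i. m + i" "\<lambda>k. k - m"]) auto
    also have "\<dots> = w m 0"
      using completely_monotone_binomial[of w m 0 "n - m", OF rec] by simp
    finally show ?thesis .
  qed
  define P where "P n = point_measure {..n} (\<lambda>k. ennreal (p n k))" for n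
  define Q where "Q n = distr (P n) borel (\<lambda>k. real k / real n)" for n
  have meas [measurable]: "g \<in> measurable (P n) borel" for g :: "nat \<Rightarrow> real" and n
    by (simp add: P_def)
  have prob: "prob_space (P n)" for n
    by (rule prob_spaceI)
      (simp add: P_def space_point_measure emeasure_point_measure_finite sum_ennreal p0 p1)
  have Q: "real_distribution (Q n)" for n
    unfolding Q_def using prob by (intro prob_space.real_distribution_distr) auto
  have intQ: "(\<integral>r. g r \<partial>Q n) = (\<Sum>k\<le>n. p n k * g (real k / real n))"
    if [measurable]: "g \<in> borel_measurable borel" for g :: "real \<Rightarrow> real" and n
    unfolding Q_def
    by (subst integral_distr)
      (auto simp: P_def lebesgue_integral_point_measure_finite p0)
  \<comment> \<open>All mass lies in [0, 1]. The left end -1 is taken because tightness is phrased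
    with half-open intervals and 0 may be an atom.\<close>
  have "tight Q"
    unfolding tight_def
  proof (intro conjI allI impI Q)
    fix e :: real assume "e > 0"
    have "measure (Q n) {-1<..1} = 1" for n
    proof -
      have "measure (Q n) {-1<..1} = (\<integral>r. indicator {-1<..1} r \<partial>Q n)"
        using Q[of n] by (simp add: real_distribution.events_eq_borel Int_absorb1
            real_distribution.space_eq_univ)
      also have "\<dots> = (\<Sum>k\<le>n. p n k * indicator {-1<..1} (real k / real n))"
        by (rule intQ) auto
      also have "\<dots> = (\<Sum>k\<le>n. p n k)"
      proof (intro sum.cong refl)
        fix k assume "k \<in> {..n}"
        then have "real k / real n \<in> {-1<..1}"
          by (auto simp: divide_le_eq_1 intro: less_le_trans[of _ 0])
        then show "p n k * indicator {-1<..1} (real k / real n) = p n k" by simp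
      qed
      finally show ?thesis by (simp add: p1)
    qed
    then show "\<exists>a b. a < b \<and> (\<forall>n. 1 - e < measure (Q n) {a<..b})"
      using \<open>e > 0\<close> by (intro exI[of _ "-1"] exI[of _ 1]) auto
  qed
  then obtain s M where s: "strict_mono (s :: nat \<Rightarrow> nat)" and M: "real_distribution M"
    and conv: "weak_conv_m (Q \<circ> id \<circ> s) M"
    using tight_imp_convergent_subsubsequence[of Q id] by (auto simp: strict_mono_def)
  have limit: "(\<lambda>n. \<integral>r. g r \<partial>Q (s n)) \<longlonglongrightarrow> (\<integral>r. g r \<partial>M)"
    if "\<And>r. isCont g r" "\<And>r. \<bar>g r\<bar> \<le> 1" for g :: "real \<Rightarrow> real"
    using weak_conv_imp_integral_bdd_continuous_conv[of "Q \<circ> id \<circ> s" M g 1] Q M conv that by simp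
  \<comment> \<open>Clamping to [0, 1] makes powers bounded and continuous on the whole line, as
    weak convergence demands, and does not change them at the points k/n.\<close>
  define cl :: "real \<Rightarrow> real" where "cl r = max 0 (min 1 r)" for r
  have clc: "isCont cl r" for r unfolding cl_def by (intro continuous_intros)
  have cl01: "0 \<le> cl r" "cl r \<le> 1" for r by (auto simp: cl_def)
  have clfix: "cl (real k / real n) = real k / real n" if "k \<le> n" for k n
    using that by (cases "n = 0") (auto simp: cl_def min_def)
  interpret M: real_distribution M by fact
  have AE: "AE r in M. r \<in> {0..1}"
  proof -
    \<comment> \<open>A bounded continuous function vanishing exactly on [0, 1]. Its integral is 0
      for every approximating measure, hence for the limit \<open>M\<close>.\<close>
    define g where "g r = min 1 \<bar>r - cl r\<bar>" for r
    have gc: "isCont g r" for r unfolding g_def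
      by (intro continuous_min continuous_rabs continuous_diff continuous_const continuous_ident clc)
    then have [measurable]: "g \<in> borel_measurable borel"
      by (simp add: borel_measurable_continuous_onI continuous_at_imp_continuous_on)
    have "(\<lambda>n. \<integral>r. g r \<partial>Q (s n)) \<longlonglongrightarrow> (\<integral>r. g r \<partial>M)"
      by (rule limit[OF gc]) (simp add: g_def)
    moreover have "(\<integral>r. g r \<partial>Q (s n)) = 0" for n
      by (subst intQ) (auto simp: g_def clfix intro!: sum.neutral)
    ultimately have "(\<integral>r. g r \<partial>M) = 0" by (simp add: LIMSEQ_const_iff)
    moreover have "integrable M g"
      by (intro M.integrable_const_bound[where B = 1]) (auto simp: g_def)
    ultimately have "AE r in M. g r = 0"
      by (subst (asm) integral_nonneg_eq_0_iff_AE) (auto simp: g_def)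
    then show ?thesis
      by eventually_elim (auto simp: g_def cl_def min_def max_def split: if_splits)
  qed
  have mom: "(\<integral>r. r ^ m \<partial>M) = w m 0" for m
  proof -
    have "(\<lambda>n. \<integral>r. cl r ^ m \<partial>Q (s n)) \<longlonglongrightarrow> (\<integral>r. cl r ^ m \<partial>M)"
      using clc cl01 by (intro limit) (auto intro!: continuous_intros simp: power_abs power_le_one)
    moreover have "(\<lambda>n. \<integral>r. cl r ^ m \<partial>Q (s n)) \<longlonglongrightarrow> w m 0"
    proof (rule LIM_zero_cancel, rule Lim_null_comparison)
      have e: "norm ((\<integral>r. cl r ^ m \<partial>Q n) - w m 0) \<le> real m * (real m / (real n - real m))"
        if n: "2 * m < n" for n
      proof -
        have clm: "(\<lambda>r. cl r ^ m) \<in> borel_measurable borel" unfolding cl_def by measurable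
        have "(\<integral>r. cl r ^ m \<partial>Q n) - w m 0
            = (\<Sum>k\<le>n. p n k * (real k / real n) ^ m) - (\<Sum>k\<le>n. p n k * (real (k choose m) / real (n choose m)))"
          using n pm[of m n] by (subst intQ[OF clm]) (simp add: clfix)
        also have "\<dots> = - (\<Sum>k\<le>n. p n k * (real (k choose m) / real (n choose m) - (real k / real n) ^ m))"
          by (simp add: right_diff_distrib sum_subtractf)
        also have "norm \<dots> \<le> (\<Sum>k\<le>n. p n k * (real m * (real m / (real n - real m))))"
          unfolding norm_minus_cancel
        proof (rule order_trans[OF norm_sum], rule sum_mono)
          fix k assume "k \<in> {..n}"
          then show "norm (p n k * (real (k choose m) / real (n choose m) - (real k / real n) ^ m))
              \<le> p n k * (real m * (real m / (real n - real m)))"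
            unfolding real_norm_def abs_mult abs_of_nonneg[OF p0]
            by (intro mult_left_mono choose_quotient_approx p0 n) auto
        qed
        also have "\<dots> = real m * (real m / (real n - real m))"
          unfolding sum_distrib_right[symmetric] p1 by simp
        finally show ?thesis .
      qed
      have "\<forall>\<^sub>F n in sequentially. 2 * m < s n"
        using s by (auto simp: eventually_sequentially intro!: exI[of _ "Suc (2 * m)"]
            dest: order_trans[OF _ seq_suble])
      then show "\<forall>\<^sub>F n in sequentially. norm ((\<integral>r. cl r ^ m \<partial>Q (s n)) - w m 0)
          \<le> real m * (real m / (real (s n) - real m))"
        by eventually_elim (rule e)
      have "(\<lambda>n. real m * (real m / (real n - real m))) \<longlonglongrightarrow> 0"
        using filterlim_tendsto_add_at_top[OF tendsto_const filterlim_real_sequentially, of "- real m"]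
        by (intro tendsto_mult_right_zero tendsto_divide_0[OF tendsto_const]
            filterlim_at_top_imp_at_infinity) simp
      then show "(\<lambda>n. real m * (real m / (real (s n) - real m))) \<longlonglongrightarrow> 0"
        using filterlim_compose[OF _ filterlim_subseq[OF s]] by blast
    qed
    ultimately have "(\<integral>r. cl r ^ m \<partial>M) = w m 0" by (rule LIMSEQ_unique)
    moreover have "(\<integral>r. r ^ m \<partial>M) = (\<integral>r. cl r ^ m \<partial>M)"
    proof (rule integral_cong_AE)
      show "AE r in M. r ^ m = cl r ^ m" using AE by eventually_elim (auto simp: cl_def)
    qed (auto simp: cl_def)
    ultimately show ?thesis by simp
  qed
  show ?thesis
    using AE mom M.finite_measure_axioms by (intro exI[of _ M]) (auto simp: unit_measure_def)
qed

text \<open>Normalization by the total mass \<open>w 0 0\<close>; if that is 0, the recursion and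
  nonnegativity force every moment to vanish and the null measure serves.\<close>

lemma hausdorff_moment:
  fixes w :: "nat \<Rightarrow> nat \<Rightarrow> real"
  assumes nonneg: "\<And>k j. 0 \<le> w k j" and rec: "\<And>k j. w k j = w (Suc k) j + w k (Suc j)"
  shows "\<exists>M. unit_measure M \<and> (\<forall>m. (\<integral>r. r ^ m \<partial>M) = w m 0)"
proof (cases "w 0 0 = 0")
  case True
  have "w m 0 = 0" for m
  proof (induction m)
    case (Suc m)
    then show ?case using rec[of m 0] nonneg[of "Suc m" 0] nonneg[of m 1] by simp
  qed (rule True)
  moreover have "unit_measure (null_measure borel)"
    by (auto simp: unit_measure_def intro!: finite_measureI AE_I[of _ _ UNIV])
  ultimately show ?thesis by (intro exI[of _ "null_measure borel"]) auto
next
  case False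
  define c where "c = w 0 0"
  have c: "c > 0" using False nonneg[of 0 0] by (simp add: c_def)
  have "\<exists>M. unit_measure M \<and> (\<forall>m. (\<integral>r. r ^ m \<partial>M) = w m 0 / c)"
  proof (rule hausdorff_moment_prob)
    show "w k j / c = w (Suc k) j / c + w k (Suc j) / c" for k j
      unfolding add_divide_distrib[symmetric] by (rule arg_cong[OF rec])
  qed (use c nonneg in \<open>auto simp: c_def\<close>)
  then obtain M where M: "unit_measure M" "\<And>m. (\<integral>r. r ^ m \<partial>M) = w m 0 / c" by blast
  interpret finite_measure M using M by (simp add: unit_measure_def)
  have sets [measurable_cong]: "sets M = sets borel" using M by (simp add: unit_measure_def)
  have "emeasure (density M (\<lambda>_. ennreal c)) (space M) \<noteq> \<infinity>"
    by (simp add: emeasure_density_const ennreal_mult_eq_top_iff)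
  then have "unit_measure (density M (\<lambda>_. ennreal c))"
    using M unfolding unit_measure_def by (auto simp: AE_density intro!: finite_measureI)
  moreover have "(\<integral>r. r ^ m \<partial>density M (\<lambda>_. ennreal c)) = w m 0" for m
    using M(2)[of m] c by (subst integral_density) auto
  ultimately show ?thesis by blast
qed


section \<open>Complex combinations of measures on the unit interval\<close>

definition comb :: "(complex \<times> real measure) list \<Rightarrow> (real \<Rightarrow> real) \<Rightarrow> complex" where
  "comb L f = (\<Sum>(c, M)\<leftarrow>L. c * of_real (\<integral>r. f r \<partial>M))"

text \<open>These are the complex measures on [0, 1], encoded as finite combinations of positive
  ones. The functional is compared with \<open>comb\<close> on Borel functions only, its other
  values being irrelevant.\<close>

definition cfunctional :: "((real \<Rightarrow> real) \<Rightarrow> complex) \<Rightarrow> bool" where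
  "cfunctional \<Lambda> \<longleftrightarrow> (\<exists>L. (\<forall>(c, M)\<in>set L. unit_measure M) \<and>
    (\<forall>f\<in>borel_measurable borel. \<Lambda> f = comb L f))"

lemma unit_measure_integrable:
  assumes M: "unit_measure M" and f: "f \<in> borel_measurable borel"
    and K: "\<And>r. r \<in> {0..1} \<Longrightarrow> \<bar>f r\<bar> \<le> K"
  shows "integrable M (f :: real \<Rightarrow> real)"
proof -
  interpret finite_measure M using M by (simp add: unit_measure_def)
  have "sets M = sets borel" using M by (simp add: unit_measure_def)
  then have "f \<in> borel_measurable M" using f by (simp cong: measurable_cong_sets)
  moreover have "AE r in M. norm (f r) \<le> K"
    by (rule unit_measure_AE[OF M]) (use K in auto)
  ultimately show ?thesis by (intro integrable_const_bound)
qed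

lemma comb_append: "comb (L @ L') f = comb L f + comb L' f"
  by (simp add: comb_def)

lemma comb_scale: "comb (map (\<lambda>(c, M). (d * c, M)) L) f = d * comb L f"
  by (induction L) (auto simp: comb_def algebra_simps)

lemma comb_cnj: "comb (map (\<lambda>(c, M). (cnj c, M)) L) f = cnj (comb L f)"
  by (induction L) (auto simp: comb_def)

lemma cfunctional_add:
  assumes "cfunctional \<Lambda>" "cfunctional \<Lambda>'"
  shows "cfunctional (\<lambda>f. \<Lambda> f + \<Lambda>' f)"
proof -
  from assms obtain L L' where "\<forall>(c, M)\<in>set L. unit_measure M" "\<forall>f\<in>borel_measurable borel. \<Lambda> f = comb L f"
    "\<forall>(c, M)\<in>set L'. unit_measure M" "\<forall>f\<in>borel_measurable borel. \<Lambda>' f = comb L' f"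
    by (auto simp: cfunctional_def)
  then show ?thesis
    unfolding cfunctional_def by (intro exI[of _ "L @ L'"]) (auto simp: comb_append)
qed

lemma cfunctional_scale:
  assumes "cfunctional \<Lambda>"
  shows "cfunctional (\<lambda>f. d * \<Lambda> f)"
proof -
  from assms obtain L where "\<forall>(c, M)\<in>set L. unit_measure M" "\<forall>f\<in>borel_measurable borel. \<Lambda> f = comb L f"
    by (auto simp: cfunctional_def)
  then show ?thesis
    unfolding cfunctional_def
    by (intro exI[of _ "map (\<lambda>(c, M). (d * c, M)) L"]) (auto simp: comb_scale)
qed

lemma cfunctional_cnj:
  assumes "cfunctional \<Lambda>"
  shows "cfunctional (\<lambda>f. cnj (\<Lambda> f))"
proof -
  from assms obtain L where "\<forall>(c, M)\<in>set L. unit_measure M" "\<forall>f\<in>borel_measurable borel. \<Lambda> f = comb L f"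
    by (auto simp: cfunctional_def)
  then show ?thesis
    unfolding cfunctional_def
    by (intro exI[of _ "map (\<lambda>(c, M). (cnj c, M)) L"]) (auto simp: comb_cnj)
qed

lemma cfunctional_integral: "unit_measure M \<Longrightarrow> cfunctional (\<lambda>f. of_real (\<integral>r. f r \<partial>M))"
  unfolding cfunctional_def by (intro exI[of _ "[(1, M)]"]) (auto simp: comb_def)

lemma cfunctional_times:
  assumes "cfunctional \<Lambda>" and h [measurable]: "h \<in> borel_measurable borel"
    and h01: "\<And>r. 0 \<le> h r" "\<And>r. h r \<le> 1"
  shows "cfunctional (\<lambda>f. \<Lambda> (\<lambda>r. h r * f r))"
proof -
  from assms obtain L where L: "\<forall>(c, M)\<in>set L. unit_measure M" "\<forall>f\<in>borel_measurable borel. \<Lambda> f = comb L f"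
    by (auto simp: cfunctional_def)
  define L' where "L' = map (\<lambda>(c, M). (c, density M (\<lambda>r. ennreal (h r)))) L"
  have "unit_measure (density M (\<lambda>r. ennreal (h r)))" if M: "unit_measure M" for M
  proof -
    have [measurable_cong]: "sets M = sets borel" using M by (simp add: unit_measure_def)
    have int: "integrable M h" using h01 by (intro unit_measure_integrable[OF M, of _ 1]) auto
    have "finite_measure (density M (\<lambda>r. ennreal (h r)))"
    proof (rule finite_measureI)
      have "emeasure (density M (\<lambda>r. ennreal (h r))) (space M) = (\<integral>\<^sup>+ r. ennreal (h r) \<partial>M)"
        by (subst emeasure_density) (auto intro!: nn_integral_cong)
      then show "emeasure (density M (\<lambda>r. ennreal (h r))) (space (density M (\<lambda>r. ennreal (h r)))) \<noteq> \<infinity>"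
        using int h01 by (simp add: nn_integral_eq_integral)
    qed
    then show ?thesis using M by (auto simp: unit_measure_def AE_density)
  qed
  then have "\<forall>(c, M)\<in>set L'. unit_measure M" using L(1) by (auto simp: L'_def)
  moreover have "comb L (\<lambda>r. h r * f r) = comb L' f" if [measurable]: "f \<in> borel_measurable borel" for f
    using L(1) unfolding L'_def
  proof (induction L)
    case (Cons p L)
    obtain c M where p: "p = (c, M)" by force
    have [measurable_cong]: "sets M = sets borel" using Cons p by (simp add: unit_measure_def)
    have "(\<integral>r. h r * f r \<partial>M) = (\<integral>r. f r \<partial>density M (\<lambda>r. ennreal (h r)))"
      using h01 by (subst integral_density) auto
    then show ?case using Cons p by (simp add: comb_def)
  qed (simp add: comb_def)
  ultimately show ?thesis
    using L(2) unfolding cfunctional_def by (intro exI[of _ L']) auto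
qed

lemma cfunctional_cong:
  assumes "cfunctional \<Lambda>" and [measurable]: "f \<in> borel_measurable borel" "g \<in> borel_measurable borel"
    and eq: "\<And>r. r \<in> {0..1} \<Longrightarrow> f r = g r"
  shows "\<Lambda> f = \<Lambda> g"
proof -
  from assms obtain L where L: "\<forall>(c, M)\<in>set L. unit_measure M" "\<forall>f\<in>borel_measurable borel. \<Lambda> f = comb L f"
    by (auto simp: cfunctional_def)
  have "comb L f = comb L g" using L(1)
  proof (induction L)
    case (Cons p L)
    obtain c M where p: "p = (c, M)" by force
    have [measurable_cong]: "sets M = sets borel" using Cons p by (simp add: unit_measure_def)
    have "AE r in M. f r = g r"
      by (rule unit_measure_AE) (use Cons p eq in auto)
    then have "(\<integral>r. f r \<partial>M) = (\<integral>r. g r \<partial>M)" by (intro integral_cong_AE) auto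
    then show ?case using Cons p by (simp add: comb_def)
  qed (simp add: comb_def)
  then show ?thesis using L(2) by simp
qed

text \<open>\<open>cfunctional_times\<close> asks for a multiplier with values in [0, 1] on the
  whole line. The clamped power is one, and it agrees with r^m where the measures live.\<close>

lemma cfunctional_power:
  assumes "cfunctional \<Lambda>"
  shows "\<exists>\<Lambda>'. cfunctional \<Lambda>' \<and> (\<forall>f\<in>borel_measurable borel. \<Lambda>' f = \<Lambda> (\<lambda>r. r ^ m * f r))"
proof -
  define cl :: "real \<Rightarrow> real" where "cl r = max 0 (min 1 r)" for r
  have [measurable]: "cl \<in> borel_measurable borel" unfolding cl_def[abs_def] by measurable
  have cl: "0 \<le> cl r" "cl r \<le> 1" for r by (auto simp: cl_def)
  have "cfunctional (\<lambda>f. \<Lambda> (\<lambda>r. cl r ^ m * f r))"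
    using cl by (intro cfunctional_times assms) (auto simp: power_le_one)
  moreover have "\<Lambda> (\<lambda>r. cl r ^ m * f r) = \<Lambda> (\<lambda>r. r ^ m * f r)"
    if [measurable]: "f \<in> borel_measurable borel" for f
    by (rule cfunctional_cong[OF assms]) (auto simp: cl_def)
  ultimately show ?thesis by blast
qed

lemma comb_limit:
  assumes L: "\<forall>(c, M)\<in>set L. unit_measure M"
    and [measurable]: "\<And>n. f n \<in> borel_measurable borel" "g \<in> borel_measurable borel"
    and K: "\<And>n r. r \<in> {0..1} \<Longrightarrow> \<bar>f n r\<bar> \<le> K" and lim: "\<And>r. r \<in> {0..1} \<Longrightarrow> (\<lambda>n. f n r) \<longlonglongrightarrow> g r"
  shows "(\<lambda>n. comb L (f n)) \<longlonglongrightarrow> comb L g"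
  using L
proof (induction L)
  case (Cons p L)
  obtain c M where p: "p = (c, M)" by force
  then have M: "unit_measure M" using Cons by auto
  have [measurable_cong]: "sets M = sets borel" using M by (simp add: unit_measure_def)
  have "(\<lambda>n. \<integral>r. f n r \<partial>M) \<longlonglongrightarrow> (\<integral>r. g r \<partial>M)"
  proof (rule integral_dominated_convergence[where w = "\<lambda>_. K"])
    show "AE r in M. (\<lambda>n. f n r) \<longlonglongrightarrow> g r" "AE r in M. norm (f n r) \<le> K" for n
      by (rule unit_measure_AE[OF M], use lim K in auto)+
    show "integrable M (\<lambda>_. K)" by (rule unit_measure_integrable[OF M, of _ "\<bar>K\<bar>"]) auto
  qed auto
  then show ?case using Cons p by (auto simp: comb_def intro!: tendsto_intros)
qed (simp add: comb_def)

lemma comb_zero_polynomial: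
  assumes L: "\<forall>(c, M)\<in>set L. unit_measure M" and zero: "\<And>k. comb L (\<lambda>r. r ^ k) = 0"
  shows "comb L (\<lambda>r. \<Sum>i\<le>n. a i * r ^ i) = 0"
proof -
  have "comb L (\<lambda>r. \<Sum>i\<le>n. a i * r ^ i) = (\<Sum>i\<le>n. of_real (a i) * comb L (\<lambda>r. r ^ i))"
    using L
  proof (induction L)
    case (Cons p L)
    obtain c M where p: "p = (c, M)" by force
    then have M: "unit_measure M" using Cons by auto
    have "integrable M (\<lambda>r. r ^ i)" for i
      by (rule unit_measure_integrable[OF M, of _ 1]) (auto simp: power_abs power_le_one)
    then have "(\<integral>r. (\<Sum>i\<le>n. a i * r ^ i) \<partial>M) = (\<Sum>i\<le>n. a i * (\<integral>r. r ^ i \<partial>M))" by simp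
    then show ?case
      using Cons p by (simp add: comb_def sum_distrib_left algebra_simps sum.distrib)
  qed (simp add: comb_def)
  then show ?thesis by (simp add: zero)
qed

lemma comb_zero_continuous:
  assumes L: "\<forall>(c, M)\<in>set L. unit_measure M" and zero: "\<And>k. comb L (\<lambda>r. r ^ k) = 0"
    and f: "continuous_on UNIV f"
  shows "comb L f = 0"
proof -
  have "\<exists>g. real_polynomial_function g \<and> (\<forall>r\<in>{0..1}. \<bar>f r - g r\<bar> < 1 / real (Suc n))" for n
    using Stone_Weierstrass_real_polynomial_function[of "{0..1::real}" f "1 / real (Suc n)"]
      continuous_on_subset[OF f] by (metis compact_Icc subset_UNIV zero_less_divide_1_iff of_nat_0_less_iff zero_less_Suc)
  then obtain g where g: "\<And>n. real_polynomial_function (g n)"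
    "\<And>n r. r \<in> {0..1} \<Longrightarrow> \<bar>f r - g n r\<bar> < 1 / real (Suc n)" by metis
  have z: "comb L (g n) = 0" for n
    using g(1)[of n] comb_zero_polynomial[OF L zero] by (auto simp: real_polynomial_function_iff_sum)
  have "bounded (f ` {0..1})"
    using f by (intro compact_imp_bounded compact_continuous_image continuous_on_subset[OF f]) auto
  then obtain K where "\<forall>r\<in>{0..1}. \<bar>f r\<bar> \<le> K" by (auto simp: bounded_iff)
  then have K: "\<bar>f r\<bar> \<le> K" if "r \<in> {0..1}" for r using that by blast
  have "(\<lambda>n. comb L (g n)) \<longlonglongrightarrow> comb L f"
  proof (rule comb_limit[OF L, where K = "K + 1"])
    show "g n \<in> borel_measurable borel" for n
      using g(1)[of n] by (auto simp: real_polynomial_function_iff_sum)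
    show "f \<in> borel_measurable borel" using f by (rule borel_measurable_continuous_onI)
    show "\<bar>g n r\<bar> \<le> K + 1" if "r \<in> {0..1}" for n r
    proof -
      have "1 / real (Suc n) \<le> 1" by simp
      then show ?thesis using g(2)[OF that, of n] K[OF that] by linarith
    qed
    show "(\<lambda>n. g n r) \<longlonglongrightarrow> f r" if "r \<in> {0..1}" for r
    proof (rule LIM_zero_cancel, rule Lim_null_comparison)
      show "\<forall>\<^sub>F n in sequentially. norm (g n r - f r) \<le> 1 / real (Suc n)"
        using g(2)[OF that] by (intro always_eventually allI) (simp add: abs_minus_commute less_imp_le)
    qed (rule LIMSEQ_Suc[OF lim_1_over_n])
  qed
  then show ?thesis by (simp add: z LIMSEQ_const_iff)
qed

text \<open>Uniqueness in the moment problem: continuous functions reach the half-lines as bounded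
  pointwise limits, and the half-lines form an intersection-stable generator of the Borel sets, so
  the Dynkin argument applies to the signed combination.\<close>

lemma comb_zero_indicator:
  assumes L: "\<forall>(c, M)\<in>set L. unit_measure M" and zero: "\<And>k. comb L (\<lambda>r. r ^ k) = 0"
    and S: "S \<in> sets borel"
  shows "comb L (indicator S) = 0"
proof -
  have half_line: "comb L (indicator {..a}) = 0" for a :: real
  proof -
    \<comment> \<open>For n > 0 the ramp that is 1 up to \<open>a\<close>, 0 from a + 1/n on and
      linear in between.\<close>
    define f where "f n r = max 0 (min 1 (1 - real n * (r - a)))" for n r
    have c: "continuous_on UNIV (f n)" for n unfolding f_def by (intro continuous_intros)
    have "(\<lambda>n. comb L (f n)) \<longlonglongrightarrow> comb L (indicator {..a})"
    proof (rule comb_limit[OF L, where K = 1])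
      show "f n \<in> borel_measurable borel" for n by (intro borel_measurable_continuous_onI c)
      show "(\<lambda>n. f n r) \<longlonglongrightarrow> indicator {..a} r" for r
      proof (cases "r \<le> a")
        case True
        then have "f n r = 1" for n
          by (auto simp: f_def min_def max_def mult_nonneg_nonpos)
        then show ?thesis using True by simp
      next
        case False
        obtain N where N: "1 / (r - a) < real N" using reals_Archimedean2 by blast
        have "f n r = 0" if "n \<ge> N" for n
        proof -
          have "1 / (r - a) < real n" using N that by linarith
          then have "1 < real n * (r - a)" using False by (simp add: field_simps)
          then show ?thesis by (simp add: f_def)
        qed
        then show ?thesis using False
          by (auto intro!: tendsto_eventually exI[of _ N] simp: eventually_sequentially)
      qed
    qed (auto simp: f_def)
    then show ?thesis by (simp add: comb_zero_continuous[OF L zero c] LIMSEQ_const_iff)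
  qed
  have meas: "comb L (indicator T) = (\<Sum>(c, M)\<leftarrow>L. c * of_real (measure M T))"
    if "T \<in> sets borel" for T
    using L
  proof (induction L)
    case (Cons p L)
    obtain c M where p: "p = (c, M)" by force
    then have M: "unit_measure M" using Cons by auto
    then have "sets M = sets borel" "space M = UNIV"
      by (auto simp: unit_measure_def dest: sets_eq_imp_space_eq)
    then show ?case using Cons p by (simp add: comb_def)
  qed (simp add: comb_def)
  have "borel = sigma UNIV (range (\<lambda>a::real. {..a}))" by (rule borel_eq_atMost)
  then have "S \<in> sigma_sets UNIV (range (\<lambda>a::real. {..a}))"
    using S by (metis sets_measure_of top_greatest Pow_UNIV)
  then show ?thesis
  proof (induction rule: sigma_sets_induct_disjoint[rotated 2, consumes 1, case_names basic empty compl union Istable closed])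
    case Istable
    then show ?case by (auto simp: Int_stable_def)
  next
    case closed
    then show ?case by auto
  next
    case (basic A)
    then obtain a where "A = {..a}" by auto
    then show ?case by (simp only: half_line)
  next
    case empty
    then show ?case by (induction L) (auto simp: comb_def)
  next
    case (compl A)
    have A: "A \<in> sets borel"
      using compl(1) by (metis borel_eq_atMost sets_measure_of top_greatest Pow_UNIV)
    have "comb L (indicator (UNIV - A)) = comb L (\<lambda>r. r ^ 0) - comb L (indicator A)"
      using L
    proof (induction L)
      case (Cons p L)
      obtain c M where p: "p = (c, M)" by force
      then have M: "unit_measure M" using Cons by auto
      have "integrable M (indicator A :: real \<Rightarrow> real)" "integrable M (\<lambda>r. r ^ 0)"
        using A by (auto intro!: unit_measure_integrable[OF M, of _ 1] simp: indicator_def)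
      then have "(\<integral>r. r ^ 0 - indicator A r \<partial>M) = (\<integral>r. r ^ 0 \<partial>M) - (\<integral>r. indicator A r \<partial>M)"
        by (intro Bochner_Integration.integral_diff)
      moreover have "(\<lambda>r. r ^ 0 - indicator A r) = (indicator (UNIV - A) :: real \<Rightarrow> real)"
        by (auto simp: indicator_def)
      ultimately have eq: "(\<integral>r. indicator (UNIV - A) r \<partial>M) = (\<integral>r. r ^ 0 \<partial>M) - (\<integral>r. indicator A r \<partial>M)"
        by simp
      have "comb L (indicator (UNIV - A)) = comb L (\<lambda>r. r ^ 0) - comb L (indicator A)"
        using Cons by auto
      then show ?case
        unfolding comb_def p
        by (simp only: list.map sum_list.Cons case_prod_conv eq of_real_diff right_diff_distrib add_diff_add)
    qed (simp add: comb_def)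
    then show ?case using compl zero[of 0] by simp
  next
    case (union A)
    have A: "range A \<subseteq> sets borel"
      using union(2) by (metis borel_eq_atMost sets_measure_of top_greatest Pow_UNIV)
    have "(\<lambda>i. \<Sum>(c, M)\<leftarrow>L. c * of_real (measure M (A i))) sums (\<Sum>(c, M)\<leftarrow>L. c * of_real (measure M (\<Union>i. A i)))"
      using L
    proof (induction L)
      case (Cons p L)
      obtain c M where p: "p = (c, M)" by force
      then have M: "unit_measure M" using Cons by auto
      interpret finite_measure M using M by (simp add: unit_measure_def)
      have "(\<lambda>i. measure M (A i)) sums measure M (\<Union>i. A i)"
        using M A union(1) by (intro finite_measure_UNION) (auto simp: unit_measure_def)
      then have "(\<lambda>i. c * of_real (measure M (A i))) sums (c * of_real (measure M (\<Union>i. A i)))"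
        by (intro sums_mult sums_of_real)
      then show ?case using Cons p by (auto intro: sums_add)
    qed simp
    moreover have "(\<Sum>(c, M)\<leftarrow>L. c * of_real (measure M (A i))) = 0" for i
      using A union(3)[of i] meas[of "A i"] by auto
    ultimately have "(\<lambda>i. 0) sums (\<Sum>(c, M)\<leftarrow>L. c * of_real (measure M (\<Union>i. A i)))" by simp
    then have "(\<Sum>(c, M)\<leftarrow>L. c * of_real (measure M (\<Union>i. A i))) = 0"
      by (rule sums_unique2[OF _ sums_zero])
    then show ?case using A by (subst meas) auto
  qed
qed

text \<open>The bridge from algebra to measure theory: an identity about spectral projections is
  settled by checking it on powers of r, that is, on powers of the operator.\<close>

lemma cfunctional_eqI:
  assumes "cfunctional \<Lambda>" "cfunctional \<Lambda>'" and mom: "\<And>k. \<Lambda> (\<lambda>r. r ^ k) = \<Lambda>' (\<lambda>r. r ^ k)"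
    and S: "S \<in> sets borel"
  shows "\<Lambda> (indicator S) = \<Lambda>' (indicator S)"
proof -
  have "cfunctional (\<lambda>f. \<Lambda> f + (- 1) * \<Lambda>' f)"
    by (intro cfunctional_add cfunctional_scale assms)
  then obtain L where L: "\<forall>(c, M)\<in>set L. unit_measure M"
    "\<forall>f\<in>borel_measurable borel. \<Lambda> f + (- 1) * \<Lambda>' f = comb L f"
    by (auto simp: cfunctional_def)
  have "comb L (\<lambda>r. r ^ k) = 0" for k
  proof -
    have "(\<lambda>r::real. r ^ k) \<in> borel_measurable borel" by simp
    from L(2)[rule_format, OF this] show ?thesis using mom[of k] by simp
  qed
  from comb_zero_indicator[OF L(1) this S] show ?thesis
    using L(2)[rule_format, of "indicator S"] S by simp
qed


section \<open>The spectral theorem for operators between 0 and 1\<close>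

lemma funpow_commute_point:
  assumes "\<And>x. f (g x) = g (f x)"
  shows "(f ^^ n) (g x) = g ((f ^^ n) x)"
  by (induction n) (auto simp: assms)

text \<open>From \<open>A + B = cid\<close> the two operators commute, so a pair of equal factors
  can be moved to the two ends and absorbed into the test vector by symmetry. This lowers the degree
  until at most one factor of each kind is left.\<close>

lemma positive_products:
  fixes A B :: "'a::chilbert_space cblinfun"
  assumes sA: "\<And>x y. cinner (A \<rhd> x) y = cinner x (A \<rhd> y)" and sB: "\<And>x y. cinner (B \<rhd> x) y = cinner x (B \<rhd> y)"
    and pA: "\<And>x. 0 \<le> Re (cinner x (A \<rhd> x))" and pB: "\<And>x. 0 \<le> Re (cinner x (B \<rhd> x))"
    and AB: "A + B = cid"
  shows "0 \<le> Re (cinner x (((\<rhd>) A ^^ k) (((\<rhd>) B ^^ j) x)))"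
proof -
  have sum: "y = A \<rhd> y + B \<rhd> y" for y
    using AB by (metis cblinfun.add_left cid_apply)
  have comm: "A \<rhd> B \<rhd> y = B \<rhd> A \<rhd> y" for y
    using sum[of "A \<rhd> y"] arg_cong[OF sum[of y], of "(\<rhd>) A"]
    by (metis add_left_cancel cblinfun.add_right)
  show ?thesis
  proof (induction "k + j" arbitrary: k j x rule: less_induct)
    case less
    consider (A2) k' where "k = Suc (Suc k')" | (B2) j' where "j = Suc (Suc j')" | (small) "k \<le> 1" "j \<le> 1"
    proof (cases "k \<ge> 2 \<or> j \<ge> 2")
      case True
      then show ?thesis using that(1)[of "k - 2"] that(2)[of "j - 2"] by (auto simp: Suc_diff_Suc numeral_2_eq_2)
    next
      case False
      then show ?thesis by (intro that(3)) auto
    qed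
    then show ?case
    proof cases
      case A2
      have "((\<rhd>) A ^^ k) (((\<rhd>) B ^^ j) x) = A \<rhd> ((\<rhd>) A ^^ k') (A \<rhd> ((\<rhd>) B ^^ j) x)"
        using A2 by (simp add: funpow_swap1)
      also have "A \<rhd> ((\<rhd>) B ^^ j) x = ((\<rhd>) B ^^ j) (A \<rhd> x)"
        by (rule funpow_commute_point[symmetric]) (simp add: comm)
      finally show ?thesis
        using less[of k' j "A \<rhd> x"] A2 by (simp add: sA)
    next
      case B2
      have "((\<rhd>) A ^^ k) (((\<rhd>) B ^^ j) x) = B \<rhd> ((\<rhd>) A ^^ k) (((\<rhd>) B ^^ j') (B \<rhd> x))"
        using B2 by (simp add: funpow_swap1 funpow_commute_point[of "(\<rhd>) A" "(\<rhd>) B", OF comm, symmetric])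
      then show ?thesis
        using less[of k j' "B \<rhd> x"] B2 by (simp add: sB)
    next
      case small
      \<comment> \<open>The product of \<open>A\<close> and \<open>B\<close> is not visibly
        positive. Inserting A + B = 1 splits it into A A B + B A B, and commutation turns these
        terms into the visibly positive A B A and B A B.\<close>
      have "Re (cinner x (A \<rhd> B \<rhd> x)) = Re (cinner (B \<rhd> x) (A \<rhd> B \<rhd> x)) + Re (cinner (A \<rhd> x) (B \<rhd> A \<rhd> x))"
      proof -
        have "cinner (B \<rhd> x) (A \<rhd> B \<rhd> x) = cinner x (B \<rhd> A \<rhd> B \<rhd> x)"
          "cinner (A \<rhd> x) (B \<rhd> A \<rhd> x) = cinner x (A \<rhd> A \<rhd> B \<rhd> x)"
          by (metis sB) (metis sA comm)
        moreover have "cinner x (A \<rhd> B \<rhd> x) = cinner x (A \<rhd> A \<rhd> B \<rhd> x) + cinner x (B \<rhd> A \<rhd> B \<rhd> x)"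
          unfolding cinner_add_right[symmetric] by (rule arg_cong[OF sum])
        ultimately show ?thesis by simp
      qed
      then have "0 \<le> Re (cinner x (A \<rhd> B \<rhd> x))" using pA pB by simp
      moreover have "k = 0 \<or> k = 1" "j = 0 \<or> j = 1" using small by auto
      ultimately show ?thesis by (auto simp: pA pB Re_cinner_self)
    qed
  qed
qed

text \<open>Sesquilinearity, symmetry and multiplicativity of \<open>E\<close> are identities
  between complex measures; \<open>cfunctional_eqI\<close> reduces each of them to an identity
  between entries of powers of \<open>A\<close>. Countable additivity is then inherited from the
  diagonal measures.\<close>

theorem bounded_spectral_theorem:
  fixes A :: "'a::chilbert_space cblinfun"
  assumes sA: "\<And>x y. cinner (A \<rhd> x) y = cinner x (A \<rhd> y)"
    and pA: "\<And>x. 0 \<le> Re (cinner x (A \<rhd> x))" and leA: "\<And>x. Re (cinner x (A \<rhd> x)) \<le> (norm x)\<^sup>2"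
  shows "\<exists>E. projection_valued_measure E \<and> E {0..1} = cid \<and>
    (\<forall>x. cinner x (A \<rhd> x) = of_real (\<integral>r. r \<partial>diagonal_measure E x))"
proof -
  define a where "a = (\<rhd>) A"
  define B where "B = cid - A"
  have an_add: "(a ^^ m) (x + y) = (a ^^ m) x + (a ^^ m) y" for m x y
    by (induction m) (auto simp: a_def cblinfun_simps)
  have an_scale: "(a ^^ m) (c *\<^sub>C x) = c *\<^sub>C (a ^^ m) x" for m c x
    by (induction m) (auto simp: a_def cblinfun_simps)
  have an_diff: "(a ^^ m) (x - y) = (a ^^ m) x - (a ^^ m) y" for m x y
    by (induction m) (auto simp: a_def cblinfun_simps)
  have an_sym: "cinner ((a ^^ m) x) y = cinner x ((a ^^ m) y)" for m x y
    by (induction m arbitrary: x y) (auto simp: a_def sA funpow_swap1)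
  have an_sesqui: "sesqui (\<lambda>x y. cinner x ((a ^^ m) y))" for m
    by (auto simp: sesqui_def an_add an_scale cinner_simps)
  have aB: "B \<rhd> a x = a (B \<rhd> x)" for x by (simp add: a_def B_def cblinfun_simps)
  have "\<exists>M. unit_measure M \<and> (\<forall>m. (\<integral>r. r ^ m \<partial>M) = Re (cinner x ((a ^^ m) x)))" for x
  proof -
    define w where "w k j = Re (cinner x ((a ^^ k) (((\<rhd>) B ^^ j) x)))" for k j
    have "\<exists>M. unit_measure M \<and> (\<forall>m. (\<integral>r. r ^ m \<partial>M) = w m 0)"
    proof (rule hausdorff_moment)
      show "0 \<le> w k j" for k j
        unfolding w_def a_def
      proof (rule positive_products)
        show "cinner (B \<rhd> x) y = cinner x (B \<rhd> y)" for x y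
          by (simp add: B_def cblinfun_simps cinner_simps sA)
        show "0 \<le> Re (cinner x (B \<rhd> x))" for x
          using leA by (simp add: B_def cblinfun_simps cinner_simps Re_cinner_self)
      qed (simp_all add: sA pA B_def)
      show "w k j = w (Suc k) j + w k (Suc j)" for k j
      proof -
        define y where "y = ((\<rhd>) B ^^ j) x"
        have "(a ^^ k) (B \<rhd> y) = (a ^^ k) y - (a ^^ k) (a y)"
          by (simp add: B_def a_def[symmetric] cblinfun_simps an_diff)
        then show ?thesis
          by (simp add: w_def y_def[symmetric] funpow_swap1 cinner_simps)
      qed
    qed
    then show ?thesis by (simp add: w_def)
  qed
  then obtain \<nu> where \<nu>: "\<And>x. unit_measure (\<nu> x)"
    "\<And>x m. (\<integral>r. r ^ m \<partial>\<nu> x) = Re (cinner x ((a ^^ m) x))" by metis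
  have mom: "of_real (\<integral>r. r ^ m \<partial>\<nu> x) = cinner x ((a ^^ m) x)" for x m
    using an_sym[of m x x] cinner_commute[of x "(a ^^ m) x"]
    by (simp add: \<nu>(2) complex_eq_iff)
  have "\<exists>\<Lambda>. cfunctional \<Lambda> \<and> (\<forall>m. \<Lambda> (\<lambda>r. r ^ m) = cinner x ((a ^^ m) y))" for x y
  proof -
    \<comment> \<open>Polarization: the diagonal measures at the four vectors i^k x + y combine to a
      complex measure whose moments are the off-diagonal entries of the powers.\<close>
    define v where "v k = \<i> ^ k *\<^sub>C x + y" for k :: nat
    define \<Lambda> where "\<Lambda> = (\<lambda>f. 1/4 * of_real (\<integral>r. f r \<partial>\<nu> (v 0)) + (\<i> / 4 * of_real (\<integral>r. f r \<partial>\<nu> (v 1))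
        + (\<i>^2 / 4 * of_real (\<integral>r. f r \<partial>\<nu> (v 2)) + \<i>^3 / 4 * of_real (\<integral>r. f r \<partial>\<nu> (v 3)))))"
    have "cfunctional \<Lambda>"
      unfolding \<Lambda>_def by (intro cfunctional_add cfunctional_scale cfunctional_integral \<nu>)
    moreover have "\<Lambda> (\<lambda>r. r ^ m) = cinner x ((a ^^ m) y)" for m
    proof -
      have "{..<4::nat} = {0,1,2,3}" by auto
      then show ?thesis
        unfolding \<Lambda>_def mom
        by (subst sesqui_polarization[OF an_sesqui]) (simp add: v_def add_divide_distrib)
    qed
    ultimately show ?thesis by blast
  qed
  then obtain \<Lambda> where \<Lambda>: "\<And>x y. cfunctional (\<Lambda> x y)"
    "\<And>x y m. \<Lambda> x y (\<lambda>r. r ^ m) = cinner x ((a ^^ m) y)" by metis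
  have \<Lambda>diag: "\<Lambda> x x (indicator S) = of_real (measure (\<nu> x) S)" if "S \<in> sets borel" for x S
  proof -
    have "\<Lambda> x x (indicator S) = of_real (\<integral>r. indicator S r \<partial>\<nu> x)"
      by (rule cfunctional_eqI[OF \<Lambda>(1) cfunctional_integral[OF \<nu>(1)] _ that]) (simp add: \<Lambda>(2) mom)
    moreover have "sets (\<nu> x) = sets borel" "space (\<nu> x) = UNIV"
      using \<nu>(1)[of x] by (auto simp: unit_measure_def dest: sets_eq_imp_space_eq)
    ultimately show ?thesis using that by simp
  qed
  have total: "measure (\<nu> x) UNIV = (norm x)\<^sup>2" for x
  proof -
    have "space (\<nu> x) = UNIV"
      using \<nu>(1)[of x] by (auto simp: unit_measure_def dest: sets_eq_imp_space_eq)
    then show ?thesis using \<nu>(2)[of x 0] by (simp add: Re_cinner_self)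
  qed
  have sesq: "sesqui (\<lambda>x y. \<Lambda> x y (indicator S))" if S: "S \<in> sets borel" for S
    unfolding sesqui_def
  proof (intro conjI allI)
    show "\<Lambda> x (y + z) (indicator S) = \<Lambda> x y (indicator S) + \<Lambda> x z (indicator S)" for x y z
      by (rule cfunctional_eqI[OF \<Lambda>(1) cfunctional_add[OF \<Lambda>(1) \<Lambda>(1)] _ S])
        (simp add: \<Lambda>(2) an_add cinner_simps)
    show "\<Lambda> x (c *\<^sub>C y) (indicator S) = c * \<Lambda> x y (indicator S)" for c x y
      by (rule cfunctional_eqI[OF \<Lambda>(1) cfunctional_scale[OF \<Lambda>(1)] _ S])
        (simp add: \<Lambda>(2) an_scale cinner_simps)
    show "\<Lambda> (x + y) z (indicator S) = \<Lambda> x z (indicator S) + \<Lambda> y z (indicator S)" for x y z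
      by (rule cfunctional_eqI[OF \<Lambda>(1) cfunctional_add[OF \<Lambda>(1) \<Lambda>(1)] _ S])
        (simp add: \<Lambda>(2) cinner_simps)
    show "\<Lambda> (c *\<^sub>C x) y (indicator S) = cnj c * \<Lambda> x y (indicator S)" for c x y
      by (rule cfunctional_eqI[OF \<Lambda>(1) cfunctional_scale[OF \<Lambda>(1)] _ S])
        (simp add: \<Lambda>(2) cinner_simps)
  qed
  have "\<exists>F. \<forall>x y. \<Lambda> x y (indicator S) = cinner x (F \<rhd> y)" if S: "S \<in> sets borel" for S
  proof (rule sesqui_operator[OF sesq[OF S], of 1])
    fix x
    interpret finite_measure "\<nu> x" using \<nu>(1) by (simp add: unit_measure_def)
    have "space (\<nu> x) = UNIV"
      using \<nu>(1)[of x] by (auto simp: unit_measure_def dest: sets_eq_imp_space_eq)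
    then have "measure (\<nu> x) S \<le> measure (\<nu> x) UNIV" using bounded_measure[of S] by simp
    then show "cmod (\<Lambda> x x (indicator S)) \<le> 1 * (norm x)\<^sup>2"
      by (simp add: \<Lambda>diag[OF S] total)
  qed simp
  then obtain E where E: "\<And>S x y. S \<in> sets borel \<Longrightarrow> \<Lambda> x y (indicator S) = cinner x (E S \<rhd> y)"
    by metis
  have E_sym: "cinner (E S \<rhd> x) y = cinner x (E S \<rhd> y)" if S: "S \<in> sets borel" for S x y
  proof -
    have "cnj (\<Lambda> y x (indicator S)) = \<Lambda> x y (indicator S)"
    proof (rule cfunctional_eqI[OF cfunctional_cnj[OF \<Lambda>(1)] \<Lambda>(1) _ S])
      show "cnj (\<Lambda> y x (\<lambda>r. r ^ k)) = \<Lambda> x y (\<lambda>r. r ^ k)" for k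
        using an_sym[of k x y] by (simp add: \<Lambda>(2) cinner_commute[of _ y])
    qed
    then show ?thesis by (simp add: E S cinner_commute[of _ y])
  qed
  have E_mult: "E S \<rhd> E T \<rhd> y = E (S \<inter> T) \<rhd> y" if S: "S \<in> sets borel" and T: "T \<in> sets borel" for S T y
  proof (rule cinner_eqI)
    fix x
    \<comment> \<open>Two uses of uniqueness, one for each set. On r^m the left side becomes the
      \<open>T\<close>-measure at (A^m x, y), since A^m moves to \<open>x\<close>; this measure is
      in turn compared with r^m times the measure at (x, y).\<close>
    have "\<Lambda> x (E T \<rhd> y) (indicator S) = \<Lambda> x y (\<lambda>r. indicator T r * indicator S r)"
    proof (rule cfunctional_eqI[OF \<Lambda>(1) cfunctional_times[OF \<Lambda>(1)] _ S])
      fix m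
      obtain \<Lambda>' where \<Lambda>': "cfunctional \<Lambda>'"
        "\<And>f. f \<in> borel_measurable borel \<Longrightarrow> \<Lambda>' f = \<Lambda> x y (\<lambda>r. r ^ m * f r)"
        using cfunctional_power[OF \<Lambda>(1)] by metis
      have "\<Lambda> x (E T \<rhd> y) (\<lambda>r. r ^ m) = \<Lambda> ((a ^^ m) x) y (indicator T)"
        by (simp add: \<Lambda>(2) an_sym[symmetric] E T)
      also have "\<dots> = \<Lambda>' (indicator T)"
        by (rule cfunctional_eqI[OF \<Lambda>(1) \<Lambda>'(1) _ T])
          (simp add: \<Lambda>'(2) \<Lambda>(2) power_add[symmetric] an_sym funpow_add)
      also have "\<dots> = \<Lambda> x y (\<lambda>r. indicator T r * r ^ m)"
        using T by (simp add: \<Lambda>'(2) mult.commute)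
      finally show "\<Lambda> x (E T \<rhd> y) (\<lambda>r. r ^ m) = \<Lambda> x y (\<lambda>r. indicator T r * r ^ m)" .
    qed (use T in \<open>auto simp: indicator_def\<close>)
    then show "cinner x (E S \<rhd> E T \<rhd> y) = cinner x (E (S \<inter> T) \<rhd> y)"
      using S T by (simp add: E indicator_inter_arith[symmetric] Int_commute flip: E)
  qed
  have E_norm: "(norm (E S \<rhd> x))\<^sup>2 = measure (\<nu> x) S" if S: "S \<in> sets borel" for S x
  proof -
    have "of_real ((norm (E S \<rhd> x))\<^sup>2) = cinner x (E S \<rhd> x)"
      using E_mult[OF S S] by (simp add: cinner_self[symmetric] E_sym[OF S] del: of_real_power)
    also have "\<dots> = of_real (measure (\<nu> x) S)" using \<Lambda>diag[OF S, of x] S by (simp add: E)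
    finally show ?thesis by (simp only: of_real_eq_iff)
  qed
  have E_UNIV: "E UNIV \<rhd> x = x" for x
  proof (rule cinner_eqI)
    fix y
    have "\<Lambda> y x (indicator UNIV) = \<Lambda> y x (\<lambda>r. r ^ 0)"
      by (simp add: indicator_def)
    also have "\<dots> = cinner y x" unfolding \<Lambda>(2) by simp
    finally show "cinner y (E UNIV \<rhd> x) = cinner y x" using E[of UNIV y x] by simp
  qed
  have E_add: "E (S \<union> T) \<rhd> x = E S \<rhd> x + E T \<rhd> x"
    if S: "S \<in> sets borel" and T: "T \<in> sets borel" and d: "S \<inter> T = {}" for S T x
  proof (rule cblinfun_eq_quadratic[THEN arg_cong[where f = "\<lambda>B. B \<rhd> x"], of "E (S \<union> T)" "E S + E T", unfolded cblinfun.add_left])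
    fix x
    interpret finite_measure "\<nu> x" using \<nu>(1) by (simp add: unit_measure_def)
    have "sets (\<nu> x) = sets borel" using \<nu>(1)[of x] by (simp add: unit_measure_def)
    then have "measure (\<nu> x) (S \<union> T) = measure (\<nu> x) S + measure (\<nu> x) T"
      using S T d by (intro finite_measure_Union) auto
    then show "cinner x ((E (S \<union> T)) \<rhd> x) = cinner x (E S \<rhd> x + E T \<rhd> x)"
      using S T \<Lambda>diag[of _ x] by (simp add: E[symmetric] cinner_simps)
  qed
  have pvm: "projection_valued_measure E"
    unfolding projection_valued_measure_def
  proof (intro conjI ballI allI impI)
    show "orthogonal_projection (E S)" if "S \<in> sets borel" for S
      using that by (simp add: orthogonal_projection_def E_mult E_sym)
    show "E UNIV \<rhd> x = x" for x by (rule E_UNIV)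
    fix S :: "nat \<Rightarrow> real set" and x
    assume S: "range S \<subseteq> sets borel \<and> disjoint_family S"
    then have Sb [measurable]: "S i \<in> sets borel" for i by auto
    interpret finite_measure "\<nu> x" using \<nu>(1) by (simp add: unit_measure_def)
    have sets\<nu>: "sets (\<nu> x) = sets borel" using \<nu>(1)[of x] by (simp add: unit_measure_def)
    have part: "(\<Sum>i<n. E (S i) \<rhd> x) = E (\<Union>i<n. S i) \<rhd> x" for n
    proof (induction n)
      case 0
      then show ?case using E_norm[of "{}" x] by simp
    next
      case (Suc n)
      have "(\<Union>i<n. S i) \<inter> S n = {}"
      proof -
        have "S i \<inter> S n = {}" if "i < n" for i
          using S that unfolding disjoint_family_on_def by (metis UNIV_I less_irrefl)
        then show ?thesis by blast
      qed
      then have "E ((\<Union>i<n. S i) \<union> S n) \<rhd> x = E (\<Union>i<n. S i) \<rhd> x + E (S n) \<rhd> x"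
        by (intro E_add) auto
      then show ?case using Suc by (simp add: lessThan_Suc Un_commute)
    qed
    \<comment> \<open>The remainder is \<open>E\<close> of a tail set, so its squared norm is a
      \<open>\<nu> x\<close> measure; strong convergence thus follows from scalar countable
      additivity.\<close>
    have diff: "(norm (E (\<Union>i. S i) \<rhd> x - (\<Sum>i<n. E (S i) \<rhd> x)))\<^sup>2
        = measure (\<nu> x) (\<Union>i. S i) - (\<Sum>i<n. measure (\<nu> x) (S i))" for n
    proof -
      have "E ((\<Union>i<n. S i) \<union> ((\<Union>i. S i) - (\<Union>i<n. S i))) \<rhd> x
          = E (\<Union>i<n. S i) \<rhd> x + E ((\<Union>i. S i) - (\<Union>i<n. S i)) \<rhd> x"
        by (intro E_add) auto
      moreover have "(\<Union>i<n. S i) \<union> ((\<Union>i. S i) - (\<Union>i<n. S i)) = (\<Union>i. S i)" by auto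
      ultimately have "E (\<Union>i. S i) \<rhd> x = E (\<Union>i<n. S i) \<rhd> x + E ((\<Union>i. S i) - (\<Union>i<n. S i)) \<rhd> x"
        by simp
      then have "(norm (E (\<Union>i. S i) \<rhd> x - (\<Sum>i<n. E (S i) \<rhd> x)))\<^sup>2
          = measure (\<nu> x) ((\<Union>i. S i) - (\<Union>i<n. S i))"
        unfolding part by (simp add: E_norm)
      also have "\<dots> = measure (\<nu> x) (\<Union>i. S i) - measure (\<nu> x) (\<Union>i<n. S i)"
        by (intro finite_measure_Diff) (auto simp: sets\<nu>)
      also have "measure (\<nu> x) (\<Union>i<n. S i) = (\<Sum>i<n. measure (\<nu> x) (S i))"
        using S by (intro finite_measure_finite_Union)
          (auto simp: sets\<nu> disjoint_family_on_def)
      finally show ?thesis .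
    qed
    have "(\<lambda>i. measure (\<nu> x) (S i)) sums measure (\<nu> x) (\<Union>i. S i)"
      using S by (intro finite_measure_UNION) (auto simp: sets\<nu>)
    then have "(\<lambda>n. measure (\<nu> x) (\<Union>i. S i) - (\<Sum>i<n. measure (\<nu> x) (S i))) \<longlonglongrightarrow> 0"
      unfolding sums_def by (intro tendsto_eq_intros) auto
    then have "(\<lambda>n. sqrt ((norm (E (\<Union>i. S i) \<rhd> x - (\<Sum>i<n. E (S i) \<rhd> x)))\<^sup>2)) \<longlonglongrightarrow> sqrt 0"
      unfolding diff by (rule tendsto_real_sqrt)
    then have "(\<lambda>n. E (\<Union>i. S i) \<rhd> x - (\<Sum>i<n. E (S i) \<rhd> x)) \<longlonglongrightarrow> 0"
      by (simp add: tendsto_norm_zero_iff)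
    from tendsto_diff[OF tendsto_const[of "E (\<Union>i. S i) \<rhd> x"] this]
    show "(\<lambda>i. E (S i) \<rhd> x) sums (E (\<Union>i. S i) \<rhd> x)"
      by (simp add: sums_def)
  qed
  interpret pvm E by standard (rule pvm)
  have \<nu>eq: "\<mu> x = \<nu> x" for x
  proof (rule measure_eqI)
    interpret finite_measure "\<nu> x" using \<nu>(1) by (simp add: unit_measure_def)
    show "sets (\<mu> x) = sets (\<nu> x)" using \<nu>(1)[of x] by (simp add: unit_measure_def)
    show "emeasure (\<mu> x) S = emeasure (\<nu> x) S" if "S \<in> sets (\<mu> x)" for S
      using that by (simp add: emeasure_\<mu> E_norm emeasure_eq_measure)
  qed
  have "E {0..1} = cid"
  proof (rule cblinfun_eq_quadratic)
    fix x
    interpret finite_measure "\<nu> x" using \<nu>(1) by (simp add: unit_measure_def)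
    have "space (\<nu> x) = UNIV"
      using \<nu>(1)[of x] by (auto simp: unit_measure_def dest: sets_eq_imp_space_eq)
    then have "measure (\<nu> x) {0..1} = measure (\<nu> x) UNIV"
      using \<nu>(1)[of x] by (intro finite_measure_eq_AE) (auto simp: unit_measure_def)
    then show "cinner x (E {0..1} \<rhd> x) = cinner x (cid \<rhd> x)"
      by (simp add: E[symmetric] \<Lambda>diag total cinner_self)
  qed
  moreover have "cinner x (A \<rhd> x) = of_real (\<integral>r. r \<partial>diagonal_measure E x)" for x
    using mom[of x 1] by (simp add: \<nu>eq a_def)
  ultimately show ?thesis using pvm by blast
qed


section \<open>The spectral theorem for nonnegative self-adjoint operators\<close>

lemma single_valued_linear_operator: "linear_operator T \<Longrightarrow> (x, y) \<in> T \<Longrightarrow> (x, z) \<in> T \<Longrightarrow> y = z"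
  unfolding linear_operator_def single_valued_def by blast

lemma linear_operator_add:
  "linear_operator T \<Longrightarrow> (x, y) \<in> T \<Longrightarrow> (x', y') \<in> T \<Longrightarrow> (x + x', y + y') \<in> T"
  unfolding linear_operator_def by blast

lemma linear_operator_scaleC: "linear_operator T \<Longrightarrow> (x, y) \<in> T \<Longrightarrow> (c *\<^sub>C x, c *\<^sub>C y) \<in> T"
  unfolding linear_operator_def by blast

lemma linear_operator_diff:
  "linear_operator T \<Longrightarrow> (x, y) \<in> T \<Longrightarrow> (x', y') \<in> T \<Longrightarrow> (x - x', y - y') \<in> T"
  using linear_operator_add[of T x y "- x'" "- y'"] linear_operator_scaleC[of T x' y' "- 1"]
  by (simp add: scaleC_minus_one)

lemma self_adjoint_linear: "self_adjoint H \<Longrightarrow> linear_operator H"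
  by (simp add: self_adjoint_def)

lemma self_adjoint_symmetric:
  assumes "self_adjoint H" "(x, y) \<in> H" "(x', y') \<in> H"
  shows "cinner y x' = cinner x y'"
proof -
  have "(x', y') \<in> adjoint_operator H" using assms by (simp add: self_adjoint_def)
  then show ?thesis using assms(2) unfolding adjoint_operator_def by blast
qed

lemma self_adjointI:
  assumes "self_adjoint H" "\<And>x y. (x, y) \<in> H \<Longrightarrow> cinner y v = cinner x w"
  shows "(v, w) \<in> H"
proof -
  have "(v, w) \<in> adjoint_operator H" using assms(2) by (auto simp: adjoint_operator_def)
  then show ?thesis using assms(1) by (simp add: self_adjoint_def)
qed

lemma self_adjoint_closed:
  assumes H: "self_adjoint H" and conv: "u \<longlonglongrightarrow> v" "w \<longlonglongrightarrow> z" and mem: "\<And>n. (u n, w n) \<in> H"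
  shows "(v, z) \<in> H"
proof (rule self_adjointI[OF H])
  fix x y assume xy: "(x, y) \<in> H"
  have "(\<lambda>n. cinner y (u n)) \<longlonglongrightarrow> cinner y v" "(\<lambda>n. cinner x (w n)) \<longlonglongrightarrow> cinner x z"
    by (intro tendsto_intros conv)+
  moreover have "cinner y (u n) = cinner x (w n)" for n
    using self_adjoint_symmetric[OF H xy mem] .
  ultimately show "cinner y v = cinner x z" using LIMSEQ_unique by auto
qed

lemma nonneg_operatorD: "nonneg_operator H \<Longrightarrow> (x, y) \<in> H \<Longrightarrow> 0 \<le> Re (cinner x y)"
  unfolding nonneg_operator_def by (auto simp: nonneg_Reals_def)

text \<open>The cross term in |x + y|^2 is nonnegative. The bound makes H + 1 injective and, since
  it controls \<open>x\<close> and \<open>y\<close> at once, gives closedness of its range.\<close>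

lemma norm_le_shifted:
  assumes "nonneg_operator H" "(x, y) \<in> H"
  shows "norm x \<le> norm (x + y)" "norm y \<le> norm (x + y)"
proof -
  have "(norm x)\<^sup>2 \<le> (norm (x + y))\<^sup>2" "(norm y)\<^sup>2 \<le> (norm (x + y))\<^sup>2"
    using nonneg_operatorD[OF assms] by (simp_all add: norm_add_sq)
  from this[THEN power2_le_imp_le] show "norm x \<le> norm (x + y)" "norm y \<le> norm (x + y)"
    by simp_all
qed

text \<open>The range of H + 1 is closed. A vector orthogonal to it lies in the domain of the
  adjoint, hence of \<open>H\<close>, as an eigenvector for -1, which positivity excludes unless it
  is 0.\<close>

lemma shifted_surjective:
  assumes H: "self_adjoint H" and nonneg: "nonneg_operator H"
  shows "\<exists>x y. (x, y) \<in> H \<and> v = x + y"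
proof -
  note lin = self_adjoint_linear[OF H]
  define V where "V = {x + y | x y. (x, y) \<in> H}"
  have V: "clinear_on V"
    unfolding clinear_on_def
  proof (intro conjI ballI allI)
    show "0 \<in> V" using lin unfolding V_def linear_operator_def by (auto intro!: exI[of _ 0])
    show "a + b \<in> V" if ab: "a \<in> V" "b \<in> V" for a b
    proof -
      obtain x y x' y' where "(x, y) \<in> H" "(x', y') \<in> H" "a = x + y" "b = x' + y'"
        using ab by (auto simp: V_def)
      then show ?thesis
        unfolding V_def using linear_operator_add[OF lin, of x y x' y']
        by (intro CollectI exI[of _ "x + x'"] exI[of _ "y + y'"]) (simp add: add_ac)
    qed
    show "c *\<^sub>C a \<in> V" if a: "a \<in> V" for c a
    proof -
      obtain x y where "(x, y) \<in> H" "a = x + y" using a by (auto simp: V_def)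
      then show ?thesis
        unfolding V_def using linear_operator_scaleC[OF lin, of x y c] by (force simp: scaleC_add_right)
    qed
  qed
  have "closed V"
    unfolding closed_sequential_limits
  proof (intro allI impI, elim conjE)
    fix f l assume f: "\<forall>n. f n \<in> V" and l: "f \<longlonglongrightarrow> l"
    then obtain x y where xy: "\<And>n. (x n, y n) \<in> H" "\<And>n. f n = x n + y n"
      unfolding V_def by (simp add: set_eq_iff) metis
    have d: "dist (x m) (x n) \<le> dist (f m) (f n)" "dist (y m) (y n) \<le> dist (f m) (f n)" for m n
      using norm_le_shifted[OF nonneg linear_operator_diff[OF lin xy(1)[of m] xy(1)[of n]]]
      by (auto simp: dist_norm xy(2) algebra_simps)
    have "Cauchy f" using l by (rule LIMSEQ_imp_Cauchy)
    then have "Cauchy x" "Cauchy y" using d unfolding Cauchy_def by (meson le_less_trans)+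
    then obtain a b where ab: "x \<longlonglongrightarrow> a" "y \<longlonglongrightarrow> b"
      using Cauchy_convergent convergent_def by metis
    have "(a, b) \<in> H" using self_adjoint_closed[OF H ab xy(1)] .
    moreover have "f \<longlonglongrightarrow> a + b" unfolding xy(2) by (intro tendsto_intros ab)
    ultimately show "l \<in> V" using LIMSEQ_unique[OF l] by (auto simp: V_def)
  qed
  then obtain p where p: "p \<in> V" "\<And>q. q \<in> V \<Longrightarrow> cinner q (v - p) = 0"
    using orthogonal_decomposition[OF V] by blast
  have "(v - p, - (v - p)) \<in> H"
  proof (rule self_adjointI[OF H])
    fix x y assume "(x, y) \<in> H"
    then have "cinner (x + y) (v - p) = 0" by (intro p(2)) (auto simp: V_def)
    then show "cinner y (v - p) = cinner x (- (v - p))"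
      by (simp only: cinner_add_left cinner_minus_right) (simp add: eq_neg_iff_add_eq_0 add.commute)
  qed
  then have "norm (v - p) \<le> norm ((v - p) + - (v - p))" by (rule norm_le_shifted[OF nonneg])
  then have "v = p" by simp
  then show ?thesis using p(1) by (auto simp: V_def)
qed

text \<open>Both bounds on the form come from splitting \<open>x = f x + (x - f x)\<close>, where
  the second summand is \<open>H\<close> applied to the first and therefore has nonnegative real
  inner product with it.\<close>

lemma shifted_inverse:
  assumes H: "self_adjoint H" and nonneg: "nonneg_operator H"
  shows "\<exists>A. (\<forall>v. (A \<rhd> v, v - A \<rhd> v) \<in> H) \<and> (\<forall>x y. (x, y) \<in> H \<longrightarrow> A \<rhd> (x + y) = x) \<and>
    (\<forall>x y. cinner (A \<rhd> x) y = cinner x (A \<rhd> y)) \<and>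
    (\<forall>x. 0 \<le> Re (cinner x (A \<rhd> x)) \<and> Re (cinner x (A \<rhd> x)) \<le> (norm x)\<^sup>2)"
proof -
  note lin = self_adjoint_linear[OF H]
  obtain f where f: "\<And>v. (f v, v - f v) \<in> H"
    using shifted_surjective[OF H nonneg] by (metis add_diff_cancel_left')
  have uniq: "f (x + y) = x" if "(x, y) \<in> H" for x y
    using norm_le_shifted(1)[OF nonneg linear_operator_diff[OF lin f[of "x + y"] that]] by simp
  have "\<exists>A. \<forall>x. A \<rhd> x = f x"
  proof (rule cblinfun_exI[where K = 1])
    show "f (x + y) = f x + f y" for x y
      using uniq[OF linear_operator_add[OF lin f[of x] f[of y]]] by (simp add: algebra_simps)
    show "f (c *\<^sub>C x) = c *\<^sub>C f x" for c x
      using uniq[OF linear_operator_scaleC[OF lin f[of x], of c]]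
      by (simp add: scaleC_add_right[symmetric])
    show "norm (f x) \<le> 1 * norm x" for x
      using norm_le_shifted(1)[OF nonneg f[of x]] by simp
  qed
  then obtain A where A: "\<And>x. A \<rhd> x = f x" by blast
  have sym: "cinner (f x) y = cinner x (f y)" for x y
    using self_adjoint_symmetric[OF H f[of x] f[of y]] by (simp add: cinner_simps)
  have "0 \<le> Re (cinner x (f x))" "Re (cinner x (f x)) \<le> (norm x)\<^sup>2" for x
  proof -
    have 1: "0 \<le> Re (cinner (f x) (x - f x))" by (rule nonneg_operatorD[OF nonneg f])
    then have 2: "(norm (f x))\<^sup>2 \<le> Re (cinner x (f x))"
      by (simp add: cinner_simps Re_cinner_self Re_cinner_commute[of "f x" x])
    then show "0 \<le> Re (cinner x (f x))" using zero_le_power2 order_trans by blast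
    have "(norm (f x + (x - f x)))\<^sup>2
        = (norm (f x))\<^sup>2 + 2 * Re (cinner (f x) (x - f x)) + (norm (x - f x))\<^sup>2"
      by (rule norm_add_sq)
    then have "(norm x)\<^sup>2 \<ge> (norm (f x))\<^sup>2 + Re (cinner (f x) (x - f x))" using 1 by simp
    then show "Re (cinner x (f x)) \<le> (norm x)\<^sup>2"
      by (simp add: cinner_simps Re_cinner_self Re_cinner_commute[of "f x" x])
  qed
  then show ?thesis using f uniq sym by (intro exI[of _ A]) (auto simp: A)
qed

lemma (in pvm) AE_\<mu>:
  assumes S: "S \<in> sets borel" and E: "E S = cid"
  shows "AE l in \<mu> x. l \<in> S"
proof -
  have "E (S \<union> - S) = E S + E (- S)" using S by (intro E_Un) auto
  then have "E (- S) = 0" using E by simp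
  then have "emeasure (\<mu> x) (- S) = 0" using S by (subst emeasure_\<mu>) auto
  then show ?thesis using S by (intro AE_I[of _ _ "- S"]) auto
qed

lemma distr_pvm:
  fixes E :: "real set \<Rightarrow> 'a::chilbert_space cblinfun"
  assumes E: "projection_valued_measure E" and h [measurable]: "h \<in> borel_measurable borel"
  shows "projection_valued_measure (\<lambda>S. E (h -` S))"
    and "diagonal_measure (\<lambda>S. E (h -` S)) x = distr (diagonal_measure E x) borel h"
proof -
  have meas: "h -` S \<in> sets borel" if "S \<in> sets borel" for S
    using measurable_sets[OF h that] by simp
  show pv: "projection_valued_measure (\<lambda>S. E (h -` S))"
    unfolding projection_valued_measure_def
  proof (intro conjI ballI allI impI)
    show "orthogonal_projection (E (h -` S))" if "S \<in> sets borel" for S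
      using E meas[OF that] by (simp add: projection_valued_measure_def)
    show "E (h -` UNIV) \<rhd> x = x" for x
      using E by (simp add: projection_valued_measure_def)
    fix S :: "nat \<Rightarrow> real set" and x
    assume S: "range S \<subseteq> sets borel \<and> disjoint_family S"
    have "range (\<lambda>i. h -` S i) \<subseteq> sets borel" "disjoint_family (\<lambda>i. h -` S i)"
      using S meas unfolding disjoint_family_on_def by (auto simp: vimage_Int[symmetric] simp del: vimage_Int)
    then have "(\<lambda>i. E (h -` S i) \<rhd> x) sums E (\<Union>i. h -` S i) \<rhd> x"
      using E unfolding projection_valued_measure_def by blast
    then show "(\<lambda>i. E (h -` S i) \<rhd> x) sums E (h -` (\<Union>i. S i)) \<rhd> x" by (simp add: vimage_UN)
  qed
  interpret E: pvm E by standard (rule E)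
  interpret F: pvm "\<lambda>S. E (h -` S)" by standard (rule pv)
  show "diagonal_measure (\<lambda>S. E (h -` S)) x = distr (diagonal_measure E x) borel h"
  proof (rule measure_eqI)
    fix S assume "S \<in> sets (diagonal_measure (\<lambda>S. E (h -` S)) x)"
    then show "emeasure (diagonal_measure (\<lambda>S. E (h -` S)) x) S
        = emeasure (distr (diagonal_measure E x) borel h) S"
      using meas by (simp add: F.emeasure_\<mu> E.emeasure_\<mu> emeasure_distr)
  qed simp
qed

text \<open>The resolvent \<open>A = (H + 1)\<^sup>-\<^sup>1\<close> lies between 0 and 1, and \<open>r \<mapsto> 1/r - 1\<close> carries its spectral
  measure to one of \<open>H\<close>; the atom at \<open>r = 0\<close> vanishes because \<open>A\<close> is injective.\<close>

theorem spectral_theorem: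
  fixes H :: "'a::chilbert_space opgraph"
  assumes H: "self_adjoint H" and nonneg: "nonneg_operator H"
  shows "\<exists>E. projection_valued_measure E \<and> has_spectral_integral E (\<lambda>l. l) H"
proof -
  note lin = self_adjoint_linear[OF H]
  obtain A where A: "\<And>v. (A \<rhd> v, v - A \<rhd> v) \<in> H" "\<And>x y. (x, y) \<in> H \<Longrightarrow> A \<rhd> (x + y) = x"
    and A_sym: "\<And>x y. cinner (A \<rhd> x) y = cinner x (A \<rhd> y)"
    and A_pos: "\<And>x. 0 \<le> Re (cinner x (A \<rhd> x))" and A_le: "\<And>x. Re (cinner x (A \<rhd> x)) \<le> (norm x)\<^sup>2"
    using shifted_inverse[OF H nonneg] by blast
  obtain F where F: "projection_valued_measure F" and F01: "F {0..1} = cid"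
    and AF: "\<And>x. cinner x (A \<rhd> x) = of_real (\<integral>r. r \<partial>diagonal_measure F x)"
    using bounded_spectral_theorem[OF A_sym A_pos A_le] by blast
  interpret pvm F by standard (rule F)
  \<comment> \<open>The identity function cut off to [0, 1], where \<open>F\<close> lives; the
    cutoff makes it bounded on the line, so that \<open>A\<close> becomes
    \<open>calc g\<close>.\<close>
  define g :: "real \<Rightarrow> real" where "g r = r * indicator {0..1} r" for r
  have g: "bounded_borel g"
    by (rule bounded_borelI[of _ 1]) (auto simp: g_def[abs_def] indicator_def)
  have g_meas [measurable]: "g \<in> borel_measurable borel" using g by (rule bounded_borelD)
  have calc_g: "calc g = A"
  proof (rule cblinfun_eq_quadratic)
    fix x
    have "AE r in \<mu> x. g r = r"
      using AE_\<mu>[OF _ F01, of x] by (auto simp: g_def elim!: AE_mp)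
    then have "(\<integral>r. g r \<partial>\<mu> x) = (\<integral>r. r \<partial>\<mu> x)" by (intro integral_cong_AE) auto
    then show "cinner x (calc g \<rhd> x) = cinner x (A \<rhd> x)" using g by (simp add: cinner_calc AF)
  qed
  have inj: "v = 0" if "A \<rhd> v = 0" for v
  proof -
    have "(0, v) \<in> H" using A(1)[of v] that by simp
    moreover have "(0, 0) \<in> H" using lin by (simp add: linear_operator_def)
    ultimately show ?thesis using single_valued_linear_operator[OF lin] by blast
  qed
  have "calc (\<lambda>r. g r * indicator {0} r) = A * F {0}"
    using g by (subst calc_mult) (auto simp: calc_g calc_indicator)
  moreover have "(\<lambda>r. g r * indicator {0} r) = (\<lambda>r. 0 * g r)"
    by (auto simp: g_def indicator_def)
  ultimately have "A * F {0} = 0" using calc_scale[OF g, of 0] by simp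
  then have F0: "F {0} = 0"
    using inj by (intro cblinfun_eqI) (metis cblinfun_zero_left times_cblinfun_apply)
  have "{0..1} = {0} \<union> {0<..1::real}" by auto
  then have "F {0..1} = F {0} + F {0<..1}" by (metis E_Un F0 Int_insert_left_if0 borel_singleton
        greaterThanAtMost_borel greaterThanAtMost_iff inf_bot_left less_irrefl sets.empty_sets)
  then have Fpos: "F {0<..1} = cid" using F0 F01 by simp
  have AEpos: "AE r in \<mu> x. 0 < r \<and> r \<le> 1" for x
    using AE_\<mu>[OF _ Fpos, of x] by simp
  define h :: "real \<Rightarrow> real" where "h r = 1 / r - 1" for r
  have h [measurable]: "h \<in> borel_measurable borel" unfolding h_def by measurable
  have \<mu>A: "\<mu> (A \<rhd> v) = density (\<mu> v) (\<lambda>r. ennreal ((g r)\<^sup>2))" for v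
    using \<mu>_calc[OF g, of v] by (simp add: calc_g)
  \<comment> \<open>Writing x = A v turns the weight h^2 at \<open>x\<close> into (g h)^2 at
    \<open>v\<close>, and g h = 1 - r is bounded on (0, 1].\<close>
  have dom1: "(\<integral>\<^sup>+ r. ennreal ((h r)\<^sup>2) \<partial>\<mu> x) < \<infinity>" if x: "x \<in> Domain H" for x
  proof -
    obtain y where "(x, y) \<in> H" using x by auto
    then have xA: "x = A \<rhd> (x + y)" using A(2) by simp
    define v where "v = x + y"
    have "(\<integral>\<^sup>+ r. ennreal ((h r)\<^sup>2) \<partial>\<mu> x) = (\<integral>\<^sup>+ r. ennreal ((g r)\<^sup>2) * ennreal ((h r)\<^sup>2) \<partial>\<mu> v)"
      by (subst xA, unfold v_def[symmetric] \<mu>A, subst nn_integral_density) auto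
    also have "\<dots> \<le> (\<integral>\<^sup>+ r. ennreal 1 \<partial>\<mu> v)"
    proof (rule nn_integral_mono_AE)
      show "AE r in \<mu> v. ennreal ((g r)\<^sup>2) * ennreal ((h r)\<^sup>2) \<le> ennreal 1"
        using AEpos[of v]
      proof eventually_elim
        case (elim r)
        then have "g r * h r = 1 - r" by (simp add: g_def h_def field_simps)
        then have "(g r)\<^sup>2 * (h r)\<^sup>2 = (1 - r)\<^sup>2" by (metis power_mult_distrib)
        moreover have "(1 - r)\<^sup>2 \<le> 1" using elim by (simp add: power_le_one)
        ultimately show ?case by (simp add: ennreal_mult[symmetric] del: ennreal_1)
      qed
    qed
    also have "\<dots> < \<infinity>" by (simp add: emeasure_\<mu>[of UNIV, simplified])
    finally show ?thesis .
  qed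
  have dom2: "x \<in> Domain H" if fin: "(\<integral>\<^sup>+ r. ennreal ((h r)\<^sup>2) \<partial>\<mu> x) < \<infinity>" for x
  proof -
    interpret finite_measure "\<mu> x" by simp
    \<comment> \<open>\<open>K\<close> stands for 1/r, the symbol of H + 1, and the
      \<open>k n\<close> are its bounded cutoffs. Square-integrability of \<open>K\<close> makes
      \<open>calc (k n) \<rhd> x\<close> Cauchy; its limit is a preimage of \<open>x\<close> under
      \<open>A\<close>, so \<open>x\<close> lies in the domain.\<close>
    define K where "K r = indicator {0<..1} r / r" for r :: real
    define k where "k n r = indicator {1 / real (Suc n)..1} r / r" for n and r :: real
    have [measurable]: "K \<in> borel_measurable borel" "k n \<in> borel_measurable borel" for n
      unfolding K_def k_def by measurable
    have kK: "0 \<le> k n r" "k n r \<le> K r" "0 \<le> K r" for n r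
      by (auto simp: k_def K_def indicator_def intro: order_trans[of 0 "1 / real (Suc n)"]
          less_le_trans[of 0 "1 / real (Suc n)"])
    have kb: "bounded_borel (k n)" for n
    proof (rule bounded_borelI[of _ "real (Suc n)"])
      show "\<bar>k n r\<bar> \<le> real (Suc n)" for r
      proof (cases "1 / real (Suc n) \<le> r")
        case True
        then have "0 < r" by (rule less_le_trans[rotated]) simp
        then have "1 / r \<le> real (Suc n)" using True by (simp add: field_simps)
        then show ?thesis using \<open>0 < r\<close> by (auto simp: k_def indicator_def)
      qed (simp add: k_def)
    qed measurable
    have hint: "integrable (\<mu> x) (\<lambda>r. (h r)\<^sup>2)"
      using fin by (intro integrableI_bounded) auto
    have Kint: "integrable (\<mu> x) (\<lambda>r. (K r)\<^sup>2)"
    proof (rule Bochner_Integration.integrable_bound)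
      show "integrable (\<mu> x) (\<lambda>r. 2 * (h r)\<^sup>2 + 2)" using hint by auto
      show "AE r in \<mu> x. norm ((K r)\<^sup>2) \<le> norm (2 * (h r)\<^sup>2 + 2)"
      proof (rule AE_I2)
        fix r
        have "(K r)\<^sup>2 \<le> (h r + 1)\<^sup>2"
          by (auto simp: K_def h_def indicator_def power_divide)
        also have "\<dots> \<le> 2 * (h r)\<^sup>2 + 2"
          using zero_le_power2[of "h r - 1"] by (simp add: power2_sum power2_diff)
        finally show "norm ((K r)\<^sup>2) \<le> norm (2 * (h r)\<^sup>2 + 2)" by simp
      qed
    qed measurable
    define y where "y n = calc (k n) \<rhd> x" for n
    define e where "e n = (\<integral>r. (k n r - K r)\<^sup>2 \<partial>\<mu> x)" for n
    have kKb: "(k n r - K r)\<^sup>2 \<le> (K r)\<^sup>2" for n r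
      using kK(1)[of n r] kK(2)[of n r] power_mono[of "K r - k n r" "K r" 2] by (simp add: power2_commute)
    have kKint: "integrable (\<mu> x) (\<lambda>r. (k n r - K r)\<^sup>2)" for n
      by (rule Bochner_Integration.integrable_bound[OF Kint]) (use kKb in \<open>auto\<close>)
    have "e \<longlonglongrightarrow> (\<integral>r. 0 \<partial>\<mu> x)"
      unfolding e_def
    proof (rule integral_dominated_convergence[OF _ _ Kint])
      show "AE r in \<mu> x. (\<lambda>n. (k n r - K r)\<^sup>2) \<longlonglongrightarrow> 0"
      proof (rule AE_I2, rule tendsto_eventually)
        fix r :: real
        show "\<forall>\<^sub>F n in sequentially. (k n r - K r)\<^sup>2 = 0"
        proof (cases "0 < r")
          case True
          then obtain N where N: "1 / r < real N" using reals_Archimedean2 by blast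
          have "1 / real (Suc n) \<le> r" if "n \<ge> N" for n
          proof -
            have "1 / r < real (Suc n)" using N that by linarith
            then show ?thesis using True by (simp add: field_simps)
          qed
          then show ?thesis using True
            by (auto simp: eventually_sequentially k_def K_def indicator_def intro!: exI[of _ N])
        next
          case False
          have "k n r = 0" for n
            using False kK(2)[of n r] kK(1)[of n r] by (simp add: K_def)
          then show ?thesis using False by (simp add: K_def)
        qed
      qed
      show "AE r in \<mu> x. norm ((k n r - K r)\<^sup>2) \<le> (K r)\<^sup>2" for n using kKb by simp
    qed measurable
    then have e0: "e \<longlonglongrightarrow> 0" by simp
    have est: "(norm (y m - y n))\<^sup>2 \<le> 2 * e m + 2 * e n" for m n
    proof -
      have "(norm (y m - y n))\<^sup>2 = (norm (calc (\<lambda>r. k m r - k n r) \<rhd> x))\<^sup>2"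
        by (simp add: y_def calc_diff kb cblinfun_simps)
      also have "\<dots> = (\<integral>r. (k m r - k n r)\<^sup>2 \<partial>\<mu> x)"
        by (intro norm_calc_sq bounded_borel_intros kb)
      also have "\<dots> \<le> (\<integral>r. 2 * (k m r - K r)\<^sup>2 + 2 * (k n r - K r)\<^sup>2 \<partial>\<mu> x)"
      proof (rule integral_mono)
        have "bounded_borel (\<lambda>r. (k m r - k n r) * (k m r - k n r))"
          by (intro bounded_borel_intros kb)
        then show "integrable (\<mu> x) (\<lambda>r. (k m r - k n r)\<^sup>2)" by (simp add: power2_eq_square)
        show "(k m r - k n r)\<^sup>2 \<le> 2 * (k m r - K r)\<^sup>2 + 2 * (k n r - K r)\<^sup>2" for r
          using zero_le_power2[of "(k m r - K r) + (k n r - K r)"]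
          by (simp add: power2_eq_square algebra_simps)
      qed (use kKint in auto)
      also have "\<dots> = 2 * e m + 2 * e n" using kKint by (simp add: e_def)
      finally show ?thesis .
    qed
    have "Cauchy y"
    proof (rule metric_CauchyI)
      fix \<epsilon> :: real assume "\<epsilon> > 0"
      then have "\<forall>\<^sub>F n in sequentially. e n < \<epsilon>\<^sup>2 / 4"
        using e0 by (intro order_tendstoD(2)[OF e0]) auto
      then obtain N where N: "\<And>n. n \<ge> N \<Longrightarrow> e n < \<epsilon>\<^sup>2 / 4" by (auto simp: eventually_sequentially)
      have "dist (y m) (y n) < \<epsilon>" if "m \<ge> N" "n \<ge> N" for m n
      proof -
        have "(norm (y m - y n))\<^sup>2 < \<epsilon>\<^sup>2" using est[of m n] N[OF that(1)] N[OF that(2)] by linarith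
        then show ?thesis using \<open>\<epsilon> > 0\<close> by (simp add: dist_norm power_less_imp_less_base)
      qed
      then show "\<exists>M. \<forall>m\<ge>M. \<forall>n\<ge>M. dist (y m) (y n) < \<epsilon>" by blast
    qed
    then obtain z where z: "y \<longlonglongrightarrow> z" using Cauchy_convergent convergent_def by blast
    have "A \<rhd> y n = calc (indicator {1 / real (Suc n)..1}) \<rhd> x" for n
    proof -
      have "A \<rhd> y n = calc (\<lambda>r. g r * k n r) \<rhd> x"
        by (simp add: y_def calc_mult g kb calc_g times_cblinfun_apply)
      also have "(\<lambda>r. g r * k n r) = indicator {1 / real (Suc n)..1}"
        by (auto simp: g_def k_def indicator_def fun_eq_iff intro: order_trans[of 0 "1 / real (Suc n)"]
            dest: less_le_trans[of 0 "1 / real (Suc n)" 0])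
      finally show ?thesis .
    qed
    moreover have "(\<lambda>n. calc (indicator {1 / real (Suc n)..1}) \<rhd> x) \<longlonglongrightarrow> calc (indicator {0<..1}) \<rhd> x"
    proof (rule calc_tendsto[where K = 1])
      fix r :: real
      show "(\<lambda>n. indicator {1 / real (Suc n)..1} r) \<longlonglongrightarrow> (indicator {0<..1} r :: real)"
      proof (rule tendsto_eventually, cases "0 < r")
        case True
        then obtain N where N: "1 / r < real N" using reals_Archimedean2 by blast
        have "1 / real (Suc n) \<le> r" if "n \<ge> N" for n
        proof -
          have "1 / r < real (Suc n)" using N that by linarith
          then show ?thesis using True by (simp add: field_simps)
        qed
        then show "\<forall>\<^sub>F n in sequentially. indicator {1 / real (Suc n)..1} r = (indicator {0<..1} r :: real)"
          using True by (auto simp: eventually_sequentially indicator_def intro!: exI[of _ N])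
      next
        case False
        have "\<not> 1 / real (Suc n) \<le> r" for n
          using False by (metis less_le_trans zero_less_divide_1_iff of_nat_0_less_iff zero_less_Suc)
        then show "\<forall>\<^sub>F n in sequentially. indicator {1 / real (Suc n)..1} r = (indicator {0<..1} r :: real)"
          using False by (simp add: indicator_def)
      qed
    qed (auto simp: indicator_def)
    moreover have "calc (indicator {0<..1}) = cid" by (simp add: calc_indicator Fpos)
    ultimately have "(\<lambda>n. A \<rhd> y n) \<longlonglongrightarrow> x" by simp
    moreover have "(\<lambda>n. A \<rhd> y n) \<longlonglongrightarrow> A \<rhd> z" by (intro tendsto_intros z)
    ultimately have "x = A \<rhd> z" by (rule LIMSEQ_unique)
    then show ?thesis using A(1)[of z] by blast
  qed
  have form: "cinner x y = of_real (\<integral>r. h r \<partial>\<mu> x)" if xy: "(x, y) \<in> H" for x y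
  proof -
    define v where "v = x + y"
    have xA: "x = A \<rhd> v" and yA: "y = v - A \<rhd> v" using A(2)[OF xy] by (simp_all add: v_def)
    have "cinner x y = cinner v (calc (\<lambda>r. g r - g r * g r) \<rhd> v)"
      by (subst xA, subst yA)
        (simp add: g calc_diff calc_mult bounded_borel_intros calc_g A_sym cblinfun_simps times_cblinfun_apply)
    also have "\<dots> = of_real (\<integral>r. g r - g r * g r \<partial>\<mu> v)"
      using g by (intro cinner_calc bounded_borel_intros)
    also have "(\<integral>r. g r - g r * g r \<partial>\<mu> v) = (\<integral>r. (g r)\<^sup>2 *\<^sub>R h r \<partial>\<mu> v)"
    proof (rule integral_cong_AE)
      show "AE r in \<mu> v. g r - g r * g r = (g r)\<^sup>2 *\<^sub>R h r"
        using AEpos[of v]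
        by eventually_elim (simp add: g_def h_def power2_eq_square field_simps)
    qed auto
    also have "\<dots> = (\<integral>r. h r \<partial>\<mu> x)"
      by (subst xA, unfold \<mu>A, subst integral_density) auto
    finally show ?thesis .
  qed
  define E where "E S = F (h -` S)" for S
  have E: "projection_valued_measure E" and dE: "diagonal_measure E x = distr (\<mu> x) borel h" for x
    unfolding E_def[abs_def] using distr_pvm[OF F h] by blast+
  have "has_spectral_integral E (\<lambda>l. l) H"
    unfolding has_spectral_integral_def
  proof (intro conjI lin)
    show "Domain H = {x. (\<integral>\<^sup>+ l. ennreal (l\<^sup>2) \<partial>diagonal_measure E x) < \<infinity>}"
      using dom1 dom2 by (auto simp: dE nn_integral_distr)
    show "\<forall>(x, y)\<in>H. cinner x y = complex_of_real (\<integral>l. l \<partial>diagonal_measure E x)"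
      using form by (auto simp: dE integral_distr)
  qed
  with E show ?thesis by blast
qed


section \<open>Functional calculus of a nonnegative self-adjoint operator\<close>

lemma (in pvm) AE_\<mu>_range:
  assumes S: "S \<in> sets borel"
  shows "AE l in \<mu> (E S \<rhd> x). l \<in> S"
proof -
  have "E (- S) \<rhd> E S \<rhd> x = 0"
    using S E_disjoint[of "- S" S] by (simp add: times_cblinfun_apply[symmetric])
  then have "emeasure (\<mu> (E S \<rhd> x)) (- S) = 0" using S by (subst emeasure_\<mu>) auto
  then show ?thesis using S by (intro AE_I[of _ _ "- S"]) auto
qed

text \<open>Apply ln z \<le> z - 1 to z = t u / b. The choice b = |a| + 1 makes |a| / b \<le> 1, so
  exactly exp (t u) suffices, and it keeps the logarithm meaningful when a = 0.\<close>

lemma powr_le_exp: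
  fixes a t u :: real
  assumes "t > 0" "u \<ge> 1"
  shows "u powr a \<le> exp (\<bar>a\<bar> * ln ((\<bar>a\<bar> + 1) / t)) * exp (t * u)"
proof -
  define b where "b = \<bar>a\<bar> + 1"
  have b: "b > 0" by (simp add: b_def)
  have "ln u = ln (t * u / b) + ln (b / t)"
    using assms b by (simp add: ln_mult ln_div)
  also have "\<dots> \<le> t * u / b + ln (b / t)"
    using ln_le_minus_one[of "t * u / b"] assms b by simp
  finally have "ln u \<le> t * u / b + ln (b / t)" .
  from mult_left_mono[OF this, of "\<bar>a\<bar>"]
  have "\<bar>a\<bar> * ln u \<le> \<bar>a\<bar> * (t * u / b) + \<bar>a\<bar> * ln (b / t)"
    by (simp only: distrib_left abs_ge_zero)
  also have "\<bar>a\<bar> * (t * u / b) \<le> t * u"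
    using assms b by (simp add: b_def field_simps)
  finally have 1: "\<bar>a\<bar> * ln u \<le> t * u + \<bar>a\<bar> * ln (b / t)" by simp
  have "a * ln u \<le> \<bar>a\<bar> * ln u" using assms by (intro mult_right_mono) auto
  then show ?thesis using 1 assms by (simp add: powr_def b_def exp_add[symmetric])
qed

text \<open>Only exp y \<ge> 1 + y is used: at -y it yields exp y - 1 - y \<le> y (exp y -
  1).\<close>

lemma exp_second_order: "\<bar>exp y - 1 - y\<bar> \<le> y\<^sup>2 * exp \<bar>y :: real\<bar>"
proof -
  have "exp y * exp (- y) = 1" by (simp add: exp_minus)
  moreover have "exp y * (1 - y) \<le> exp y * exp (- y)"
    using exp_ge_add_one_self[of "- y"] by (intro mult_left_mono) auto
  ultimately have 1: "exp y - 1 - y \<le> y * (exp y - 1)" by (simp add: algebra_simps)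
  have 2: "0 \<le> exp y - 1 - y" using exp_ge_add_one_self[of y] by linarith
  have "y * (exp y - 1) \<le> y\<^sup>2 * exp \<bar>y\<bar>"
  proof (cases "y \<ge> 0")
    case True
    have "exp y - 1 \<le> y * exp y" using 1 2 by (simp add: algebra_simps)
    then have "y * (exp y - 1) \<le> y * (y * exp y)" using True by (intro mult_left_mono) auto
    then show ?thesis using True by (simp add: power2_eq_square mult.assoc)
  next
    case False
    have "y \<le> exp y - 1" using exp_ge_add_one_self[of y] by linarith
    then have "y * (exp y - 1) \<le> y * y"
      by (rule mult_left_mono_neg) (use False in simp)
    also have "\<dots> \<le> y * y * exp \<bar>y\<bar>"
      using mult_left_mono[of 1 "exp \<bar>y\<bar>" "y * y"] by simp
    finally show ?thesis by (simp add: power2_eq_square)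
  qed
  then show ?thesis using 1 2 by simp
qed

text \<open>A way to differentiate operator-valued functions: the remainder bound is obtained from a
  scalar one that is uniform in the spectral parameter or integrable in a parameter.\<close>

lemma has_vector_derivative_quadratic:
  fixes f :: "real \<Rightarrow> 'b::real_normed_vector"
  assumes "\<delta> > 0" and C: "\<And>h. \<bar>h\<bar> < \<delta> \<Longrightarrow> norm (f (t + h) - f t - h *\<^sub>R D) \<le> C * h\<^sup>2"
  shows "(f has_vector_derivative D) (at t)"
  unfolding has_vector_derivative_def has_derivative_at
proof (intro conjI)
  show "bounded_linear (\<lambda>h. h *\<^sub>R D)" by (rule bounded_linear_scaleR_left)
  show "(\<lambda>h. norm (f (t + h) - f t - h *\<^sub>R D) / norm h) \<midarrow>0\<rightarrow> 0"
  proof (rule Lim_null_comparison)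
    have "\<forall>\<^sub>F h in at 0. \<bar>h\<bar> < \<delta> \<and> h \<noteq> 0"
      using \<open>\<delta> > 0\<close> by (auto simp: eventually_at dist_norm)
    then show "\<forall>\<^sub>F h in at 0. norm (norm (f (t + h) - f t - h *\<^sub>R D) / norm h) \<le> \<bar>C\<bar> * \<bar>h\<bar>"
    proof eventually_elim
      case (elim h)
      have "norm (f (t + h) - f t - h *\<^sub>R D) \<le> C * h\<^sup>2" using elim by (intro C) simp
      also have "\<dots> \<le> \<bar>C\<bar> * \<bar>h\<bar> * \<bar>h\<bar>"
        by (simp add: power2_eq_square mult.assoc mult_right_mono)
      finally show ?case using elim by (simp add: field_simps)
    qed
    show "((\<lambda>h. \<bar>C\<bar> * \<bar>h\<bar>) \<longlongrightarrow> 0) (at 0)" by (auto intro!: tendsto_eq_intros)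
  qed
qed

locale nonneg_self_adjoint =
  fixes H :: "'a::chilbert_space opgraph"
  assumes self_adj: "self_adjoint H" and nonneg: "nonneg_operator H"
begin

lemmas H_linear = self_adjoint_linear[OF self_adj]

text \<open>The chosen measure need not be the one constructed in \<open>spectral_theorem\<close>;
  these two properties are all that is known about it, and everything below is derived from
  them.\<close>

lemma spectral_measure:
  "projection_valued_measure (spectral_measure H)"
  "has_spectral_integral (spectral_measure H) (\<lambda>l. l) H"
  using someI_ex[OF spectral_theorem[OF self_adj nonneg]] unfolding spectral_measure_def by auto

sublocale pvm "spectral_measure H"
  by standard (rule spectral_measure)

abbreviation E :: "real set \<Rightarrow> 'a cblinfun" where "E \<equiv> spectral_measure H"

text \<open>For a vector in the range of \<open>E S\<close> the scalar measure is carried by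
  \<open>S\<close>; if \<open>S\<close> is bounded, square-integrability of l is automatic.\<close>

lemma range_E_domain:
  assumes S: "S \<in> sets borel" and K: "\<And>l. l \<in> S \<Longrightarrow> \<bar>l\<bar> \<le> K"
  obtains w where "(E S \<rhd> x, w) \<in> H"
    "cinner (E S \<rhd> x) w = of_real (\<integral>l. l * indicator S l \<partial>\<mu> (E S \<rhd> x))"
proof -
  let ?y = "E S \<rhd> x"
  have AE: "AE l in \<mu> ?y. l \<in> S" by (rule AE_\<mu>_range[OF S])
  have "(\<integral>\<^sup>+ l. ennreal (l\<^sup>2) \<partial>\<mu> ?y) \<le> (\<integral>\<^sup>+ l. ennreal (K\<^sup>2) \<partial>\<mu> ?y)"
  proof (rule nn_integral_mono_AE)
    show "AE l in \<mu> ?y. ennreal (l\<^sup>2) \<le> ennreal (K\<^sup>2)"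
      using AE
    proof eventually_elim
      case (elim l)
      then have "\<bar>l\<bar>\<^sup>2 \<le> K\<^sup>2" using K by (intro power_mono) auto
      then show ?case by (simp add: ennreal_leI)
    qed
  qed
  also have "\<dots> < \<infinity>" by (simp add: emeasure_\<mu>[of UNIV, simplified] ennreal_mult_less_top)
  finally have "?y \<in> Domain H"
    using spectral_measure(2) unfolding has_spectral_integral_def by blast
  then obtain w where w: "(?y, w) \<in> H" by auto
  then have "cinner ?y w = of_real (\<integral>l. l \<partial>\<mu> ?y)"
    using spectral_measure(2) unfolding has_spectral_integral_def by blast
  also have "(\<integral>l. l \<partial>\<mu> ?y) = (\<integral>l. l * indicator S l \<partial>\<mu> ?y)"
    using S AE by (intro integral_cong_AE) (auto elim!: AE_mp)
  finally show ?thesis using w that by blast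
qed

text \<open>A vector y in the spectral subspace of [-(n + 1), -1/(n + 1)] lies in Dom H, as the
  interval is bounded, and has form at most -|y|^2 / (n + 1), as it stays away from 0. Positivity of
  \<open>H\<close> makes it 0, and these intervals exhaust the negative half-line.\<close>

lemma E_nonneg: "E {0..} = cid"
proof -
  have neg: "E {- real (Suc n)..- 1 / real (Suc n)} = 0" for n
  proof (rule cblinfun_eqI)
    fix x
    let ?S = "{- real (Suc n)..- 1 / real (Suc n)}" and ?y = "E {- real (Suc n)..- 1 / real (Suc n)} \<rhd> x"
    have S0: "l \<le> 0" if "l \<in> ?S" for l
      using that by (auto intro: order_trans[of l "- 1 / real (Suc n)"])
    have SK: "\<bar>l\<bar> \<le> real (Suc n)" if "l \<in> ?S" for l
      using that S0[OF that] unfolding atLeastAtMost_iff by linarith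
    obtain w where w: "(?y, w) \<in> H" "cinner ?y w = of_real (\<integral>l. l * indicator ?S l \<partial>\<mu> ?y)"
      by (rule range_E_domain[of ?S "real (Suc n)" x]) (use SK in auto)
    have "(\<integral>l. l * indicator ?S l \<partial>\<mu> ?y) \<le> (\<integral>l. (- 1 / real (Suc n)) * indicator ?S l \<partial>\<mu> ?y)"
    proof (rule integral_mono)
      show "integrable (\<mu> ?y) (\<lambda>l. l * indicator ?S l)"
      proof (intro integrable_\<mu> bounded_borelI[of _ "real (Suc n)"])
        show "\<bar>l * indicator ?S l\<bar> \<le> real (Suc n)" for l
          using SK[of l] by (cases "l \<in> ?S") auto
      qed measurable
      show "integrable (\<mu> ?y) (\<lambda>l. (- 1 / real (Suc n)) * indicator ?S l)"
        by (intro integrable_\<mu> bounded_borel_intros) auto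
    qed (auto simp: indicator_def)
    also have "\<dots> = (- 1 / real (Suc n)) * measure (\<mu> ?y) ?S"
      by (subst integral_mult_right_zero) simp
    also have "measure (\<mu> ?y) ?S = (norm ?y)\<^sup>2"
      using E_idem[of ?S] by (subst measure_\<mu>) (auto simp: times_cblinfun_apply[symmetric])
    finally have "Re (cinner ?y w) \<le> (- 1 / real (Suc n)) * (norm ?y)\<^sup>2" using w(2) by simp
    then have "(1 / real (Suc n)) * (norm ?y)\<^sup>2 \<le> 0"
      using nonneg_operatorD[OF nonneg w(1)] by simp
    then have "(norm ?y)\<^sup>2 \<le> 0" by (simp add: divide_le_0_iff)
    then show "?y = 0 \<rhd> x" by simp
  qed
  have "E {..<0} \<rhd> x = 0" for x
  proof -
    have "(\<lambda>n. calc (indicator {- real (Suc n)..- 1 / real (Suc n)}) \<rhd> x) \<longlonglongrightarrow> calc (indicator {..<0}) \<rhd> x"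
    proof (rule calc_tendsto[where K = 1])
      fix l :: real
      show "(\<lambda>n. indicator {- real (Suc n)..- 1 / real (Suc n)} l) \<longlonglongrightarrow> (indicator {..<0} l :: real)"
      proof (rule tendsto_eventually, cases "l < 0")
        case True
        obtain N where N: "max (- l) (1 / - l) < real N" using reals_Archimedean2 by blast
        have "- real (Suc n) \<le> l \<and> l \<le> - 1 / real (Suc n)" if "n \<ge> N" for n
        proof -
          have "- l < real (Suc n)" "1 / - l < real (Suc n)" using N that by auto
          then show ?thesis using True by (simp add: field_simps)
        qed
        then show "\<forall>\<^sub>F n in sequentially. indicator {- real (Suc n)..- 1 / real (Suc n)} l = (indicator {..<0} l :: real)"
          using True by (auto simp: eventually_sequentially indicator_def intro!: exI[of _ N])
      next
        case False
        have "\<not> l \<le> - 1 / real (Suc n)" for n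
        proof -
          have "- 1 / real (Suc n) < 0" by simp
          then show ?thesis using False by linarith
        qed
        then show "\<forall>\<^sub>F n in sequentially. indicator {- real (Suc n)..- 1 / real (Suc n)} l = (indicator {..<0} l :: real)"
          using False by (simp add: indicator_def)
      qed
    qed (auto simp: indicator_def)
    moreover have "calc (indicator {- real (Suc n)..- 1 / real (Suc n)}) = 0" for n
      unfolding neg[of n, symmetric] by (rule calc_indicator) simp
    ultimately show ?thesis by (simp add: calc_indicator LIMSEQ_const_iff)
  qed
  then have "E {..<0} = 0" by (intro cblinfun_eqI) simp
  moreover have "E ({..<0} \<union> {0..}) = E {..<0} + E {0..}" by (intro E_Un) auto
  moreover have "{..<0} \<union> {0..} = (UNIV :: real set)" by auto
  ultimately show ?thesis by simp
qed

text \<open>Two things are at stake: \<open>f\<close> may be unbounded on the negative half-line,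
  which is null by \<open>E_nonneg\<close>, and the description operator needs uniqueness, which
  polarization gives since the domain is the whole space.\<close>

lemma spectral_calculus_graph:
  assumes meas [measurable]: "f \<in> borel_measurable borel" and K: "\<And>l. l \<ge> 0 \<Longrightarrow> \<bar>f l\<bar> \<le> K"
  shows "spectral_calculus H f = graph_of (calc (\<lambda>l. f l * indicator {0..} l))"
proof -
  define f' where "f' l = f l * indicator {0..} l" for l
  have f': "bounded_borel f'"
    unfolding f'_def by (rule bounded_borelI[of _ "\<bar>K\<bar>"])
      (auto simp: indicator_def intro: order_trans[OF K abs_ge_self])
  note [measurable] = bounded_borelD(1)[OF f']
  have AE: "AE l in \<mu> x. f l = f' l" for x
    using AE_\<mu>[OF _ E_nonneg, of x] by (auto simp: f'_def elim!: AE_mp)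
  have int: "(\<integral>l. f l \<partial>\<mu> x) = (\<integral>l. f' l \<partial>\<mu> x)" for x
    by (rule integral_cong_AE) (use AE in auto)
  have fin: "(\<integral>\<^sup>+ l. ennreal ((f l)\<^sup>2) \<partial>\<mu> x) < \<infinity>" for x
  proof -
    have "(\<integral>\<^sup>+ l. ennreal ((f l)\<^sup>2) \<partial>\<mu> x) = (\<integral>\<^sup>+ l. ennreal ((f' l)\<^sup>2) \<partial>\<mu> x)"
      by (rule nn_integral_cong_AE) (use AE[of x] in \<open>eventually_elim, simp\<close>)
    also have "\<dots> < \<infinity>"
    proof -
      have "bounded_borel (\<lambda>l. f' l * f' l)" using f' by auto
      then have "integrable (\<mu> x) (\<lambda>l. (f' l)\<^sup>2)" by (simp add: power2_eq_square)
      then show ?thesis by (simp add: nn_integral_eq_integral)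
    qed
    finally show ?thesis .
  qed
  have "has_spectral_integral E f (graph_of (calc f'))"
    unfolding has_spectral_integral_def
    using fin by (auto simp: linear_operator_graph_of Domain_iff graph_of_iff cinner_calc f' int)
  moreover have "T = graph_of (calc f')" if T: "has_spectral_integral E f T" for T
  proof -
    have lin: "linear_operator T" and dom: "Domain T = UNIV"
      and form: "\<And>x y. (x, y) \<in> T \<Longrightarrow> cinner x y = of_real (\<integral>l. f l \<partial>\<mu> x)"
      using T fin unfolding has_spectral_integral_def by auto
    have "\<forall>x. \<exists>y. (x, y) \<in> T" using dom by auto
    then obtain t where t: "\<And>x. (x, t x) \<in> T" by metis
    have tI: "(x, y) \<in> T \<Longrightarrow> y = t x" for x y
      using single_valued_linear_operator[OF lin] t by blast
    have t_add: "t (x + y) = t x + t y" for x y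
      by (rule tI[symmetric]) (rule linear_operator_add[OF lin t t])
    have t_scale: "t (c *\<^sub>C x) = c *\<^sub>C t x" for c x
      by (rule tI[symmetric]) (rule linear_operator_scaleC[OF lin t])
    have "t y = calc f' \<rhd> y" for y
    proof (rule cinner_eqI)
      show "cinner x (t y) = cinner x (calc f' \<rhd> y)" for x
      proof (rule sesqui_eqI[OF _ sesqui_cinner_apply(1)])
        show "sesqui (\<lambda>x y. cinner x (t y))" by (auto simp: sesqui_def t_add t_scale cinner_simps)
        show "cinner x (t x) = cinner x (calc f' \<rhd> x)" for x
          using form[OF t] f' by (simp add: cinner_calc int)
      qed
    qed
    then show ?thesis using t tI by (auto simp: graph_of_def)
  qed
  ultimately show ?thesis
    unfolding spectral_calculus_def f'_def by (rule the_equality)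
qed

text \<open>\<open>has_spectral_integral\<close> yields only the quadratic form of \<open>H\<close>,
  whereas here the vector H E[-n, n] y itself is identified. Polarization first determines its inner
  products with vectors from spectral subspaces.\<close>

lemma cutoff_mem_graph:
  "(E {- real n..real n} \<rhd> y, calc (\<lambda>l. l * indicator {- real n..real n} l) \<rhd> y) \<in> H"
proof -
  define e where "e n = E {- real n..real n}" for n
  define c where "c n l = l * indicator {- real n..real n} l" for n l
  have c: "bounded_borel (c n)" for n
    unfolding c_def by (rule bounded_borelI[of _ "real n"]) (auto simp: indicator_def)
  have "\<exists>w. (e n \<rhd> x, w) \<in> H \<and> cinner (e n \<rhd> x) w = cinner x (calc (c n) \<rhd> x)" for n x
  proof -
    obtain w where w: "(e n \<rhd> x, w) \<in> H" "cinner (e n \<rhd> x) w = of_real (\<integral>l. c n l \<partial>\<mu> (e n \<rhd> x))"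
      unfolding e_def c_def by (rule range_E_domain[of "{- real n..real n}" "real n" x]) auto
    have "of_real (\<integral>l. c n l \<partial>\<mu> (e n \<rhd> x)) = cinner (e n \<rhd> x) (calc (c n) \<rhd> e n \<rhd> x)"
      using c by (simp add: cinner_calc)
    also have "\<dots> = cinner x ((E {- real n..real n} * calc (c n) * E {- real n..real n}) \<rhd> x)"
      by (simp add: e_def E_sym times_cblinfun_apply)
    also have "E {- real n..real n} * calc (c n) * E {- real n..real n} = calc (\<lambda>l. indicator {- real n..real n} l * c n l * indicator {- real n..real n} l)"
      using c by (simp add: calc_mult calc_indicator bounded_borel_intros)
    also have "(\<lambda>l. indicator {- real n..real n} l * c n l * indicator {- real n..real n} l) = c n"
      by (auto simp: c_def indicator_def)
    finally show ?thesis using w by auto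
  qed
  then obtain t where t: "\<And>n x. (e n \<rhd> x, t n x) \<in> H"
    "\<And>n x. cinner (e n \<rhd> x) (t n x) = cinner x (calc (c n) \<rhd> x)" by metis
  have tI: "(e n \<rhd> x, y) \<in> H \<Longrightarrow> y = t n x" for n x y
    using single_valued_linear_operator[OF H_linear] t by blast
  have t_add: "t n (x + y) = t n x + t n y" for n x y
    using linear_operator_add[OF H_linear t(1) t(1)] by (intro tI[symmetric]) (simp add: cblinfun_simps)
  have t_scale: "t n (c *\<^sub>C x) = c *\<^sub>C t n x" for n c x
    using linear_operator_scaleC[OF H_linear t(1)] by (intro tI[symmetric]) (simp add: cblinfun_simps)
  have form: "cinner (e n \<rhd> x) (t n y) = cinner x (calc (c n) \<rhd> y)" for n x y
  proof (rule sesqui_eqI[OF _ sesqui_cinner_apply(1)])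
    show "sesqui (\<lambda>x y. cinner (e n \<rhd> x) (t n y))"
      by (auto simp: sesqui_def t_add t_scale cinner_simps cblinfun_simps)
  qed (rule t)
  have "t n y = calc (c n) \<rhd> y"
  proof (rule cinner_eqI)
    fix x
    \<comment> \<open>Testing against the larger subspaces \<open>e m\<close> gives the same value
      for all m \<ge> n, because \<open>e m\<close> fixes the range of \<open>e n\<close>; letting m
      grow reaches every test vector \<open>x\<close>.\<close>
    have ev: "cinner (e m \<rhd> x) (t n y) = cinner x (calc (c n) \<rhd> y)" if "m \<ge> n" for m
    proof -
      have "{- real m..real m} \<inter> {- real n..real n} = {- real n..real n}" using that by auto
      then have ee: "e m \<rhd> e n \<rhd> y = e n \<rhd> y"
        using E_Int[of "{- real m..real m}" "{- real n..real n}"]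
        by (simp add: e_def times_cblinfun_apply[symmetric])
      have "t m (e n \<rhd> y) = t n y" using t(1)[of m "e n \<rhd> y"] ee by (intro tI) simp
      then have "cinner (e m \<rhd> x) (t n y) = cinner x (calc (c m) \<rhd> e n \<rhd> y)"
        using form[of m x "e n \<rhd> y"] by simp
      also have "calc (c m) \<rhd> e n \<rhd> y = calc (\<lambda>l. c m l * indicator {- real n..real n} l) \<rhd> y"
        using c by (simp add: calc_mult calc_indicator e_def times_cblinfun_apply bounded_borel_intros)
      also have "(\<lambda>l. c m l * indicator {- real n..real n} l) = c n"
        using that by (auto simp: c_def indicator_def)
      finally show ?thesis .
    qed
    have "(\<lambda>m. calc (indicator {- real m..real m}) \<rhd> x) \<longlonglongrightarrow> calc (\<lambda>_. 1) \<rhd> x"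
    proof (rule calc_tendsto[where K = 1])
      fix l :: real
      obtain N where "\<bar>l\<bar> < real N" using reals_Archimedean2 by blast
      then show "(\<lambda>n. indicator {- real n..real n} l) \<longlonglongrightarrow> (1 :: real)"
        by (auto intro!: tendsto_eventually exI[of _ N] simp: eventually_sequentially indicator_def)
    qed (auto simp: indicator_def)
    then have "(\<lambda>m. e m \<rhd> x) \<longlonglongrightarrow> x" by (simp add: calc_indicator calc_one e_def)
    then have "(\<lambda>m. cinner (e m \<rhd> x) (t n y)) \<longlonglongrightarrow> cinner x (t n y)" by (intro tendsto_intros)
    moreover have "(\<lambda>m. cinner (e m \<rhd> x) (t n y)) \<longlonglongrightarrow> cinner x (calc (c n) \<rhd> y)"
      using ev by (auto intro!: tendsto_eventually exI[of _ n] simp: eventually_sequentially)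
    ultimately show "cinner x (t n y) = cinner x (calc (c n) \<rhd> y)" by (rule LIMSEQ_unique)
  qed
  then show ?thesis using t(1)[of n y] by (simp add: e_def c_def[abs_def])
qed

text \<open>The statement holds for the cutoffs of \<open>g\<close> to [-n, n] by
  \<open>cutoff_mem_graph\<close>; both components converge, and \<open>H\<close> is closed.\<close>

lemma calc_mem_graph:
  assumes g: "bounded_borel g" and lg: "bounded_borel (\<lambda>l. l * g l)"
  shows "(calc g \<rhd> x, calc (\<lambda>l. l * g l) \<rhd> x) \<in> H"
proof (rule self_adjoint_closed[OF self_adj])
  have c: "bounded_borel (\<lambda>l. l * indicator {- real n..real n} l)" for n
    by (rule bounded_borelI[of _ "real n"]) (auto simp: indicator_def)
  obtain K L where KL: "\<And>l. \<bar>g l\<bar> \<le> K" "\<And>l. \<bar>l * g l\<bar> \<le> L"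
    using bounded_borelD(2)[OF g] bounded_borelD(2)[OF lg] by blast
  have ind: "(\<lambda>n. indicator {- real n..real n} l) \<longlonglongrightarrow> (1 :: real)" for l
  proof -
    obtain N where "\<bar>l\<bar> < real N" using reals_Archimedean2 by blast
    then show ?thesis
      by (auto intro!: tendsto_eventually exI[of _ N] simp: eventually_sequentially indicator_def)
  qed
  show "(\<lambda>n. calc (\<lambda>l. indicator {- real n..real n} l * g l) \<rhd> x) \<longlonglongrightarrow> calc g \<rhd> x"
  proof (rule calc_tendsto[where K = "\<bar>K\<bar>"])
    show "(\<lambda>n. indicator {- real n..real n} l * g l) \<longlonglongrightarrow> g l" for l
      using tendsto_mult[OF ind tendsto_const, of l "g l"] by simp
    show "\<bar>indicator {- real n..real n} l * g l\<bar> \<le> \<bar>K\<bar>" for n l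
      using KL(1)[of l] by (auto simp: indicator_def)
  qed (use g in \<open>auto intro!: bounded_borel_intros\<close>)
  show "(\<lambda>n. calc (\<lambda>l. indicator {- real n..real n} l * (l * g l)) \<rhd> x) \<longlonglongrightarrow> calc (\<lambda>l. l * g l) \<rhd> x"
  proof (rule calc_tendsto[where K = "\<bar>L\<bar>"])
    show "(\<lambda>n. indicator {- real n..real n} l * (l * g l)) \<longlonglongrightarrow> l * g l" for l
      using tendsto_mult[OF ind tendsto_const, of l "l * g l"] by simp
    show "\<bar>indicator {- real n..real n} l * (l * g l)\<bar> \<le> \<bar>L\<bar>" for n l
      using KL(2)[of l] by (auto simp: indicator_def)
  qed (use lg in \<open>auto intro!: bounded_borel_intros\<close>)
  fix n
  have "calc (\<lambda>l. indicator {- real n..real n} l * (l * g l)) = calc (\<lambda>l. l * indicator {- real n..real n} l) * calc g"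
    using g c[of n] by (simp add: calc_mult[symmetric] mult_ac)
  moreover have "calc (\<lambda>l. indicator {- real n..real n} l * g l) = E {- real n..real n} * calc g"
    using g by (simp add: calc_mult calc_indicator bounded_borel_intros)
  ultimately show "(calc (\<lambda>l. indicator {- real n..real n} l * g l) \<rhd> x,
      calc (\<lambda>l. indicator {- real n..real n} l * (l * g l)) \<rhd> x) \<in> H"
    using cutoff_mem_graph[of n "calc g \<rhd> x"] by (simp add: times_cblinfun_apply)
qed


section \<open>The operators \<open>(H + 1)\<^sup>a e\<^sup>-\<^sup>t\<^sup>H\<close>\<close>

definition q :: "real \<Rightarrow> real \<Rightarrow> real \<Rightarrow> real" where
  "q a t l = (l + 1) powr a * exp (- t * l) * indicator {0..} l"

definition Q :: "real \<Rightarrow> real \<Rightarrow> 'a cblinfun" where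
  "Q a t = calc (q a t)"

text \<open>The parameters for which (l + 1)^a exp (- t l) stays bounded on the half-line: without
  time decay only nonpositive powers are allowed.\<close>

definition admissible :: "real \<Rightarrow> real \<Rightarrow> bool" where
  "admissible a t \<longleftrightarrow> 0 < t \<or> t = 0 \<and> a \<le> 0"

lemma q_nonneg: "0 \<le> q a t l" by (simp add: q_def)

lemma bounded_borel_q [intro]:
  assumes "admissible a t"
  shows "bounded_borel (q a t)"
proof -
  have "\<exists>K\<ge>0. \<forall>l\<ge>0. (l + 1) powr a * exp (- t * l) \<le> K"
  proof (cases "t > 0")
    case True
    define C where "C = exp (\<bar>a\<bar> * ln ((\<bar>a\<bar> + 1) / t))"
    have "(l + 1) powr a * exp (- t * l) \<le> C * exp t" if "l \<ge> 0" for l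
    proof -
      have "(l + 1) powr a * exp (- t * l) \<le> (C * exp (t * (l + 1))) * exp (- t * l)"
        using powr_le_exp[OF True, of "l + 1" a] that
        by (intro mult_right_mono) (auto simp: C_def)
      also have "\<dots> = C * exp t" by (simp add: mult.assoc exp_add[symmetric] algebra_simps)
      finally show ?thesis .
    qed
    then show ?thesis by (intro exI[of _ "C * exp t"]) (auto simp: C_def)
  next
    case False
    then have "t = 0" "a \<le> 0" using assms by (auto simp: admissible_def)
    then have "(l + 1) powr a * exp (- t * l) \<le> 1" if "l \<ge> 0" for l
      using that powr_mono[of a 0 "l + 1"] by simp
    then show ?thesis by (intro exI[of _ 1]) auto
  qed
  then obtain K where "K \<ge> 0" "\<And>l. l \<ge> 0 \<Longrightarrow> (l + 1) powr a * exp (- t * l) \<le> K" by blast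
  then have "\<bar>q a t l\<bar> \<le> K" for l
    unfolding abs_of_nonneg[OF q_nonneg] by (auto simp: q_def indicator_def)
  then show ?thesis by (intro bounded_borelI[of _ K]) (auto simp: q_def[abs_def])
qed

lemma Q_mult:
  assumes "admissible a t" "admissible b s"
  shows "Q a t * Q b s = Q (a + b) (t + s)"
proof -
  have "q (a + b) (t + s) = (\<lambda>l. q a t l * q b s l)"
    by (auto simp: q_def fun_eq_iff indicator_def powr_add exp_add[symmetric] algebra_simps)
  then show ?thesis using assms by (simp add: Q_def calc_mult bounded_borel_q)
qed

lemma heat_semigroup_eq: "t \<ge> 0 \<Longrightarrow> heat_semigroup H t = graph_of (Q 0 t)"
proof -
  assume "t \<ge> 0"
  then have "heat_semigroup H t = graph_of (calc (\<lambda>l. exp (- t * l) * indicator {0..} l))"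
    unfolding heat_semigroup_def by (intro spectral_calculus_graph[of _ 1]) auto
  moreover have "q 0 t = (\<lambda>l. exp (- t * l) * indicator {0..} l)"
    by (auto simp: q_def indicator_def)
  ultimately show ?thesis by (simp add: Q_def)
qed

lemma shifted_power_eq: "a \<ge> 0 \<Longrightarrow> shifted_power H (- a) = graph_of (Q (- a) 0)"
proof -
  assume a: "a \<ge> 0"
  have "shifted_power H (- a) = graph_of (calc (\<lambda>l. (l + 1) powr (- a) * indicator {0..} l))"
    unfolding shifted_power_def
  proof (rule spectral_calculus_graph[of _ 1])
    show "\<bar>(l + 1) powr - a\<bar> \<le> 1" if "l \<ge> 0" for l
      using a that powr_mono[of "- a" 0 "l + 1"] by simp
  qed measurable
  moreover have "q (- a) 0 = (\<lambda>l. (l + 1) powr (- a) * indicator {0..} l)"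
    by (auto simp: q_def)
  ultimately show ?thesis by (simp add: Q_def)
qed

lemma Q_0_0: "Q 0 0 = cid"
proof -
  have "q 0 0 = indicator {0..}" by (auto simp: q_def indicator_def)
  then show ?thesis by (simp add: Q_def calc_indicator E_nonneg)
qed

text \<open>From l / (l + 1) = 1 - 1 / (l + 1). For positive times membership in Dom H is obtained
  later by exhibiting a vector as a value of this resolvent.\<close>

lemma resolvent_mem_graph: "(Q (- 1) 0 \<rhd> x, x - Q (- 1) 0 \<rhd> x) \<in> H"
proof -
  have ad: "admissible (- 1) 0" "admissible 0 0" by (auto simp: admissible_def)
  have eq: "(\<lambda>l. l * q (- 1) 0 l) = (\<lambda>l. q 0 0 l - q (- 1) 0 l)"
    by (auto simp: q_def fun_eq_iff indicator_def powr_minus field_simps)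
  have "(calc (q (- 1) 0) \<rhd> x, calc (\<lambda>l. l * q (- 1) 0 l) \<rhd> x) \<in> H"
    unfolding eq by (rule calc_mem_graph[of "q (- 1) 0", unfolded eq]) (use ad in auto)
  then show ?thesis
    unfolding eq using ad by (simp add: calc_diff bounded_borel_q Q_def[symmetric] Q_0_0 cblinfun_simps)
qed

text \<open>With u = t (l + 1) the symbol is t^-a u^a exp (- u) exp t, and u^a exp (- u) is bounded
  for u > 0. This is the source of the singularity r^-a of the kernels.\<close>

lemma norm_Q_le:
  assumes a: "0 \<le> a"
  shows "\<exists>C\<ge>0. \<forall>t>0. norm (Q a t) \<le> C * exp t * t powr (- a)"
proof -
  define C where "C = max 1 (exp (\<bar>a\<bar> * ln ((\<bar>a\<bar> + 1) / 1)))"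
  have C: "1 \<le> C" by (simp add: C_def)
  have u_le: "u powr a \<le> C * exp u" if u: "u > 0" for u
  proof (cases "u \<ge> 1")
    case True
    then have "u powr a \<le> exp (\<bar>a\<bar> * ln ((\<bar>a\<bar> + 1) / 1)) * exp (1 * u)"
      by (intro powr_le_exp) auto
    also have "\<dots> \<le> C * exp u" unfolding C_def by (intro mult_mono) auto
    finally show ?thesis .
  next
    case False
    then have "u powr a \<le> 1" using a u by (intro powr_le1) auto
    also have "1 \<le> C * exp u"
      using C u one_le_exp_iff[of u] mult_mono[of 1 C 1 "exp u"] by simp
    finally show ?thesis .
  qed
  have "norm (Q a t) \<le> 2 * (C * exp t * t powr (- a))" if t: "0 < t" for t
    unfolding Q_def
  proof (rule norm_calc_le)
    show "bounded_borel (q a t)" using t by (intro bounded_borel_q) (simp add: admissible_def)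
    show "\<bar>q a t l\<bar> \<le> C * exp t * t powr (- a)" for l
    proof (cases "l \<ge> 0")
      case True
      define u where "u = t * (l + 1)"
      have u: "u > 0" using True t by (simp add: u_def)
      have "u powr a = t powr a * (l + 1) powr a"
        using True t by (simp add: u_def powr_mult)
      then have "t powr a * (l + 1) powr a * exp (- u) \<le> C"
        using u_le[OF u] by (simp add: exp_minus field_simps)
      moreover have "exp (- t * l) = exp (- u) * exp t"
        by (simp add: u_def exp_add[symmetric] algebra_simps)
      ultimately have "t powr a * ((l + 1) powr a * exp (- t * l)) \<le> C * exp t"
        by (simp add: mult_ac)
      then have "(l + 1) powr a * exp (- t * l) \<le> C * exp t * t powr (- a)"
        using t by (simp add: powr_minus field_simps)
      then show ?thesis using True unfolding abs_of_nonneg[OF q_nonneg] by (simp add: q_def)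
    qed (use C in \<open>simp add: q_def\<close>)
  qed
  then show ?thesis using C by (intro exI[of _ "2 * C"]) (auto simp: mult.assoc)
qed

text \<open>Writing -l = 1 - (l + 1) keeps the derivative inside the family \<open>Q\<close>, at the
  price of one more power of H + 1.\<close>

lemma Q_derivative:
  assumes t: "0 < t"
  shows "(Q a has_vector_derivative (Q a t - Q (a + 1) t)) (at t)"
proof -
  have ad: "admissible b s" if "s > 0" for b s using that by (simp add: admissible_def)
  \<comment> \<open>The second-order remainder brings l^2 exp (|h| l). Two extra powers absorb l^2,
    and half of the time absorbs the exponential when |h| < t/2.\<close>
  obtain C where C: "\<And>l. \<bar>q (a + 2) (t / 2) l\<bar> \<le> C"
    using bounded_borelD(2)[OF bounded_borel_q[OF ad, of "t / 2" "a + 2"]] t by auto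
  show ?thesis
  proof (rule has_vector_derivative_quadratic[of "t / 2" _ _ _ "2 * C"])
    fix h :: real assume h: "\<bar>h\<bar> < t / 2"
    have th: "t + h > 0" using h t by linarith
    have bb: "bounded_borel (q a (t + h))" "bounded_borel (q a t)" "bounded_borel (q (a + 1) t)"
      using th t by (auto intro: ad)
    define r where "r l = q a (t + h) l - q a t l - h * (q a t l - q (a + 1) t l)" for l
    have rb: "bounded_borel r" unfolding r_def by (intro bounded_borel_intros bb)
    have "\<bar>r l\<bar> \<le> C * h\<^sup>2" for l
    proof (cases "l \<ge> 0")
      case True
      have "(l + 1) powr (a + 1) = (l + 1) powr a * (l + 1)" using True by (simp add: powr_add)
      then have "r l = (l + 1) powr a * exp (- t * l) * (exp (- h * l) - 1 - (- h * l))"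
        using True by (simp add: r_def q_def exp_add[symmetric] algebra_simps)
      then have "\<bar>r l\<bar> = (l + 1) powr a * exp (- t * l) * \<bar>exp (- h * l) - 1 - (- h * l)\<bar>"
        by (simp add: abs_mult)
      also have "\<dots> \<le> (l + 1) powr a * exp (- t * l) * ((- h * l)\<^sup>2 * exp \<bar>- h * l\<bar>)"
        by (intro mult_left_mono exp_second_order) simp
      also have "\<dots> \<le> (l + 1) powr a * exp (- t * l) * ((h\<^sup>2 * (l + 1)\<^sup>2) * exp (t / 2 * l))"
      proof (intro mult_left_mono mult_mono)
        show "(- h * l)\<^sup>2 \<le> h\<^sup>2 * (l + 1)\<^sup>2"
          unfolding power_mult_distrib power2_minus using True by (intro mult_left_mono power_mono) auto
        show "exp \<bar>- h * l\<bar> \<le> exp (t / 2 * l)"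
        proof -
          have "\<bar>h\<bar> * l \<le> t / 2 * l" using True h by (intro mult_right_mono) auto
          then show ?thesis using True by (simp add: abs_mult)
        qed
      qed auto
      also have "\<dots> = q (a + 2) (t / 2) l * h\<^sup>2"
      proof -
        have "(l + 1) powr (a + 2) = (l + 1) powr a * (l + 1)\<^sup>2"
          using True powr_realpow[of "l + 1" 2] by (simp add: powr_add)
        moreover have "exp (- t * l) * exp (t / 2 * l) = exp (- (t / 2) * l)"
          by (simp add: exp_add[symmetric] field_simps)
        ultimately show ?thesis using True by (simp add: q_def algebra_simps)
      qed
      also have "\<dots> \<le> C * h\<^sup>2" using C[of l] by (intro mult_right_mono) auto
      finally show ?thesis .
    next
      case False
      have "0 \<le> C" using C[of 0] by simp
      then show ?thesis using False by (simp add: r_def q_def)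
    qed
    then have "norm (calc r) \<le> 2 * (C * h\<^sup>2)" by (intro norm_calc_le rb)
    moreover have "calc r = Q a (t + h) - Q a t - h *\<^sub>R (Q a t - Q (a + 1) t)"
      unfolding r_def Q_def using bb by (simp add: calc_diff calc_scale bounded_borel_intros)
    ultimately show "norm (Q a (t + h) - Q a t - h *\<^sub>R (Q a t - Q (a + 1) t)) \<le> 2 * C * h\<^sup>2" by simp
  qed (use t in auto)
qed

text \<open>Convergence at time 0 holds in norm once the resolvent is applied, since (1 - exp (- c
  l)) / (l + 1) \<le> c uniformly in l \<ge> 0.\<close>

lemma resolvent_heat_bound:
  assumes "0 \<le> c"
  shows "norm (Q (- 1) c - Q (- 1) 0) \<le> 2 * c"
proof -
  have ad: "admissible (- 1) c" "admissible (- 1) 0" using assms by (auto simp: admissible_def)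
  have "\<bar>q (- 1) c l - q (- 1) 0 l\<bar> \<le> c" for l
  proof (cases "l \<ge> 0")
    case True
    have "1 - exp (- c * l) \<le> c * l" using exp_ge_add_one_self[of "- c * l"] by simp
    also have "\<dots> \<le> c * (l + 1)" using assms by (simp add: distrib_left)
    finally have "(1 - exp (- c * l)) / (l + 1) \<le> c" using True by (simp add: field_simps)
    moreover have "exp (- c * l) \<le> 1" using assms True by simp
    moreover have "q (- 1) c l - q (- 1) 0 l = - ((1 - exp (- c * l)) / (l + 1))"
      using True by (simp add: q_def powr_minus diff_divide_distrib divide_inverse algebra_simps)
    ultimately show ?thesis using True by simp
  qed (use assms in \<open>simp add: q_def\<close>)
  then have "norm (calc (\<lambda>l. q (- 1) c l - q (- 1) 0 l)) \<le> 2 * c"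
    using ad by (intro norm_calc_le) auto
  then show ?thesis using ad by (simp add: Q_def calc_diff bounded_borel_q)
qed

end


section \<open>Bochner integration without separability\<close>

text \<open>Pointwise convergence is required everywhere, not just almost everywhere, so that
  composition with measurable maps needs no care about null sets.\<close>

definition strong_measurable :: "'b measure \<Rightarrow> ('b \<Rightarrow> 'c::real_normed_vector) \<Rightarrow> bool" where
  "strong_measurable M f \<longleftrightarrow>
    (\<exists>s :: nat \<Rightarrow> 'b \<Rightarrow> 'c. (\<forall>i. simple_function M (s i)) \<and> (\<forall>x\<in>space M. (\<lambda>i. s i x) \<longlonglongrightarrow> f x))"

lemma strong_measurable_comp:
  assumes "strong_measurable M f" "continuous_on UNIV g"
  shows "strong_measurable M (\<lambda>x. g (f x))"
proof -
  obtain s where s: "\<And>i. simple_function M (s i)" "\<And>x. x \<in> space M \<Longrightarrow> (\<lambda>i. s i x) \<longlonglongrightarrow> f x"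
    using assms(1) unfolding strong_measurable_def by blast
  have "(\<lambda>i. g (s i x)) \<longlonglongrightarrow> g (f x)" if "x \<in> space M" for x
    using continuous_on_tendsto_compose[OF assms(2) s(2)[OF that]] by simp
  then show ?thesis
    unfolding strong_measurable_def using s(1)
    by (intro exI[of _ "\<lambda>i x. g (s i x)"]) (auto intro: simple_function_compose1)
qed

lemma strong_measurable_bilinear:
  assumes "strong_measurable M f" "strong_measurable M g" "bounded_bilinear B"
  shows "strong_measurable M (\<lambda>x. B (f x) (g x))"
proof -
  obtain s t where "\<And>i. simple_function M (s i)" "\<And>x. x \<in> space M \<Longrightarrow> (\<lambda>i. s i x) \<longlonglongrightarrow> f x"
    "\<And>i. simple_function M (t i)" "\<And>x. x \<in> space M \<Longrightarrow> (\<lambda>i. t i x) \<longlonglongrightarrow> g x"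
    using assms(1,2) unfolding strong_measurable_def by metis
  then show ?thesis
    unfolding strong_measurable_def
    by (intro exI[of _ "\<lambda>i x. B (s i x) (t i x)"])
      (auto intro: simple_function_compose2 bounded_bilinear.tendsto[OF assms(3)])
qed

lemma strong_measurable_add:
  assumes "strong_measurable M f" "strong_measurable M g"
  shows "strong_measurable M (\<lambda>x. f x + g x)"
proof -
  obtain s t where "\<And>i. simple_function M (s i)" "\<And>x. x \<in> space M \<Longrightarrow> (\<lambda>i. s i x) \<longlonglongrightarrow> f x"
    "\<And>i. simple_function M (t i)" "\<And>x. x \<in> space M \<Longrightarrow> (\<lambda>i. t i x) \<longlonglongrightarrow> g x"
    using assms unfolding strong_measurable_def by metis
  then show ?thesis
    unfolding strong_measurable_def
    by (intro exI[of _ "\<lambda>i x. s i x + t i x"])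
      (auto intro: simple_function_compose2 tendsto_add)
qed

lemma strong_measurable_diff:
  assumes "strong_measurable M f" "strong_measurable M g"
  shows "strong_measurable M (\<lambda>x. f x - g x)"
  using strong_measurable_add[OF assms(1) strong_measurable_comp[OF assms(2), of uminus]]
  by (simp add: continuous_on_minus continuous_on_id)

lemma strong_measurable_simple: "simple_function M f \<Longrightarrow> strong_measurable M f"
  unfolding strong_measurable_def by (intro exI[of _ "\<lambda>_. f"]) auto

lemma strong_measurable_compose:
  assumes "strong_measurable N f" "h \<in> measurable M N"
  shows "strong_measurable M (\<lambda>x. f (h x))"
proof -
  obtain s where s: "\<And>i. simple_function N (s i)" "\<And>x. x \<in> space N \<Longrightarrow> (\<lambda>i. s i x) \<longlonglongrightarrow> f x"
    using assms(1) unfolding strong_measurable_def by blast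
  then show ?thesis
    unfolding strong_measurable_def using assms(2)
    by (intro exI[of _ "\<lambda>i x. s i (h x)"]) (auto intro: simple_function_comp dest: measurable_space)
qed

lemma strong_measurable_real:
  fixes f :: "'b \<Rightarrow> real"
  assumes "strong_measurable M f"
  shows "f \<in> borel_measurable M"
proof -
  obtain s where "\<And>i. simple_function M (s i)" "\<And>x. x \<in> space M \<Longrightarrow> (\<lambda>i. s i x) \<longlonglongrightarrow> f x"
    using assms unfolding strong_measurable_def by blast
  then show ?thesis
    by (intro borel_measurable_LIMSEQ_real[of M s f] borel_measurable_simple_function) auto
qed

lemma strong_measurable_norm: "strong_measurable M f \<Longrightarrow> (\<lambda>x. norm (f x)) \<in> borel_measurable M"
  by (rule strong_measurable_real, rule strong_measurable_comp[where g = norm])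
    (auto intro: continuous_intros)

text \<open>Continuity on the open half-line allows approximation by sampling, even though
  \<open>F\<close> may be unbounded near 0.\<close>

lemma strong_measurable_halfline:
  fixes F :: "real \<Rightarrow> 'c::real_normed_vector"
  assumes cont: "continuous_on {0<..} F" and zero: "\<And>r. r \<le> 0 \<Longrightarrow> F r = 0"
  shows "strong_measurable borel F"
proof -
  \<comment> \<open>The summand 1 moves the sampling point strictly to the right of r, hence away
    from the singular point 0. Outside the window the index 0 samples
    \<open>F 0 = 0\<close>.\<close>
  define k where "k i r = (if 0 < r \<and> r \<le> real i then \<lfloor>real (Suc i) * r\<rfloor> + 1 else 0)" for i and r :: real
  define s where "s i r = F (of_int (k i r) / real (Suc i))" for i r
  have "simple_function borel (k i)" for i
    unfolding simple_function_def
  proof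
    have "k i r \<in> {0..\<lceil>real (Suc i) * real i\<rceil> + 1}" for r
    proof (cases "0 < r \<and> r \<le> real i")
      case True
      then have "real (Suc i) * r \<le> real (Suc i) * real i" "0 \<le> real (Suc i) * r"
        by (auto intro: mult_left_mono)
      then show ?thesis using True unfolding k_def atLeastAtMost_iff if_P[OF True] by linarith
    next
      case False
      have "0 \<le> real (Suc i) * real i" by simp
      then show ?thesis unfolding k_def atLeastAtMost_iff if_not_P[OF False] by linarith
    qed
    then have "range (k i) \<subseteq> {0..\<lceil>real (Suc i) * real i\<rceil> + 1}" by blast
    then show "finite (k i ` space borel)" by (simp add: finite_subset)
    have "k i \<in> measurable borel (count_space UNIV)" unfolding k_def by measurable
    then have "k i -` {x} \<inter> space borel \<in> sets borel" for x
      by (rule measurable_sets) simp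
    then show "\<forall>x\<in>k i ` space borel. k i -` {x} \<inter> space borel \<in> sets borel" by blast
  qed
  then have "simple_function borel (s i)" for i
    unfolding s_def by (rule simple_function_compose1)
  moreover have "(\<lambda>i. s i r) \<longlonglongrightarrow> F r" for r
  proof (cases "0 < r")
    case True
    define p where "p i = of_int (\<lfloor>real (Suc i) * r\<rfloor> + 1) / real (Suc i)" for i
    have p: "r < p i" "p i \<le> r + 1 / real (Suc i)" for i
      unfolding p_def by (simp_all add: field_simps del: of_nat_Suc) linarith+
    have "p \<longlonglongrightarrow> r"
    proof (rule tendsto_sandwich[of "\<lambda>_. r" _ _ "\<lambda>i. r + 1 / real (Suc i)"])
      show "(\<lambda>i. r + 1 / real (Suc i)) \<longlonglongrightarrow> r"
        using tendsto_add[OF tendsto_const[of r] LIMSEQ_Suc[OF lim_1_over_n]] by simp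
    qed (use p in \<open>auto intro!: always_eventually less_imp_le[OF p(1)]\<close>)
    then have "(\<lambda>i. F (p i)) \<longlonglongrightarrow> F r"
      using True p(1) by (intro continuous_on_tendsto_compose[OF cont]) (auto intro!: always_eventually less_trans[OF True p(1)])
    moreover obtain N where "r < real N" using reals_Archimedean2 by blast
    then have "\<forall>\<^sub>F i in sequentially. F (p i) = s i r"
      using True by (auto simp: eventually_sequentially s_def k_def p_def intro!: exI[of _ N])
    ultimately show ?thesis by (rule Lim_transform_eventually)
  next
    case False
    then show ?thesis by (simp add: s_def k_def zero)
  qed
  ultimately show ?thesis unfolding strong_measurable_def by blast
qed

section \<open>Existence and uniqueness of the Bochner integral\<close>

definition bochner_integrable :: "'b measure \<Rightarrow> ('b \<Rightarrow> 'c::real_normed_vector) \<Rightarrow> bool" where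
  "bochner_integrable M f \<longleftrightarrow> strong_measurable M f \<and> (\<integral>\<^sup>+ x. ennreal (norm (f x)) \<partial>M) < \<infinity>"

lemma has_bochner_exists:
  fixes f :: "'b \<Rightarrow> 'c::banach"
  assumes "bochner_integrable M f"
  shows "\<exists>y. has_bochner M f y"
proof -
  have sm: "strong_measurable M f" and fin: "(\<integral>\<^sup>+ x. ennreal (norm (f x)) \<partial>M) < \<infinity>"
    using assms by (auto simp: bochner_integrable_def)
  note [measurable] = strong_measurable_norm[OF sm]
  obtain s where s: "\<And>i. simple_function M (s i)" "\<And>x. x \<in> space M \<Longrightarrow> (\<lambda>i. s i x) \<longlonglongrightarrow> f x"
    using sm unfolding strong_measurable_def by blast
  \<comment> \<open>Discarding values larger than twice the limit gives a dominating function,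
    namely 3 |f|, for the L1 convergence; where \<open>f\<close> vanishes the truncated sequence is
    0.\<close>
  define t where "t i x = (if norm (s i x) \<le> 2 * norm (f x) then s i x else 0)" for i x
  have t_simple: "simple_function M (t i)" for i
  proof -
    have A: "{x \<in> space M. norm (s i x) \<le> 2 * norm (f x)} \<in> sets M"
      using borel_measurable_simple_function[OF simple_function_compose1[OF s(1)[of i], of norm]] by measurable
    have "simple_function M (\<lambda>x. (indicator {x \<in> space M. norm (s i x) \<le> 2 * norm (f x)} x :: real) *\<^sub>R s i x)"
      by (intro simple_function_compose2[where h = "(*\<^sub>R)"] simple_function_indicator A s)
    then show ?thesis
      by (rule simple_function_cong[THEN iffD1, rotated]) (auto simp: t_def indicator_def)
  qed
  have t_le: "norm (t i x) \<le> 2 * norm (f x)" for i x by (auto simp: t_def)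
  have t_lim: "(\<lambda>i. t i x) \<longlonglongrightarrow> f x" if x: "x \<in> space M" for x
  proof (cases "f x = 0")
    case True
    then show ?thesis using t_le[of _ x] by simp
  next
    case False
    then have "\<forall>\<^sub>F i in sequentially. norm (s i x) < 2 * norm (f x)"
      by (intro order_tendstoD(2)[OF tendsto_norm[OF s(2)[OF x]]]) simp
    then have "\<forall>\<^sub>F i in sequentially. s i x = t i x" by eventually_elim (simp add: t_def)
    then show ?thesis by (rule Lim_transform_eventually[OF s(2)[OF x]])
  qed
  have t_int: "Bochner_Integration.simple_bochner_integrable M (t i)" for i
  proof (rule simple_bochner_integrableI_bounded[OF t_simple])
    have "(\<integral>\<^sup>+ x. ennreal (norm (t i x)) \<partial>M) \<le> (\<integral>\<^sup>+ x. 2 * ennreal (norm (f x)) \<partial>M)"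
      using t_le by (intro nn_integral_mono) (simp add: ennreal_mult'[symmetric] ennreal_leI flip: ennreal_numeral)
    also have "\<dots> < \<infinity>" using fin by (simp add: nn_integral_cmult ennreal_mult_less_top)
    finally show "(\<integral>\<^sup>+ x. ennreal (norm (t i x)) \<partial>M) < \<infinity>" .
  qed
  have sm_diff: "(\<lambda>x. norm (f x - t i x)) \<in> borel_measurable M" for i
    by (intro strong_measurable_norm strong_measurable_diff sm strong_measurable_simple t_simple)
  have L1: "(\<lambda>i. \<integral>\<^sup>+ x. ennreal (norm (f x - t i x)) \<partial>M) \<longlonglongrightarrow> 0"
  proof -
    have "(\<lambda>i. \<integral>\<^sup>+ x. ennreal (norm (f x - t i x)) \<partial>M) \<longlonglongrightarrow> (\<integral>\<^sup>+ x. 0 \<partial>M)"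
    proof (rule nn_integral_dominated_convergence[where w = "\<lambda>x. 3 * ennreal (norm (f x))"])
      show "AE x in M. ennreal (norm (f x - t i x)) \<le> 3 * ennreal (norm (f x))" for i
      proof (rule AE_I2)
        fix x
        have "norm (f x - t i x) \<le> 3 * norm (f x)"
          using norm_triangle_ineq4[of "f x" "t i x"] t_le[of i x] by linarith
        then show "ennreal (norm (f x - t i x)) \<le> 3 * ennreal (norm (f x))"
          by (simp add: ennreal_mult'[symmetric] ennreal_leI flip: ennreal_numeral)
      qed
      show "(\<integral>\<^sup>+ x. 3 * ennreal (norm (f x)) \<partial>M) < \<infinity>"
        using fin by (simp add: nn_integral_cmult ennreal_mult_less_top)
      show "AE x in M. (\<lambda>i. ennreal (norm (f x - t i x))) \<longlonglongrightarrow> 0"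
      proof (rule AE_I2)
        fix x assume "x \<in> space M"
        then have "(\<lambda>i. norm (f x - t i x)) \<longlonglongrightarrow> norm (f x - f x)"
          by (intro tendsto_intros t_lim)
        then have "(\<lambda>i. ennreal (norm (f x - t i x))) \<longlonglongrightarrow> ennreal (norm (f x - f x))"
          by (rule tendsto_ennrealI)
        then show "(\<lambda>i. ennreal (norm (f x - t i x))) \<longlonglongrightarrow> 0" by simp
      qed
    qed (use sm_diff in \<open>measurable\<close>)
    then show ?thesis by simp
  qed
  have bnd: "ennreal (norm (Bochner_Integration.simple_bochner_integral M (t m) - Bochner_Integration.simple_bochner_integral M (t n)))
      \<le> (\<integral>\<^sup>+ x. ennreal (norm (f x - t m x)) \<partial>M) + (\<integral>\<^sup>+ x. ennreal (norm (f x - t n x)) \<partial>M)" for m n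
  proof -
    have "ennreal (norm (Bochner_Integration.simple_bochner_integral M (t m) - Bochner_Integration.simple_bochner_integral M (t n)))
        \<le> ennreal (Bochner_Integration.simple_bochner_integral M (\<lambda>x. norm (t m x - t n x)))"
      using simple_bochner_integral_norm_bound[OF simple_bochner_integrable_compose2[where p = "(-)", OF _ t_int t_int]]
      by (subst simple_bochner_integral_diff[OF t_int t_int, symmetric]) (auto intro: ennreal_leI)
    also have "\<dots> = (\<integral>\<^sup>+ x. ennreal (norm (t m x - t n x)) \<partial>M)"
      by (intro simple_bochner_integral_eq_nn_integral simple_bochner_integrable_compose2[where p = "\<lambda>a b. norm (a - b)", OF _ t_int t_int]) auto
    also have "\<dots> \<le> (\<integral>\<^sup>+ x. ennreal (norm (f x - t m x)) + ennreal (norm (f x - t n x)) \<partial>M)"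
    proof (rule nn_integral_mono)
      fix x
      have "norm (t m x - t n x) \<le> norm (f x - t m x) + norm (f x - t n x)"
        using norm_triangle_ineq4[of "f x - t n x" "f x - t m x"] by simp
      then show "ennreal (norm (t m x - t n x)) \<le> ennreal (norm (f x - t m x)) + ennreal (norm (f x - t n x))"
        by (simp add: ennreal_leI flip: ennreal_plus)
    qed
    also have "\<dots> = (\<integral>\<^sup>+ x. ennreal (norm (f x - t m x)) \<partial>M) + (\<integral>\<^sup>+ x. ennreal (norm (f x - t n x)) \<partial>M)"
      using sm_diff by (intro nn_integral_add) auto
    finally show ?thesis .
  qed
  have "Cauchy (\<lambda>i. Bochner_Integration.simple_bochner_integral M (t i))"
  proof (rule metric_CauchyI)
    fix e :: real assume "e > 0"
    then have "\<forall>\<^sub>F i in sequentially. (\<integral>\<^sup>+ x. ennreal (norm (f x - t i x)) \<partial>M) < ennreal (e / 2)"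
      by (intro order_tendstoD(2)[OF L1]) auto
    then obtain N where N: "\<And>i. i \<ge> N \<Longrightarrow> (\<integral>\<^sup>+ x. ennreal (norm (f x - t i x)) \<partial>M) < ennreal (e / 2)"
      by (auto simp: eventually_sequentially)
    have "dist (Bochner_Integration.simple_bochner_integral M (t m)) (Bochner_Integration.simple_bochner_integral M (t n)) < e"
      if "m \<ge> N" "n \<ge> N" for m n
    proof -
      have "ennreal (norm (Bochner_Integration.simple_bochner_integral M (t m) - Bochner_Integration.simple_bochner_integral M (t n)))
          < ennreal (e / 2) + ennreal (e / 2)"
        using bnd[of m n] add_strict_mono[OF N[OF that(1)] N[OF that(2)]] by (rule le_less_trans)
      also have "\<dots> = ennreal e" using \<open>e > 0\<close> by (simp flip: ennreal_plus)
      finally show ?thesis using \<open>e > 0\<close> by (simp add: dist_norm ennreal_less_iff)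
    qed
    then show "\<exists>M'. \<forall>m\<ge>M'. \<forall>n\<ge>M'. dist (Bochner_Integration.simple_bochner_integral M (t m)) (Bochner_Integration.simple_bochner_integral M (t n)) < e"
      by blast
  qed
  then obtain y where "(\<lambda>i. Bochner_Integration.simple_bochner_integral M (t i)) \<longlonglongrightarrow> y"
    using Cauchy_convergent convergent_def by blast
  then show ?thesis
    unfolding has_bochner_def using t_int L1 t_lim
    by (intro exI[of _ y] exI[of _ t]) auto
qed

text \<open>Applying a real functional to the approximating simple functions turns
  \<open>has_bochner\<close> into the ordinary real integral, with all its theorems.\<close>

lemma has_bochner_functional:
  fixes l :: "'c::real_normed_vector \<Rightarrow> real"
  assumes f: "has_bochner M f y" and sm: "strong_measurable M f" and l: "bounded_linear l"
  shows "has_bochner_integral M (\<lambda>x. l (f x)) (l y)"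
proof -
  interpret l: bounded_linear l by fact
  obtain s where s: "\<And>i. Bochner_Integration.simple_bochner_integrable M (s i)"
    "(\<lambda>i. \<integral>\<^sup>+ x. ennreal (norm (f x - s i x)) \<partial>M) \<longlonglongrightarrow> 0"
    "(\<lambda>i. Bochner_Integration.simple_bochner_integral M (s i)) \<longlonglongrightarrow> y"
    using f unfolding has_bochner_def by blast
  obtain K where K: "K > 0" "\<And>x. norm (l x) \<le> norm x * K" using l.pos_bounded by blast
  show ?thesis
  proof (rule has_bochner_integral.intros)
    show "(\<lambda>x. l (f x)) \<in> borel_measurable M"
      by (rule strong_measurable_real, rule strong_measurable_comp[OF sm l.continuous_on[OF continuous_on_id]])
    show "Bochner_Integration.simple_bochner_integrable M (\<lambda>x. l (s i x))" for i
      using simple_bochner_integrable_compose2[where p = "\<lambda>a b. l a", OF _ s(1) s(1)] by (simp add: l.zero)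
    show "(\<lambda>i. Bochner_Integration.simple_bochner_integral M (\<lambda>x. l (s i x))) \<longlonglongrightarrow> l y"
      by (simp add: simple_bochner_integral_linear[OF l.linear_axioms s(1)] l.tendsto s(3))
    have sdiff: "(\<lambda>x. norm (f x - s i x)) \<in> borel_measurable M" for i
    proof -
      have "simple_function M (s i)"
        using s(1)[of i] by (auto elim: Bochner_Integration.simple_bochner_integrable.cases)
      then show ?thesis
        by (intro strong_measurable_norm strong_measurable_diff sm strong_measurable_simple)
    qed
    show "(\<lambda>i. \<integral>\<^sup>+ x. ennreal (norm (l (f x) - l (s i x))) \<partial>M) \<longlonglongrightarrow> 0"
    proof (rule tendsto_sandwich[of "\<lambda>_. 0"])
      show "(\<lambda>i. ennreal K * (\<integral>\<^sup>+ x. ennreal (norm (f x - s i x)) \<partial>M)) \<longlonglongrightarrow> 0"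
        using ennreal_tendsto_cmult[OF _ s(2), of "ennreal K"] by simp
      have "(\<integral>\<^sup>+ x. ennreal (norm (l (f x) - l (s i x))) \<partial>M) \<le> ennreal K * (\<integral>\<^sup>+ x. ennreal (norm (f x - s i x)) \<partial>M)" for i
      proof -
        have "(\<integral>\<^sup>+ x. ennreal (norm (l (f x) - l (s i x))) \<partial>M) \<le> (\<integral>\<^sup>+ x. ennreal K * ennreal (norm (f x - s i x)) \<partial>M)"
          using K by (intro nn_integral_mono)
            (simp add: l.diff[symmetric] ennreal_mult'[symmetric] ennreal_leI mult.commute)
        also have "\<dots> = ennreal K * (\<integral>\<^sup>+ x. ennreal (norm (f x - s i x)) \<partial>M)"
          using sdiff by (intro nn_integral_cmult) auto
        finally show ?thesis .
      qed
      then show "\<forall>\<^sub>F i in sequentially. (\<integral>\<^sup>+ x. ennreal (norm (l (f x) - l (s i x))) \<partial>M)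
          \<le> ennreal K * (\<integral>\<^sup>+ x. ennreal (norm (f x - s i x)) \<partial>M)" by simp
    qed auto
  qed
qed

lemma has_bochner_cong_AE:
  assumes "AE x in M. f x = g x"
  shows "has_bochner M f y \<longleftrightarrow> has_bochner M g y"
proof -
  have "has_bochner M g y" if f: "has_bochner M f y" and eq: "AE x in M. f x = g x" for f g
  proof -
    obtain s where s: "\<And>i. Bochner_Integration.simple_bochner_integrable M (s i)" "AE x in M. (\<lambda>i. s i x) \<longlonglongrightarrow> f x"
      "(\<lambda>i. \<integral>\<^sup>+ x. ennreal (norm (f x - s i x)) \<partial>M) \<longlonglongrightarrow> 0"
      "(\<lambda>i. Bochner_Integration.simple_bochner_integral M (s i)) \<longlonglongrightarrow> y"
      using f unfolding has_bochner_def by blast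
    have "(\<integral>\<^sup>+ x. ennreal (norm (g x - s i x)) \<partial>M) = (\<integral>\<^sup>+ x. ennreal (norm (f x - s i x)) \<partial>M)" for i
      by (rule nn_integral_cong_AE) (use eq in \<open>eventually_elim, simp\<close>)
    moreover have "AE x in M. (\<lambda>i. s i x) \<longlonglongrightarrow> g x"
      using s(2) eq by eventually_elim simp
    ultimately show ?thesis unfolding has_bochner_def using s by (intro exI[of _ s]) auto
  qed
  then show ?thesis using assms by (metis (mono_tags, lifting) eventually_mono)
qed

lemma bochner_cong_AE: "AE x in M. f x = g x \<Longrightarrow> bochner M f = bochner M g"
  unfolding bochner_def by (rule arg_cong[of _ _ The], rule ext) (rule has_bochner_cong_AE)

section \<open>Operator integrals through their real matrix entries\<close>

definition entry :: "'a::chilbert_space \<Rightarrow> 'a \<Rightarrow> 'a cblinfun \<Rightarrow> real" where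
  "entry x v A = Re (cinner x (A \<rhd> v))"

lemma bounded_linear_entry: "bounded_linear (entry x v)"
  by (rule bounded_linear_intro[where K = "norm x * norm v"])
    (auto simp: entry_def cblinfun_simps cinner_simps intro!: order_trans[OF abs_Re_le_cmod]
      order_trans[OF norm_cinner_le] order_trans[OF mult_left_mono[OF norm_cblinfun]])

lemma entry_simps:
  "entry x v (A + B) = entry x v A + entry x v B"
  "entry x v (A - B) = entry x v A - entry x v B"
  "entry x v (c *\<^sub>R A) = c * entry x v A"
  by (simp_all add: entry_def cblinfun_simps cinner_simps)

text \<open>Real parts suffice, since a difference of vectors can be tested against itself.
  Linearity, Fubini, substitution and the fundamental theorem of calculus are transferred to
  operators through these entries.\<close>

lemma entry_eqI: "(\<And>x v. entry x v A = entry x v B) \<Longrightarrow> A = B"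
  unfolding entry_def by (intro cblinfun_eqI Re_cinner_eqI)

lemma bochner_integral_entry:
  fixes f :: "'b \<Rightarrow> 'a::chilbert_space cblinfun"
  assumes f: "bochner_integrable M f"
  shows "has_bochner_integral M (\<lambda>s. entry x v (f s)) (entry x v (bochner M f))"
proof -
  obtain y where y: "has_bochner M f y" using has_bochner_exists[OF f] by blast
  have sm: "strong_measurable M f" using f by (simp add: bochner_integrable_def)
  have "bochner M f = y"
    unfolding bochner_def
  proof (rule the_equality)
    show "z = y" if "has_bochner M f z" for z
      using has_bochner_functional[OF that sm bounded_linear_entry]
        has_bochner_functional[OF y sm bounded_linear_entry]
      by (intro entry_eqI) (rule has_bochner_integral_eq)
  qed (rule y)
  then show ?thesis using has_bochner_functional[OF y sm bounded_linear_entry] by simp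
qed

lemma bochner_eqI:
  fixes f :: "'b \<Rightarrow> 'a::chilbert_space cblinfun"
  assumes "bochner_integrable M f"
    and "\<And>x v. has_bochner_integral M (\<lambda>s. entry x v (f s)) (entry x v A)"
  shows "bochner M f = A"
  using bochner_integral_entry[OF assms(1)] assms(2)
  by (intro entry_eqI) (rule has_bochner_integral_eq)

lemma norm_bochner_le:
  fixes f :: "'b \<Rightarrow> 'a::chilbert_space cblinfun"
  assumes f: "bochner_integrable M f" and B: "(\<integral>\<^sup>+ s. ennreal (norm (f s)) \<partial>M) \<le> ennreal B" "B \<ge> 0"
  shows "norm (bochner M f) \<le> B"
proof (rule norm_cblinfun_bound)
  fix v
  \<comment> \<open>Testing the integral against its own value at \<open>v\<close> bounds the square
    of the norm and costs no constant.\<close>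
  let ?x = "bochner M f \<rhd> v"
  have h: "has_bochner_integral M (\<lambda>s. entry ?x v (f s)) (entry ?x v (bochner M f))"
    by (rule bochner_integral_entry[OF f])
  have [measurable]: "(\<lambda>s. norm (f s)) \<in> borel_measurable M"
    using f by (intro strong_measurable_norm) (simp add: bochner_integrable_def)
  have "ennreal (norm (entry ?x v (bochner M f))) \<le> (\<integral>\<^sup>+ s. ennreal (norm (entry ?x v (f s))) \<partial>M)"
    using integral_norm_bound_ennreal[of M "\<lambda>s. entry ?x v (f s)"] h
    by (simp add: has_bochner_integral_iff)
  also have "\<dots> \<le> (\<integral>\<^sup>+ s. ennreal (norm ?x * norm v) * ennreal (norm (f s)) \<partial>M)"
  proof (rule nn_integral_mono)
    fix s
    have "norm (entry ?x v (f s)) \<le> norm ?x * norm (f s \<rhd> v)"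
      unfolding entry_def using order_trans[OF abs_Re_le_cmod norm_cinner_le] by simp
    also have "\<dots> \<le> norm ?x * (norm (f s) * norm v)" by (intro mult_left_mono norm_cblinfun) auto
    finally show "ennreal (norm (entry ?x v (f s))) \<le> ennreal (norm ?x * norm v) * ennreal (norm (f s))"
      by (simp add: ennreal_mult'[symmetric] ennreal_leI mult_ac)
  qed
  also have "\<dots> = ennreal (norm ?x * norm v) * (\<integral>\<^sup>+ s. ennreal (norm (f s)) \<partial>M)"
    by (rule nn_integral_cmult) measurable
  also have "\<dots> \<le> ennreal (norm ?x * norm v) * ennreal B" by (intro mult_left_mono B) simp
  also have "\<dots> = ennreal (norm ?x * norm v * B)" using B by (simp add: ennreal_mult')
  finally have "norm ?x * norm ?x \<le> norm ?x * (B * norm v)"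
    using B by (simp add: ennreal_le_iff entry_def Re_cinner_self power2_eq_square mult_ac)
  then show "norm (bochner M f \<rhd> v) \<le> B * norm v"
    using B by (cases "?x = 0") auto
qed (rule B)

lemma bochner_integrable_bound:
  assumes f: "strong_measurable M f" and le: "\<And>x. x \<in> space M \<Longrightarrow> norm (f x) \<le> g x"
    and g: "(\<integral>\<^sup>+ x. ennreal (g x) \<partial>M) < \<infinity>"
  shows "bochner_integrable M f"
proof -
  have "(\<integral>\<^sup>+ x. ennreal (norm (f x)) \<partial>M) \<le> (\<integral>\<^sup>+ x. ennreal (g x) \<partial>M)"
    using le by (intro nn_integral_mono ennreal_leI) auto
  then show ?thesis using f g by (auto simp: bochner_integrable_def)
qed

lemma bochner_integrable_linear:
  assumes f: "bochner_integrable M f" and T: "bounded_linear T"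
  shows "bochner_integrable M (\<lambda>x. T (f x))"
proof -
  interpret T: bounded_linear T by fact
  obtain K where K: "K > 0" "\<And>x. norm (T x) \<le> norm x * K" using T.pos_bounded by blast
  have [measurable]: "(\<lambda>s. norm (f s)) \<in> borel_measurable M"
    using f by (intro strong_measurable_norm) (simp add: bochner_integrable_def)
  show ?thesis
  proof (rule bochner_integrable_bound[where g = "\<lambda>x. norm (f x) * K"])
    show "strong_measurable M (\<lambda>x. T (f x))"
      using f by (intro strong_measurable_comp[where g = T, OF _ T.continuous_on[OF continuous_on_id]])
        (simp add: bochner_integrable_def)
    show "(\<integral>\<^sup>+ x. ennreal (norm (f x) * K) \<partial>M) < \<infinity>"
      using f K by (simp add: ennreal_mult nn_integral_multc ennreal_mult_less_top bochner_integrable_def)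
  qed (rule K)
qed

lemma bochner_integrable_add:
  assumes f: "bochner_integrable M f" and g: "bochner_integrable M g"
  shows "bochner_integrable M (\<lambda>x. f x + g x)"
proof (rule bochner_integrable_bound[where g = "\<lambda>x. norm (f x) + norm (g x)"])
  have [measurable]: "(\<lambda>s. norm (f s)) \<in> borel_measurable M" "(\<lambda>s. norm (g s)) \<in> borel_measurable M"
    using f g by (auto intro!: strong_measurable_norm simp: bochner_integrable_def)
  show "strong_measurable M (\<lambda>x. f x + g x)"
    using f g by (intro strong_measurable_add) (auto simp: bochner_integrable_def)
  show "(\<integral>\<^sup>+ x. ennreal (norm (f x) + norm (g x)) \<partial>M) < \<infinity>"
    using f g by (simp add: nn_integral_add bochner_integrable_def)
qed (rule norm_triangle_ineq)

lemma bochner_integrable_scaleR: "bochner_integrable M f \<Longrightarrow> bochner_integrable M (\<lambda>x. c *\<^sub>R f x)"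
  by (rule bochner_integrable_linear[OF _ bounded_linear_scaleR_right])

lemma bochner_integrable_diff:
  assumes f: "bochner_integrable M f" and g: "bochner_integrable M g"
  shows "bochner_integrable M (\<lambda>x. f x - g x)"
  using bochner_integrable_add[OF f bochner_integrable_scaleR[OF g, of "- 1"]] by simp

lemma bochner_add:
  fixes f g :: "'b \<Rightarrow> 'a::chilbert_space cblinfun"
  assumes f: "bochner_integrable M f" and g: "bochner_integrable M g"
  shows "bochner M (\<lambda>x. f x + g x) = bochner M f + bochner M g"
  by (rule bochner_eqI[OF bochner_integrable_add[OF f g]])
    (auto simp: entry_simps intro!: has_bochner_integral_add bochner_integral_entry f g)

lemma bochner_diff:
  fixes f g :: "'b \<Rightarrow> 'a::chilbert_space cblinfun"
  assumes f: "bochner_integrable M f" and g: "bochner_integrable M g"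
  shows "bochner M (\<lambda>x. f x - g x) = bochner M f - bochner M g"
  by (rule bochner_eqI[OF bochner_integrable_diff[OF f g]])
    (auto simp: entry_simps intro!: has_bochner_integral_diff bochner_integral_entry f g)

lemma bochner_scaleR:
  fixes f :: "'b \<Rightarrow> 'a::chilbert_space cblinfun"
  assumes f: "bochner_integrable M f"
  shows "bochner M (\<lambda>x. c *\<^sub>R f x) = c *\<^sub>R bochner M f"
  by (rule bochner_eqI[OF bochner_integrable_scaleR[OF f]])
    (use has_bochner_integral_mult_right[OF bochner_integral_entry[OF f], of c] in \<open>auto simp: entry_simps\<close>)

lemma cblinfun_adjoint:
  fixes L :: "'a::chilbert_space cblinfun"
  shows "\<exists>y. \<forall>z. cinner x (L \<rhd> z) = cinner y z"
proof (rule riesz_representation[where K = "norm x * norm L"])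
  show "cmod (cinner x (L \<rhd> z)) \<le> norm x * norm L * norm z" for z
    using order_trans[OF norm_cinner_le mult_left_mono[OF norm_cblinfun norm_ge_zero]] by (simp add: mult.assoc)
qed (auto simp: cblinfun_simps cinner_simps)

lemma entry_mult_left: "\<exists>y. \<forall>A. entry x v (L * A) = entry y v A"
  using cblinfun_adjoint[of x L] by (auto simp: entry_def times_cblinfun_apply)

lemma bochner_mult_left:
  fixes f :: "'b \<Rightarrow> 'a::chilbert_space cblinfun"
  assumes f: "bochner_integrable M f"
  shows "bochner M (\<lambda>x. L * f x) = L * bochner M f"
proof (rule bochner_eqI[OF bochner_integrable_linear[OF f bounded_linear_mult_right]])
  fix x v
  obtain y where "\<And>A. entry x v (L * A) = entry y v A" using entry_mult_left by metis
  then show "has_bochner_integral M (\<lambda>s. entry x v (L * f s)) (entry x v (L * bochner M f))"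
    using bochner_integral_entry[OF f] by simp
qed


section \<open>Weakly singular kernels\<close>

text \<open>Vanishing on the nonpositive half-line replaces limits of integration: convolutions and
  iterated integrals can be taken over the whole space. The constant may depend on T, as the factor
  exp t in \<open>norm_Q_le\<close> forces.\<close>

definition bounded_kernel :: "real \<Rightarrow> (real \<Rightarrow> 'a::chilbert_space cblinfun) \<Rightarrow> bool" where
  "bounded_kernel a F \<longleftrightarrow> strong_measurable borel F \<and> (\<forall>r\<le>0. F r = 0) \<and>
    (\<forall>T>0. \<exists>C\<ge>0. \<forall>r. 0 < r \<and> r \<le> T \<longrightarrow> norm (F r) \<le> C * r powr (- a))"

text \<open>The Euler operator \<open>r d/dr\<close> preserves the order of the singularity at 0, unlike \<open>d/dr\<close>.\<close>

definition euler :: "(real \<Rightarrow> 'b::real_normed_vector) \<Rightarrow> (real \<Rightarrow> 'b) \<Rightarrow> bool" where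
  "euler F F1 \<longleftrightarrow> (\<forall>r>0. (F has_vector_derivative (1 / r) *\<^sub>R F1 r) (at r))"

text \<open>A coinductive definition: \<open>X\<close> is a family of kernels of order
  \<open>a\<close> in which every member has an Euler derivative. Thus Euler derivatives of all
  orders exist with the same singularity, without listing them.\<close>

definition singular_kernel :: "real \<Rightarrow> (real \<Rightarrow> 'a::chilbert_space cblinfun) \<Rightarrow> bool" where
  "singular_kernel a F \<longleftrightarrow> 0 \<le> a \<and> a < 1 \<and>
    (\<exists>X. X F \<and> (\<forall>F. X F \<longrightarrow> bounded_kernel a F \<and> (\<exists>F1. X F1 \<and> euler F F1)))"

text \<open>The Euler derivative of a generator is in general a sum of generators. Scalar factors
  are absorbed into the generators where they occur.\<close>

inductive add_closure :: "((real \<Rightarrow> 'b::real_normed_vector) \<Rightarrow> bool) \<Rightarrow> (real \<Rightarrow> 'b) \<Rightarrow> bool"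
  for G where
    base: "G F \<Longrightarrow> add_closure G F"
  | add: "add_closure G F \<Longrightarrow> add_closure G F' \<Longrightarrow> add_closure G (\<lambda>r. F r + F' r)"

lemma bounded_kernelD:
  assumes "bounded_kernel a F"
  shows "strong_measurable borel F" "r \<le> 0 \<Longrightarrow> F r = 0"
    "T > 0 \<Longrightarrow> \<exists>C\<ge>0. \<forall>r. 0 < r \<and> r \<le> T \<longrightarrow> norm (F r) \<le> C * r powr (- a)"
  using assms by (auto simp: bounded_kernel_def)

lemma singular_kernelD:
  assumes "singular_kernel a F"
  shows "bounded_kernel a F" "0 \<le> a" "a < 1" "\<exists>F1. singular_kernel a F1 \<and> euler F F1"
  using assms unfolding singular_kernel_def by blast+

lemma bounded_kernel_add:
  assumes F: "bounded_kernel a F" and G: "bounded_kernel a G"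
  shows "bounded_kernel a (\<lambda>r. F r + G r)"
  unfolding bounded_kernel_def
proof (intro conjI allI impI)
  show "strong_measurable borel (\<lambda>r. F r + G r)"
    by (intro strong_measurable_add bounded_kernelD(1)[OF F] bounded_kernelD(1)[OF G])
  show "F r + G r = 0" if "r \<le> 0" for r
    using bounded_kernelD(2)[OF F that] bounded_kernelD(2)[OF G that] by simp
  fix T :: real assume T: "T > 0"
  obtain C C' where "0 \<le> C" "\<forall>r. 0 < r \<and> r \<le> T \<longrightarrow> norm (F r) \<le> C * r powr (- a)"
    "0 \<le> C'" "\<forall>r. 0 < r \<and> r \<le> T \<longrightarrow> norm (G r) \<le> C' * r powr (- a)"
    using bounded_kernelD(3)[OF F T] bounded_kernelD(3)[OF G T] by blast
  then show "\<exists>C\<ge>0. \<forall>r. 0 < r \<and> r \<le> T \<longrightarrow> norm (F r + G r) \<le> C * r powr (- a)"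
    by (intro exI[of _ "C + C'"]) (auto simp: distrib_right intro!: norm_triangle_le add_mono)
qed

lemma euler_add: "euler F F1 \<Longrightarrow> euler G G1 \<Longrightarrow> euler (\<lambda>r. F r + G r) (\<lambda>r. F1 r + G1 r)"
  unfolding euler_def scaleR_add_right by (auto intro: has_vector_derivative_add)

text \<open>Only generators have to be differentiated: sums then form a family closed under Euler
  derivatives, as the coinductive definition demands.\<close>

lemma singular_kernel_spanI:
  assumes a: "0 \<le> a" "a < 1"
    and G: "\<And>F. G F \<Longrightarrow> bounded_kernel a F \<and> (\<exists>F1. add_closure G F1 \<and> euler F F1)"
    and F: "add_closure G F"
  shows "singular_kernel a F"
proof -
  have "bounded_kernel a F \<and> (\<exists>F1. add_closure G F1 \<and> euler F F1)" if "add_closure G F" for F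
    using that
  proof induction
    case (base F)
    then show ?case by (rule G)
  next
    case (add F F')
    then obtain F1 F1' where "add_closure G F1" "euler F F1" "add_closure G F1'" "euler F' F1'" by blast
    then have "add_closure G (\<lambda>r. F1 r + F1' r)" "euler (\<lambda>r. F r + F' r) (\<lambda>r. F1 r + F1' r)"
      by (auto intro: add_closure.add euler_add)
    moreover have "bounded_kernel a (\<lambda>r. F r + F' r)" using add by (auto intro: bounded_kernel_add)
    ultimately show ?case by blast
  qed
  then show ?thesis
    unfolding singular_kernel_def using a F by (intro conjI exI[of _ "add_closure G"]) blast+
qed

lemma euler_continuous_on: "euler F F1 \<Longrightarrow> continuous_on {0<..} F"
  unfolding euler_def
  by (intro continuous_at_imp_continuous_on ballI) (auto intro: has_vector_derivative_continuous)

lemma has_vector_derivative_continuous_halfline: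
  assumes "\<And>r. 0 < r \<Longrightarrow> \<exists>D. (F has_vector_derivative D) (at r)"
  shows "continuous_on {0<..} F"
  using assms by (intro continuous_at_imp_continuous_on ballI) (auto dest: has_vector_derivative_continuous)

text \<open>On t > 0 the functions c t^-m F(t), with F a singular kernel, have derivatives that are
  sums of such functions; choosing one derivative for each sum and iterating gives the sequence
  required by \<open>smooth_on\<close>.\<close>

lemma singular_kernel_smooth:
  assumes "singular_kernel a F"
  shows "smooth_on {0<..} F"
proof -
  define G where "G = (\<lambda>f :: real \<Rightarrow> 'a cblinfun. \<exists>c m F. singular_kernel a F \<and> f = (\<lambda>t. (c * inverse t ^ m) *\<^sub>R F t))"
  have "\<exists>g. add_closure G g \<and> (\<forall>t>0. (f has_vector_derivative g t) (at t))" if "add_closure G f" for f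
    using that
  proof induction
    case (base f)
    then obtain c m F where F: "singular_kernel a F" and f: "f = (\<lambda>t. (c * inverse t ^ m) *\<^sub>R F t)"
      by (auto simp: G_def)
    obtain F1 where F1: "singular_kernel a F1" "euler F F1" using singular_kernelD(4)[OF F] by blast
    define g where "g t = (c * inverse t ^ Suc m) *\<^sub>R F1 t + ((- real m * c) * inverse t ^ Suc m) *\<^sub>R F t" for t
    have "add_closure G g"
    proof -
      have "G (\<lambda>t. (c * inverse t ^ Suc m) *\<^sub>R F1 t)" unfolding G_def using F1 by blast
      moreover have "G (\<lambda>t. ((- real m * c) * inverse t ^ Suc m) *\<^sub>R F t)" unfolding G_def using F by blast
      ultimately show ?thesis unfolding g_def[abs_def] by (intro add_closure.add add_closure.base)
    qed
    moreover have "(f has_vector_derivative g t) (at t)" if t: "t > 0" for t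
    proof -
      have "((\<lambda>t. c * inverse t ^ m) has_field_derivative (- real m * c) * inverse t ^ Suc m) (at t)"
      proof -
        have "((\<lambda>t. inverse t) has_field_derivative - (inverse t ^ Suc (Suc 0))) (at t)"
          using t by (intro DERIV_inverse) simp
        from DERIV_cmult[OF DERIV_power[OF this, of m], of c] show ?thesis
          by (cases m) (simp_all add: algebra_simps)
      qed
      moreover have "(F has_vector_derivative (1 / t) *\<^sub>R F1 t) (at t)"
        using F1(2) t by (simp add: euler_def)
      ultimately have "((\<lambda>t. (c * inverse t ^ m) *\<^sub>R F t) has_vector_derivative
          (c * inverse t ^ m) *\<^sub>R ((1 / t) *\<^sub>R F1 t) + ((- real m * c) * inverse t ^ Suc m) *\<^sub>R F t) (at t)"
        by (rule has_vector_derivative_scaleR)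
      moreover have "(c * inverse t ^ m) *\<^sub>R ((1 / t) *\<^sub>R F1 t) = (c * inverse t ^ Suc m) *\<^sub>R F1 t"
        by (simp add: divide_inverse mult_ac)
      ultimately show ?thesis unfolding f g_def by (simp only:)
    qed
    ultimately show ?case by blast
  next
    case (add f f')
    then obtain g g' where "add_closure G g" "\<forall>t>0. (f has_vector_derivative g t) (at t)"
      "add_closure G g'" "\<forall>t>0. (f' has_vector_derivative g' t) (at t)" by blast
    then show ?case
      by (intro exI[of _ "\<lambda>t. g t + g' t"]) (auto intro: add_closure.add has_vector_derivative_add)
  qed
  then obtain D where D: "\<And>f. add_closure G f \<Longrightarrow> add_closure G (D f)"
    "\<And>f t. add_closure G f \<Longrightarrow> t > 0 \<Longrightarrow> (f has_vector_derivative D f t) (at t)" by metis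
  have "F = (\<lambda>t. (1 * inverse t ^ 0) *\<^sub>R F t)" by simp
  then have "add_closure G F" using assms unfolding G_def by (intro add_closure.base) blast
  then have "add_closure G ((D ^^ k) F)" for k by (induction k) (auto intro: D)
  then show ?thesis
    unfolding smooth_on_def by (intro exI[of _ "\<lambda>k. (D ^^ k) F"]) (auto intro: D)
qed


section \<open>Convolution\<close>

text \<open>A Beta integral, of which only the exponent of r matters. On each half of the interval
  one factor is bounded by its value at r/2, and the other has an explicit integral.\<close>

lemma beta_nn_integral:
  fixes a b :: real
  assumes a: "0 \<le> a" "a < 1" and b: "0 \<le> b" "b < 1"
  shows "\<exists>D\<ge>0. \<forall>r>0. (\<integral>\<^sup>+ q. ennreal (indicator {0<..<r} q * (q powr (- a) * (r - q) powr (- b))) \<partial>lborel)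
    \<le> ennreal (D * r powr (1 - a - b))"
proof -
  have I: "(\<integral>\<^sup>+ q. ennreal (indicator {0..r} q * q powr (- c)) \<partial>lborel) = ennreal (r powr (1 - c) / (1 - c))"
    if "0 < r" "c < 1" for r c :: real
    using nn_integral_has_integral_lebesgue[OF _ has_integral_powr_from_0[of "- c" r]] that by simp
  have bound: "(\<integral>\<^sup>+ q. ennreal (indicator {0<..<r} q * (q powr (- a) * (r - q) powr (- b))) \<partial>lborel)
      \<le> ennreal ((2 powr b / (1 - a) + 2 powr a / (1 - b)) * r powr (1 - a - b))" if r: "r > 0" for r
  proof -
    define A where "A = (r / 2) powr (- a)"
    define B where "B = (r / 2) powr (- b)"
    have "(\<integral>\<^sup>+ q. ennreal (indicator {0<..<r} q * (q powr (- a) * (r - q) powr (- b))) \<partial>lborel)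
        \<le> (\<integral>\<^sup>+ q. ennreal B * ennreal (indicator {0..r} q * q powr (- a))
            + ennreal A * ennreal (indicator {0..r} (r + (- 1) * q) * (r + (- 1) * q) powr (- b)) \<partial>lborel)"
    proof (rule nn_integral_mono)
      fix q
      show "ennreal (indicator {0<..<r} q * (q powr (- a) * (r - q) powr (- b)))
          \<le> ennreal B * ennreal (indicator {0..r} q * q powr (- a))
            + ennreal A * ennreal (indicator {0..r} (r + (- 1) * q) * (r + (- 1) * q) powr (- b))"
      proof (cases "0 < q \<and> q < r")
        case True
        have "q powr (- a) * (r - q) powr (- b) \<le> B * q powr (- a) + A * (r - q) powr (- b)"
        proof (cases "q \<le> r / 2")
          case True': True
          have "(r - q) powr (- b) \<le> B"
            unfolding B_def using True' True b by (intro powr_mono2') auto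
          then have "q powr (- a) * (r - q) powr (- b) \<le> q powr (- a) * B" by (intro mult_left_mono) auto
          moreover have "0 \<le> A * (r - q) powr (- b)" by (simp add: A_def)
          ultimately show ?thesis by (simp add: mult.commute)
        next
          case False
          have "q powr (- a) \<le> A"
            unfolding A_def using False True a r by (intro powr_mono2') auto
          then have "q powr (- a) * (r - q) powr (- b) \<le> A * (r - q) powr (- b)" by (intro mult_right_mono) auto
          moreover have "0 \<le> B * q powr (- a)" by (simp add: B_def)
          ultimately show ?thesis by simp
        qed
        then show ?thesis
          using True by (simp add: A_def B_def ennreal_leI flip: ennreal_mult ennreal_plus)
      next
        case False
        then have "indicator {0<..<r} q = (0 :: real)" by (auto simp: indicator_def)
        then show ?thesis by simp
      qed
    qed
    also have "\<dots> = ennreal B * (\<integral>\<^sup>+ q. ennreal (indicator {0..r} q * q powr (- a)) \<partial>lborel)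
        + ennreal A * (\<integral>\<^sup>+ q. ennreal (indicator {0..r} (r + (- 1) * q) * (r + (- 1) * q) powr (- b)) \<partial>lborel)"
      by (subst nn_integral_add) (auto simp: nn_integral_cmult)
    also have "(\<integral>\<^sup>+ q. ennreal (indicator {0..r} (r + (- 1) * q) * (r + (- 1) * q) powr (- b)) \<partial>lborel)
        = (\<integral>\<^sup>+ q. ennreal (indicator {0..r} q * q powr (- b)) \<partial>lborel)"
      using nn_integral_real_affine[of "\<lambda>q. ennreal (indicator {0..r} q * q powr (- b))" "- 1" r] by simp
    also have "ennreal B * (\<integral>\<^sup>+ q. ennreal (indicator {0..r} q * q powr (- a)) \<partial>lborel)
        + ennreal A * (\<integral>\<^sup>+ q. ennreal (indicator {0..r} q * q powr (- b)) \<partial>lborel)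
        = ennreal (B * (r powr (1 - a) / (1 - a)) + A * (r powr (1 - b) / (1 - b)))"
      using a b r by (simp add: I A_def B_def flip: ennreal_mult ennreal_plus)
    also have "B * (r powr (1 - a) / (1 - a)) + A * (r powr (1 - b) / (1 - b))
        = (2 powr b / (1 - a) + 2 powr a / (1 - b)) * r powr (1 - a - b)"
    proof -
      have "B = 2 powr b * r powr (- b)" "A = 2 powr a * r powr (- a)"
        using r by (simp_all add: A_def B_def powr_divide powr_minus divide_simps)
      moreover have "r powr (- b) * r powr (1 - a) = r powr (1 - a - b)"
        "r powr (- a) * r powr (1 - b) = r powr (1 - a - b)"
        by (simp_all add: powr_add[symmetric] algebra_simps)
      ultimately show ?thesis by (simp add: distrib_right) (simp add: mult.assoc)
    qed
    finally show ?thesis .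
  qed
  have "0 \<le> 2 powr b / (1 - a) + 2 powr a / (1 - b)" using a b by simp
  then show ?thesis using bound by blast
qed

definition conv :: "(real \<Rightarrow> 'a::chilbert_space cblinfun) \<Rightarrow> (real \<Rightarrow> 'a cblinfun) \<Rightarrow> real \<Rightarrow> 'a cblinfun" where
  "conv F G r = bochner lborel (\<lambda>q. F q * G (r - q))"

lemma strong_measurable_lborel: "strong_measurable borel F \<Longrightarrow> h \<in> borel_measurable M \<Longrightarrow> strong_measurable M (\<lambda>x. F (h x))"
  by (rule strong_measurable_compose)

lemma strong_measurable_mult:
  fixes f g :: "'b \<Rightarrow> 'a::chilbert_space cblinfun"
  shows "strong_measurable M f \<Longrightarrow> strong_measurable M g \<Longrightarrow> strong_measurable M (\<lambda>x. f x * g x)"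
  by (rule strong_measurable_bilinear[OF _ _ bounded_bilinear_mult])

text \<open>Stated for scalar functions because it serves twice: for norms of convolution factors
  and, in \<open>word_nn_bound\<close>, for bounds of inner iterated integrals.\<close>

lemma conv_nn_bound:
  fixes f g :: "real \<Rightarrow> real"
  assumes a: "0 \<le> a" "a < 1" and b: "0 \<le> b" "b < 1" and C: "0 \<le> C" "0 \<le> C'"
    and f: "\<And>q. q \<le> 0 \<Longrightarrow> f q = 0" "\<And>q. 0 < q \<Longrightarrow> q \<le> T \<Longrightarrow> \<bar>f q\<bar> \<le> C * q powr (- a)"
    and g: "\<And>q. q \<le> 0 \<Longrightarrow> g q = 0" "\<And>q. 0 < q \<Longrightarrow> q \<le> T \<Longrightarrow> \<bar>g q\<bar> \<le> C' * q powr (- b)"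
    and D: "\<forall>r>0. (\<integral>\<^sup>+ q. ennreal (indicator {0<..<r} q * (q powr (- a) * (r - q) powr (- b))) \<partial>lborel)
      \<le> ennreal (D * r powr (1 - a - b))"
    and r: "0 < r" "r \<le> T"
  shows "(\<integral>\<^sup>+ q. ennreal \<bar>f q * g (r - q)\<bar> \<partial>lborel) \<le> ennreal (C * C' * D * r powr (1 - a - b))"
proof -
  have "(\<integral>\<^sup>+ q. ennreal \<bar>f q * g (r - q)\<bar> \<partial>lborel)
      \<le> (\<integral>\<^sup>+ q. ennreal (C * C') * ennreal (indicator {0<..<r} q * (q powr (- a) * (r - q) powr (- b))) \<partial>lborel)"
  proof (rule nn_integral_mono)
    fix q
    show "ennreal \<bar>f q * g (r - q)\<bar>
        \<le> ennreal (C * C') * ennreal (indicator {0<..<r} q * (q powr (- a) * (r - q) powr (- b)))"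
    proof (cases "0 < q \<and> q < r")
      case True
      then have "\<bar>f q\<bar> * \<bar>g (r - q)\<bar> \<le> (C * q powr (- a)) * (C' * (r - q) powr (- b))"
        using r C by (intro mult_mono f g) auto
      then show ?thesis
        using True C by (simp add: abs_mult ennreal_leI mult_ac flip: ennreal_mult)
    next
      case False
      then have "f q = 0 \<or> g (r - q) = 0" using f(1)[of q] g(1)[of "r - q"] by linarith
      then show ?thesis by auto
    qed
  qed
  also have "\<dots> = ennreal (C * C') * (\<integral>\<^sup>+ q. ennreal (indicator {0<..<r} q * (q powr (- a) * (r - q) powr (- b))) \<partial>lborel)"
    by (rule nn_integral_cmult) measurable
  also have "\<dots> \<le> ennreal (C * C') * ennreal (D * r powr (1 - a - b))"
    using D r by (intro mult_left_mono) auto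
  also have "\<dots> = ennreal (C * C' * D * r powr (1 - a - b))"
    using C by (simp add: mult.assoc flip: ennreal_mult')
  finally show ?thesis .
qed

lemma conv_norm_bound:
  assumes F: "bounded_kernel a F" and G: "bounded_kernel b G"
    and a: "0 \<le> a" "a < 1" and b: "0 \<le> b" "b < 1" and T: "T > 0"
  shows "\<exists>C\<ge>0. \<forall>r. 0 < r \<and> r \<le> T \<longrightarrow>
    (\<integral>\<^sup>+ q. ennreal (norm (F q * G (r - q))) \<partial>lborel) \<le> ennreal (C * r powr (1 - a - b))"
proof -
  obtain C C' where C: "0 \<le> C" "\<forall>r. 0 < r \<and> r \<le> T \<longrightarrow> norm (F r) \<le> C * r powr (- a)"
    "0 \<le> C'" "\<forall>r. 0 < r \<and> r \<le> T \<longrightarrow> norm (G r) \<le> C' * r powr (- b)"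
    using bounded_kernelD(3)[OF F T] bounded_kernelD(3)[OF G T] by blast
  obtain D where D: "D \<ge> 0" "\<forall>r>0. (\<integral>\<^sup>+ q. ennreal (indicator {0<..<r} q * (q powr (- a) * (r - q) powr (- b))) \<partial>lborel)
      \<le> ennreal (D * r powr (1 - a - b))" using beta_nn_integral[OF a b] by blast
  have "(\<integral>\<^sup>+ q. ennreal (norm (F q * G (r - q))) \<partial>lborel) \<le> ennreal (C * C' * D * r powr (1 - a - b))"
    if r: "0 < r" "r \<le> T" for r
  proof -
    have "(\<integral>\<^sup>+ q. ennreal (norm (F q * G (r - q))) \<partial>lborel)
        \<le> (\<integral>\<^sup>+ q. ennreal \<bar>norm (F q) * norm (G (r - q))\<bar> \<partial>lborel)"
      by (intro nn_integral_mono ennreal_leI) (simp add: norm_mult_ineq)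
    also have "\<dots> \<le> ennreal (C * C' * D * r powr (1 - a - b))"
      using C bounded_kernelD(2)[OF F] bounded_kernelD(2)[OF G] r
      by (intro conv_nn_bound[OF a b C(1,3) _ _ _ _ D(2), where T = T]) auto
    finally show ?thesis .
  qed
  then show ?thesis using C D by (intro exI[of _ "C * C' * D"]) auto
qed

lemma conv_integrable:
  assumes F: "bounded_kernel a F" and G: "bounded_kernel b G"
    and a: "0 \<le> a" "a < 1" and b: "0 \<le> b" "b < 1"
  shows "bochner_integrable lborel (\<lambda>q. F q * G (r - q))"
  unfolding bochner_integrable_def
proof
  show "strong_measurable lborel (\<lambda>q. F q * G (r - q))"
    by (intro strong_measurable_mult strong_measurable_lborel[OF bounded_kernelD(1)[OF F], of "\<lambda>q. q"]
        strong_measurable_lborel[OF bounded_kernelD(1)[OF G]]) measurable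
  show "(\<integral>\<^sup>+ q. ennreal (norm (F q * G (r - q))) \<partial>lborel) < \<infinity>"
  proof (cases "r > 0")
    case True
    then obtain C where "(\<integral>\<^sup>+ q. ennreal (norm (F q * G (r - q))) \<partial>lborel) \<le> ennreal (C * r powr (1 - a - b))"
      using conv_norm_bound[OF F G a b True] by blast
    also have "\<dots> < \<infinity>" by simp
    finally show ?thesis .
  next
    case False
    then have "F q * G (r - q) = 0" for q
      using bounded_kernelD(2)[OF F, of q] bounded_kernelD(2)[OF G, of "r - q"] by (cases "q \<le> 0") auto
    then show ?thesis by simp
  qed
qed

lemma conv_bound:
  assumes F: "bounded_kernel a F" and G: "bounded_kernel b G"
    and a: "0 \<le> a" "a < 1" and b: "0 \<le> b" "b < 1" and T: "T > 0"
  shows "\<exists>C\<ge>0. \<forall>r. 0 < r \<and> r \<le> T \<longrightarrow> norm (conv F G r) \<le> C * r powr (1 - a - b)"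
  using conv_norm_bound[OF F G a b T] norm_bochner_le[OF conv_integrable[OF F G a b]]
  unfolding conv_def by (meson mult_nonneg_nonneg powr_ge_zero)

lemma bochner_zero: "bochner M (\<lambda>_. 0) = (0 :: 'a::chilbert_space cblinfun)"
  by (rule bochner_eqI) (auto simp: bochner_integrable_def entry_def intro!: strong_measurable_simple)

lemma conv_nonpos:
  assumes F: "bounded_kernel a F" and G: "bounded_kernel b G" and r: "r \<le> 0"
  shows "conv F G r = 0"
proof -
  have "F q * G (r - q) = 0" for q
    using bounded_kernelD(2)[OF F, of q] bounded_kernelD(2)[OF G, of "r - q"] r by (cases "q \<le> 0") auto
  then show ?thesis by (simp add: conv_def bochner_zero)
qed

lemma bochner_scaled:
  fixes f :: "real \<Rightarrow> 'a::chilbert_space cblinfun"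
  assumes f: "bochner_integrable lborel f" and sm: "strong_measurable borel f" and r: "r > 0"
  shows "bochner_integrable lborel (\<lambda>x. f (r * x))"
    and "bochner lborel (\<lambda>x. f (r * x)) = (1 / r) *\<^sub>R bochner lborel f"
proof -
  have n: "(\<lambda>x. ennreal (norm (f x))) \<in> borel_measurable borel"
    using strong_measurable_norm[OF sm] by measurable
  have "(\<integral>\<^sup>+ x. ennreal (norm (f x)) \<partial>lborel) = ennreal r * (\<integral>\<^sup>+ x. ennreal (norm (f (r * x))) \<partial>lborel)"
    using nn_integral_real_affine[OF n, of r 0] r by simp
  then have "(\<integral>\<^sup>+ x. ennreal (norm (f (r * x))) \<partial>lborel) < \<infinity>"
    using f r by (auto simp: bochner_integrable_def ennreal_mult_less_top)
  then show i: "bochner_integrable lborel (\<lambda>x. f (r * x))"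
    unfolding bochner_integrable_def by (auto intro!: strong_measurable_lborel[OF sm])
  show "bochner lborel (\<lambda>x. f (r * x)) = (1 / r) *\<^sub>R bochner lborel f"
  proof (rule bochner_eqI[OF i])
    show "has_bochner_integral lborel (\<lambda>x. entry z v (f (r * x))) (entry z v ((1 / r) *\<^sub>R bochner lborel f))" for z v
      using lborel_has_bochner_integral_real_affine_iff[of r "\<lambda>x. entry z v (f x)" "entry z v (bochner lborel f)" 0]
        bochner_integral_entry[OF f, of z v] r
      by (simp add: entry_simps divide_inverse_commute)
  qed
qed

text \<open>The mean value inequality, first for \<open>f'\<close> and then for \<open>f\<close>
  minus its linear part. The explicit constant \<open>M\<close> lets the estimate be integrated in a
  parameter.\<close>

lemma quadratic_remainder:
  fixes f :: "real \<Rightarrow> 'b::real_normed_vector"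
  assumes f1: "\<And>x. x \<in> {\<alpha>..\<beta>} \<Longrightarrow> (f has_vector_derivative f' x) (at x)"
    and f2: "\<And>x. x \<in> {\<alpha>..\<beta>} \<Longrightarrow> (f' has_vector_derivative f'' x) (at x)"
    and M: "\<And>x. x \<in> {\<alpha>..\<beta>} \<Longrightarrow> norm (f'' x) \<le> M"
    and p: "p \<in> {\<alpha>..\<beta>}" "p + h \<in> {\<alpha>..\<beta>}"
  shows "norm (f (p + h) - f p - h *\<^sub>R f' p) \<le> M * h\<^sup>2"
proof -
  have M0: "M \<ge> 0" using M[OF p(1)] norm_ge_zero order_trans by blast
  let ?S = "closed_segment p (p + h)"
  have S: "?S \<subseteq> {\<alpha>..\<beta>}" using p by (auto simp: closed_segment_eq_real_ivl)
  have 1: "norm (f' x - f' p) \<le> M * \<bar>h\<bar>" if x: "x \<in> ?S" for x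
  proof -
    have "norm (f' x - f' p) \<le> M * norm (x - p)"
    proof (rule differentiable_bound[where S = ?S and f' = "\<lambda>x h. h *\<^sub>R f'' x"])
      show "(f' has_derivative (\<lambda>h. h *\<^sub>R f'' y)) (at y within ?S)" if "y \<in> ?S" for y
        using f2[of y] S that has_derivative_at_withinI unfolding has_vector_derivative_def by blast
      show "onorm (\<lambda>h. h *\<^sub>R f'' y) \<le> M" if "y \<in> ?S" for y
        using M[of y] S that M0 by (intro onorm_bound) (auto simp: mult.commute[of M] intro!: mult_left_mono)
    qed (use x in auto)
    also have "\<dots> \<le> M * \<bar>h\<bar>"
      using x M0 by (intro mult_left_mono) (auto simp: closed_segment_eq_real_ivl split: if_splits)
    finally show ?thesis .
  qed
  have "norm ((f (p + h) - (p + h) *\<^sub>R f' p) - (f p - p *\<^sub>R f' p)) \<le> (M * \<bar>h\<bar>) * norm ((p + h) - p)"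
  proof (rule differentiable_bound[where S = ?S and f = "\<lambda>x. f x - x *\<^sub>R f' p" and f' = "\<lambda>x h. h *\<^sub>R (f' x - f' p)"])
    show "((\<lambda>x. f x - x *\<^sub>R f' p) has_derivative (\<lambda>h. h *\<^sub>R (f' y - f' p))) (at y within ?S)" if "y \<in> ?S" for y
    proof -
      have "((\<lambda>x. f x - x *\<^sub>R f' p) has_vector_derivative (f' y - f' p)) (at y)"
        using f1[of y] S that by (auto intro!: derivative_eq_intros)
      then show ?thesis using has_derivative_at_withinI unfolding has_vector_derivative_def by blast
    qed
    show "onorm (\<lambda>h. h *\<^sub>R (f' y - f' p)) \<le> M * \<bar>h\<bar>" if "y \<in> ?S" for y
      using 1[OF that] M0 by (intro onorm_bound) (auto simp: mult.commute[of "M * _"] intro!: mult_left_mono)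
  qed auto
  then show ?thesis by (simp add: algebra_simps power2_eq_square abs_mult_self_eq)
qed

lemma euler_scaled:
  assumes "euler F F1" "0 < \<sigma>" "0 < r"
  shows "((\<lambda>r. F (r * \<sigma>)) has_vector_derivative (1 / r) *\<^sub>R F1 (r * \<sigma>)) (at r)"
proof -
  have "((\<lambda>r. r * \<sigma>) has_vector_derivative \<sigma>) (at r)" by (auto intro!: derivative_eq_intros)
  moreover have "(F has_vector_derivative (1 / (r * \<sigma>)) *\<^sub>R F1 (r * \<sigma>)) (at (r * \<sigma>))"
    using assms by (simp add: euler_def)
  ultimately have "((F \<circ> (\<lambda>r. r * \<sigma>)) has_vector_derivative \<sigma> *\<^sub>R ((1 / (r * \<sigma>)) *\<^sub>R F1 (r * \<sigma>))) (at r)"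
    by (rule vector_diff_chain_at)
  then show ?thesis using assms by (simp add: o_def)
qed

text \<open>Differentiation under the integral sign in \<open>conv F G r = r \<integral> F (r \<sigma>) G (r (1 - \<sigma>)) d\<sigma>\<close>.\<close>

lemma conv_euler:
  assumes F: "singular_kernel a F" and G: "singular_kernel b G" and F1: "singular_kernel a F1" "euler F F1" and G1: "singular_kernel b G1" "euler G G1"
  shows "euler (conv F G) (\<lambda>r. conv F G r + (conv F1 G r + conv F G1 r))"
proof -
  \<comment> \<open>Second Euler derivatives serve only to bound the second derivative of the
    integrand, and thereby the quadratic remainder.\<close>
  obtain F2 G2 where F2: "singular_kernel a F2" "euler F1 F2" and G2: "singular_kernel b G2" "euler G1 G2"
    using singular_kernelD(4)[OF F1(1)] singular_kernelD(4)[OF G1(1)] by blast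
  have a: "0 \<le> a" "a < 1" and b: "0 \<le> b" "b < 1" using singular_kernelD[OF F] singular_kernelD[OF G] by auto
  note bk = singular_kernelD(1)[OF F] singular_kernelD(1)[OF G] singular_kernelD(1)[OF F1(1)] singular_kernelD(1)[OF G1(1)]
    singular_kernelD(1)[OF F2(1)] singular_kernelD(1)[OF G2(1)]
  define X where "X f g r \<sigma> = f (r * \<sigma>) * g (r - r * \<sigma>)" for f g :: "real \<Rightarrow> 'a cblinfun" and r \<sigma> :: real
  define D where "D f g r = bochner lborel (X f g r)" for f g r
  have X: "bochner_integrable lborel (X f g r)" "conv f g r = r *\<^sub>R D f g r"
    if fg: "bounded_kernel a f" "bounded_kernel b g" and r: "r > 0" for f g r
  proof -
    have sm: "strong_measurable borel (\<lambda>q. f q * g (r - q))"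
      by (intro strong_measurable_mult strong_measurable_lborel[OF bounded_kernelD(1)[OF fg(1)], of "\<lambda>q. q"]
          strong_measurable_lborel[OF bounded_kernelD(1)[OF fg(2)]]) measurable
    show "bochner_integrable lborel (X f g r)"
      using bochner_scaled(1)[OF conv_integrable[OF fg a b] sm r] by (simp add: X_def[abs_def])
    show "conv f g r = r *\<^sub>R D f g r"
      using bochner_scaled(2)[OF conv_integrable[OF fg a b] sm r] r by (simp add: X_def[abs_def] D_def conv_def)
  qed
  have vanish: "X f g r \<sigma> = 0"
    if fg: "bounded_kernel a f" "bounded_kernel b g" and r: "r > 0" and \<sigma>: "\<not> (0 < \<sigma> \<and> \<sigma> < 1)" for f g r \<sigma>
  proof (cases "\<sigma> \<le> 0")
    case True
    then show ?thesis using bounded_kernelD(2)[OF fg(1), of "r * \<sigma>"] r by (simp add: X_def mult_nonneg_nonpos)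
  next
    case False
    then have "r * 1 \<le> r * \<sigma>" using \<sigma> r by (intro mult_left_mono) auto
    then show ?thesis using bounded_kernelD(2)[OF fg(2), of "r - r * \<sigma>"] by (simp add: X_def)
  qed
  obtain B where B: "B \<ge> 0" "\<forall>r>0. (\<integral>\<^sup>+ q. ennreal (indicator {0<..<r} q * (q powr (- a) * (r - q) powr (- b))) \<partial>lborel)
      \<le> ennreal (B * r powr (1 - a - b))" using beta_nn_integral[OF a b] by blast
  \<comment> \<open>An integrable majorant, up to constants, for the integrands of all pairs of
    kernels of orders \<open>a\<close> and \<open>b\<close>, uniform for r between \<rho>/2 and 2
    \<rho>.\<close>
  define w where "w \<sigma> = indicator {0<..<1} \<sigma> * (\<sigma> powr (- a) * (1 - \<sigma>) powr (- b))" for \<sigma> :: real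
  have w: "(\<integral>\<^sup>+ \<sigma>. ennreal (w \<sigma>) \<partial>lborel) \<le> ennreal B" "0 \<le> w \<sigma>" for \<sigma>
    using B(2)[rule_format, of 1] by (simp_all add: w_def)
  have [measurable]: "w \<in> borel_measurable borel" unfolding w_def[abs_def] by measurable
  have Xbound: "\<exists>K\<ge>0. \<forall>r \<sigma>. \<rho> / 2 \<le> r \<longrightarrow> r \<le> 2 * \<rho> \<longrightarrow> norm (X f g r \<sigma>) \<le> K * w \<sigma>"
    if fg: "bounded_kernel a f" "bounded_kernel b g" and \<rho>: "\<rho> > 0" for f g \<rho>
  proof -
    have "2 * \<rho> > 0" using \<rho> by simp
    then obtain C C' where C: "0 \<le> C" "\<forall>r. 0 < r \<and> r \<le> 2 * \<rho> \<longrightarrow> norm (f r) \<le> C * r powr (- a)"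
      "0 \<le> C'" "\<forall>r. 0 < r \<and> r \<le> 2 * \<rho> \<longrightarrow> norm (g r) \<le> C' * r powr (- b)"
      using bounded_kernelD(3)[OF fg(1)] bounded_kernelD(3)[OF fg(2)] by blast
    define K where "K = C * (\<rho> / 2) powr (- a) * (C' * (\<rho> / 2) powr (- b))"
    have "norm (X f g r \<sigma>) \<le> K * w \<sigma>" if r: "\<rho> / 2 \<le> r" "r \<le> 2 * \<rho>" for r \<sigma>
    proof (cases "0 < \<sigma> \<and> \<sigma> < 1")
      case True
      have r0: "r > 0" using r \<rho> by linarith
      have *: "norm (h (r * s)) \<le> E * (\<rho> / 2) powr (- c) * s powr (- c)"
        if h: "\<forall>r. 0 < r \<and> r \<le> 2 * \<rho> \<longrightarrow> norm (h r) \<le> E * r powr (- c)" and s: "0 < s" "s < 1"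
          and E: "E \<ge> 0" and c: "0 \<le> c" for h :: "real \<Rightarrow> 'a cblinfun" and E c s
      proof -
        have "r * s \<le> r * 1" using s r0 by (intro mult_left_mono) auto
        then have "0 < r * s" "r * s \<le> 2 * \<rho>" using s r0 r by (simp, linarith)
        then have "norm (h (r * s)) \<le> E * (r * s) powr (- c)" using h by blast
        also have "\<dots> = E * r powr (- c) * s powr (- c)" using r0 s by (simp add: powr_mult)
        also have "\<dots> \<le> E * (\<rho> / 2) powr (- c) * s powr (- c)"
          using r \<rho> c E by (intro mult_right_mono mult_left_mono powr_mono2') auto
        finally show ?thesis .
      qed
      have "norm (X f g r \<sigma>) \<le> norm (f (r * \<sigma>)) * norm (g (r * (1 - \<sigma>)))"
        unfolding X_def right_diff_distrib mult_1_right by (rule norm_mult_ineq)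
      also have "\<dots> \<le> (C * (\<rho> / 2) powr (- a) * \<sigma> powr (- a)) * (C' * (\<rho> / 2) powr (- b) * (1 - \<sigma>) powr (- b))"
        using True C a b by (intro mult_mono * C) auto
      also have "\<dots> = K * w \<sigma>" using True by (simp add: K_def w_def)
      finally show ?thesis .
    next
      case False
      have "r > 0" using r \<rho> by linarith
      then show ?thesis using vanish[OF fg _ False] False by (simp add: w_def)
    qed
    moreover have "K \<ge> 0" using C by (simp add: K_def)
    ultimately show ?thesis by blast
  qed
  have Xderiv: "((\<lambda>r. X f g r \<sigma>) has_vector_derivative (1 / r) *\<^sub>R (X f g1 r \<sigma> + X f1 g r \<sigma>)) (at r)"
    if fg: "bounded_kernel a f" "bounded_kernel b g" "bounded_kernel a f1" "bounded_kernel b g1"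
      and e: "euler f f1" "euler g g1" and r: "r > 0" for f g f1 g1 r \<sigma>
  proof (cases "0 < \<sigma> \<and> \<sigma> < 1")
    case True
    have "((\<lambda>r. f (r * \<sigma>) * g (r * (1 - \<sigma>))) has_vector_derivative
        f (r * \<sigma>) * ((1 / r) *\<^sub>R g1 (r * (1 - \<sigma>))) + (1 / r) *\<^sub>R f1 (r * \<sigma>) * g (r * (1 - \<sigma>))) (at r)"
      using True r by (intro has_vector_derivative_mult euler_scaled e) auto
    then show ?thesis by (simp add: X_def right_diff_distrib scaleR_add_right)
  next
    case False
    have "((\<lambda>r. X f g r \<sigma>) has_vector_derivative 0) (at r)"
      by (rule has_vector_derivative_transform_within_open[of "\<lambda>_. 0" _ _ "{0<..}"])
        (use r vanish[OF fg(1,2) _ False] in auto)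
    then show ?thesis using vanish[OF fg(1,4) r False] vanish[OF fg(3,2) r False] by simp
  qed
  have Dderiv: "(D F G has_vector_derivative (1 / \<rho>) *\<^sub>R (D F G1 \<rho> + D F1 G \<rho>)) (at \<rho>)" if \<rho>: "\<rho> > 0" for \<rho>
  proof -
    obtain K1 where K1: "K1 \<ge> 0" "\<And>r \<sigma>. \<rho> / 2 \<le> r \<Longrightarrow> r \<le> 2 * \<rho> \<Longrightarrow> norm (X F G1 r \<sigma>) \<le> K1 * w \<sigma>"
      using Xbound[OF bk(1) bk(4) \<rho>] by blast
    obtain K2 where K2: "K2 \<ge> 0" "\<And>r \<sigma>. \<rho> / 2 \<le> r \<Longrightarrow> r \<le> 2 * \<rho> \<Longrightarrow> norm (X F1 G r \<sigma>) \<le> K2 * w \<sigma>"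
      using Xbound[OF bk(3) bk(2) \<rho>] by blast
    obtain K3 where K3: "K3 \<ge> 0" "\<And>r \<sigma>. \<rho> / 2 \<le> r \<Longrightarrow> r \<le> 2 * \<rho> \<Longrightarrow> norm (X F G2 r \<sigma>) \<le> K3 * w \<sigma>"
      using Xbound[OF bk(1) bk(6) \<rho>] by blast
    obtain K4 where K4: "K4 \<ge> 0" "\<And>r \<sigma>. \<rho> / 2 \<le> r \<Longrightarrow> r \<le> 2 * \<rho> \<Longrightarrow> norm (X F1 G1 r \<sigma>) \<le> K4 * w \<sigma>"
      using Xbound[OF bk(3) bk(4) \<rho>] by blast
    obtain K5 where K5: "K5 \<ge> 0" "\<And>r \<sigma>. \<rho> / 2 \<le> r \<Longrightarrow> r \<le> 2 * \<rho> \<Longrightarrow> norm (X F2 G r \<sigma>) \<le> K5 * w \<sigma>"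
      using Xbound[OF bk(5) bk(2) \<rho>] by blast
    note K = K1 K2 K3 K4 K5
    \<comment> \<open>\<open>K1\<close> and \<open>K2\<close> come from differentiating 1/r, the
      others from differentiating the products again; the mixed product of \<open>F1\<close> and
      \<open>G1\<close> arises twice. The square is the bound 1/r \<le> 2/\<rho> used twice.\<close>
    define K where "K = (2 / \<rho>)\<^sup>2 * (K1 + K2 + (K3 + K4 + (K4 + K5)))"
    have K0: "K \<ge> 0" unfolding K_def using K(1,3,5,7,9) by simp
    define \<phi>1 where "\<phi>1 \<sigma> r = (1 / r) *\<^sub>R (X F G1 r \<sigma> + X F1 G r \<sigma>)" for \<sigma> r
    define \<phi>2 where "\<phi>2 \<sigma> r = (1 / r) *\<^sub>R ((1 / r) *\<^sub>R (X F G2 r \<sigma> + X F1 G1 r \<sigma>) + (1 / r) *\<^sub>R (X F1 G1 r \<sigma> + X F2 G r \<sigma>))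
        + (- 1 / r\<^sup>2) *\<^sub>R (X F G1 r \<sigma> + X F1 G r \<sigma>)" for \<sigma> r
    have rem: "norm (X F G (\<rho> + h) \<sigma> - X F G \<rho> \<sigma> - h *\<^sub>R \<phi>1 \<sigma> \<rho>) \<le> (K * w \<sigma>) * h\<^sup>2" if h: "\<bar>h\<bar> < \<rho> / 2" for h \<sigma>
    proof (rule quadratic_remainder[where \<alpha> = "\<rho> / 2" and \<beta> = "2 * \<rho>" and f' = "\<phi>1 \<sigma>" and f'' = "\<phi>2 \<sigma>"])
      fix r assume "r \<in> {\<rho> / 2..2 * \<rho>}"
      then have r: "\<rho> / 2 \<le> r" "r \<le> 2 * \<rho>" "r > 0" using \<rho> by auto
      show "((\<lambda>r. X F G r \<sigma>) has_vector_derivative \<phi>1 \<sigma> r) (at r)"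
        unfolding \<phi>1_def by (rule Xderiv[OF bk(1,2,3,4) F1(2) G1(2) r(3)])
      have "((\<lambda>r. 1 / r) has_field_derivative - 1 / r\<^sup>2) (at r)"
        using r by (auto intro!: derivative_eq_intros simp: power2_eq_square)
      moreover have "((\<lambda>r. X F G1 r \<sigma> + X F1 G r \<sigma>) has_vector_derivative
          (1 / r) *\<^sub>R (X F G2 r \<sigma> + X F1 G1 r \<sigma>) + (1 / r) *\<^sub>R (X F1 G1 r \<sigma> + X F2 G r \<sigma>)) (at r)"
        by (intro has_vector_derivative_add Xderiv bk F1 G1 F2 G2 r)
      ultimately show "(\<phi>1 \<sigma> has_vector_derivative \<phi>2 \<sigma> r) (at r)"
        unfolding \<phi>1_def[abs_def] \<phi>2_def by (rule has_vector_derivative_scaleR)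
      show "norm (\<phi>2 \<sigma> r) \<le> K * w \<sigma>"
      proof -
        have i: "1 / r \<le> 2 / \<rho>" using r \<rho> by (simp add: field_simps)
        have "norm (\<phi>2 \<sigma> r) \<le> (1 / r) * ((1 / r) * (K3 * w \<sigma> + K4 * w \<sigma>) + (1 / r) * (K4 * w \<sigma> + K5 * w \<sigma>))
            + (1 / r)\<^sup>2 * (K1 * w \<sigma> + K2 * w \<sigma>)"
          unfolding \<phi>2_def
        proof (intro norm_triangle_le add_mono)
          show "norm ((- 1 / r\<^sup>2) *\<^sub>R (X F G1 r \<sigma> + X F1 G r \<sigma>)) \<le> (1 / r)\<^sup>2 * (K1 * w \<sigma> + K2 * w \<sigma>)"
            unfolding norm_scaleR using r
            by (intro mult_mono norm_triangle_le add_mono K r) (auto simp: power_divide)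
          show "norm ((1 / r) *\<^sub>R ((1 / r) *\<^sub>R (X F G2 r \<sigma> + X F1 G1 r \<sigma>) + (1 / r) *\<^sub>R (X F1 G1 r \<sigma> + X F2 G r \<sigma>)))
              \<le> (1 / r) * ((1 / r) * (K3 * w \<sigma> + K4 * w \<sigma>) + (1 / r) * (K4 * w \<sigma> + K5 * w \<sigma>))"
            unfolding norm_scaleR using r
            by (intro mult_mono norm_triangle_le add_mono order_trans[OF eq_refl[OF norm_scaleR]] K r) auto
        qed
        also have "\<dots> = (1 / r)\<^sup>2 * ((K1 + K2 + (K3 + K4 + (K4 + K5))) * w \<sigma>)"
          by (simp add: power2_eq_square algebra_simps)
        also have "\<dots> \<le> (2 / \<rho>)\<^sup>2 * ((K1 + K2 + (K3 + K4 + (K4 + K5))) * w \<sigma>)"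
          using i r K(1,3,5,7,9) w(2)[of \<sigma>] by (intro mult_right_mono power_mono) auto
        finally show ?thesis by (simp add: K_def mult.assoc)
      qed
    qed (use h \<rho> in auto)
    show ?thesis
    proof (rule has_vector_derivative_quadratic[of "\<rho> / 2" _ _ _ "K * B"])
      fix h :: real assume h: "\<bar>h\<bar> < \<rho> / 2"
      have \<rho>h: "\<rho> + h > 0" using h \<rho> by linarith
      let ?f = "\<lambda>\<sigma>. X F G (\<rho> + h) \<sigma> - X F G \<rho> \<sigma> - h *\<^sub>R \<phi>1 \<sigma> \<rho>"
      have i1: "bochner_integrable lborel (\<lambda>\<sigma>. X F G1 \<rho> \<sigma> + X F1 G \<rho> \<sigma>)"
        by (intro bochner_integrable_add X bk \<rho>)
      have i2: "bochner_integrable lborel (\<lambda>\<sigma>. \<phi>1 \<sigma> \<rho>)"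
        unfolding \<phi>1_def by (rule bochner_integrable_scaleR[OF i1])
      have i3: "bochner_integrable lborel (\<lambda>\<sigma>. X F G (\<rho> + h) \<sigma> - X F G \<rho> \<sigma>)"
        by (intro bochner_integrable_diff X bk \<rho> \<rho>h)
      have i4: "bochner_integrable lborel ?f"
        by (intro bochner_integrable_diff[OF i3] bochner_integrable_scaleR i2)
      have "bochner lborel ?f = bochner lborel (\<lambda>\<sigma>. X F G (\<rho> + h) \<sigma> - X F G \<rho> \<sigma>) - bochner lborel (\<lambda>\<sigma>. h *\<^sub>R \<phi>1 \<sigma> \<rho>)"
        by (intro bochner_diff i3 bochner_integrable_scaleR i2)
      also have "bochner lborel (\<lambda>\<sigma>. X F G (\<rho> + h) \<sigma> - X F G \<rho> \<sigma>) = D F G (\<rho> + h) - D F G \<rho>"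
        unfolding D_def by (intro bochner_diff X bk \<rho> \<rho>h)
      also have "bochner lborel (\<lambda>\<sigma>. h *\<^sub>R \<phi>1 \<sigma> \<rho>) = h *\<^sub>R bochner lborel (\<lambda>\<sigma>. \<phi>1 \<sigma> \<rho>)"
        by (rule bochner_scaleR[OF i2])
      also have "bochner lborel (\<lambda>\<sigma>. \<phi>1 \<sigma> \<rho>) = (1 / \<rho>) *\<^sub>R bochner lborel (\<lambda>\<sigma>. X F G1 \<rho> \<sigma> + X F1 G \<rho> \<sigma>)"
        unfolding \<phi>1_def by (rule bochner_scaleR[OF i1])
      also have "bochner lborel (\<lambda>\<sigma>. X F G1 \<rho> \<sigma> + X F1 G \<rho> \<sigma>) = D F G1 \<rho> + D F1 G \<rho>"
        unfolding D_def by (intro bochner_add X bk \<rho>)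
      finally have eq: "bochner lborel ?f = D F G (\<rho> + h) - D F G \<rho> - h *\<^sub>R ((1 / \<rho>) *\<^sub>R (D F G1 \<rho> + D F1 G \<rho>))" .
      have "(\<integral>\<^sup>+ \<sigma>. ennreal (norm (?f \<sigma>)) \<partial>lborel) \<le> (\<integral>\<^sup>+ \<sigma>. ennreal (K * h\<^sup>2) * ennreal (w \<sigma>) \<partial>lborel)"
        using rem[OF h] K0 w(2) by (intro nn_integral_mono)
          (simp add: ennreal_leI mult_ac flip: ennreal_mult)
      also have "\<dots> = ennreal (K * h\<^sup>2) * (\<integral>\<^sup>+ \<sigma>. ennreal (w \<sigma>) \<partial>lborel)"
        by (rule nn_integral_cmult) measurable
      also have "\<dots> \<le> ennreal (K * h\<^sup>2) * ennreal B" by (intro mult_left_mono w) simp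
      also have "\<dots> = ennreal (K * B * h\<^sup>2)" using K0 B(1) by (simp add: mult_ac flip: ennreal_mult)
      finally show "norm (D F G (\<rho> + h) - D F G \<rho> - h *\<^sub>R ((1 / \<rho>) *\<^sub>R (D F G1 \<rho> + D F1 G \<rho>))) \<le> K * B * h\<^sup>2"
        unfolding eq[symmetric] by (intro norm_bochner_le[OF i4]) (use K0 B in auto)
    qed (use \<rho> in auto)
  qed
  show ?thesis
    unfolding euler_def
  proof (intro allI impI)
    fix r :: real assume r: "r > 0"
    have "((\<lambda>r. r *\<^sub>R D F G r) has_vector_derivative r *\<^sub>R ((1 / r) *\<^sub>R (D F G1 r + D F1 G r)) + 1 *\<^sub>R D F G r) (at r)"
      by (intro has_vector_derivative_scaleR Dderiv r DERIV_ident)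
    then have "(conv F G has_vector_derivative r *\<^sub>R ((1 / r) *\<^sub>R (D F G1 r + D F1 G r)) + 1 *\<^sub>R D F G r) (at r)"
      by (rule has_vector_derivative_transform_within_open[of _ _ _ "{0<..}"])
        (use r X(2)[OF bk(1,2)] in auto)
    moreover have "r *\<^sub>R ((1 / r) *\<^sub>R (D F G1 r + D F1 G r)) + 1 *\<^sub>R D F G r
        = (1 / r) *\<^sub>R (conv F G r + (conv F1 G r + conv F G1 r))"
      using r by (simp add: X(2)[OF bk(1,2) r] X(2)[OF bk(1,4) r] X(2)[OF bk(3,2) r] scaleR_add_right)
    ultimately show "(conv F G has_vector_derivative (1 / r) *\<^sub>R (conv F G r + (conv F1 G r + conv F G1 r))) (at r)"
      by simp
  qed
qed

text \<open>The natural order is r^(1 - a - b) = r^(1 - b) r^-a, and the first factor is bounded on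
  (0, T] because b < 1: the left factor alone fixes the order. By \<open>conv_euler\<close> the
  convolutions generate a family closed under Euler derivatives.\<close>

lemma singular_kernel_conv:
  assumes F: "singular_kernel a F" and G: "singular_kernel b G"
  shows "singular_kernel a (conv F G)"
proof (rule singular_kernel_spanI[where G = "\<lambda>C. \<exists>F G. singular_kernel a F \<and> singular_kernel b G \<and> C = conv F G"])
  have a: "0 \<le> a" "a < 1" and b: "0 \<le> b" "b < 1" using singular_kernelD[OF F] singular_kernelD[OF G] by auto
  show "0 \<le> a" "a < 1" by fact+
  show "add_closure (\<lambda>C. \<exists>F G. singular_kernel a F \<and> singular_kernel b G \<and> C = conv F G) (conv F G)"
    using F G by (intro add_closure.base) blast
  fix C assume "\<exists>F G. singular_kernel a F \<and> singular_kernel b G \<and> C = conv F G"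
  then obtain F G where FG: "singular_kernel a F" "singular_kernel b G" "C = conv F G" by blast
  obtain F1 G1 where F1: "singular_kernel a F1" "euler F F1" and G1: "singular_kernel b G1" "euler G G1"
    using singular_kernelD(4)[OF FG(1)] singular_kernelD(4)[OF FG(2)] by blast
  have e: "euler C (\<lambda>r. conv F G r + (conv F1 G r + conv F G1 r))"
    unfolding FG(3) by (rule conv_euler[OF FG(1,2) F1 G1])
  note bk = singular_kernelD(1)[OF FG(1)] singular_kernelD(1)[OF FG(2)]
  have "bounded_kernel a C"
    unfolding bounded_kernel_def
  proof (intro conjI allI impI)
    show z: "C r = 0" if "r \<le> 0" for r using conv_nonpos[OF bk that] FG(3) by simp
    show "strong_measurable borel C"
      by (rule strong_measurable_halfline[OF euler_continuous_on[OF e] z])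
    fix T :: real assume T: "T > 0"
    obtain K where K: "K \<ge> 0" "\<forall>r. 0 < r \<and> r \<le> T \<longrightarrow> norm (C r) \<le> K * r powr (1 - a - b)"
      using conv_bound[OF bk a b T] FG(3) by blast
    have "norm (C r) \<le> K * T powr (1 - b) * r powr (- a)" if r: "0 < r" "r \<le> T" for r
    proof -
      have "r powr (1 - a - b) = r powr (1 - b) * r powr (- a)"
        by (simp add: powr_add[symmetric] algebra_simps)
      moreover have "r powr (1 - b) \<le> T powr (1 - b)" using r b by (intro powr_mono2) auto
      ultimately have "K * r powr (1 - a - b) \<le> K * (T powr (1 - b) * r powr (- a))"
        using K(1) by (intro mult_left_mono) (auto intro: mult_right_mono)
      then show ?thesis using K(2) r by (auto simp: mult.assoc intro: order_trans)
    qed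
    then show "\<exists>K\<ge>0. \<forall>r. 0 < r \<and> r \<le> T \<longrightarrow> norm (C r) \<le> K * r powr (- a)"
      using K(1) by (intro exI[of _ "K * T powr (1 - b)"]) auto
  qed
  moreover have "add_closure (\<lambda>C. \<exists>F G. singular_kernel a F \<and> singular_kernel b G \<and> C = conv F G)
      (\<lambda>r. conv F G r + (conv F1 G r + conv F G1 r))"
    using FG(1,2) F1(1) G1(1) by (intro add_closure.add add_closure.base) blast+
  ultimately show "bounded_kernel a C \<and> (\<exists>F1. add_closure (\<lambda>C. \<exists>F G. singular_kernel a F \<and> singular_kernel b G \<and> C = conv F G) F1 \<and> euler C F1)"
    using e by blast
qed

lemma conv_mult_left:
  assumes "bounded_kernel a F" "bounded_kernel b G" "0 \<le> a" "a < 1" "0 \<le> b" "b < 1"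
  shows "conv (\<lambda>r. L * F r) G r = L * conv F G r"
  unfolding conv_def mult.assoc by (rule bochner_mult_left[OF conv_integrable[OF assms]])


section \<open>Heat kernels\<close>

context nonneg_self_adjoint
begin

text \<open>For L = P (H + 1)^-a this is the bounded form of P exp (- r H). Cutting off at r = 0
  hides that the operator may be unbounded there.\<close>

definition heat_kernel :: "'a cblinfun \<Rightarrow> real \<Rightarrow> real \<Rightarrow> 'a cblinfun" where
  "heat_kernel L a r = (if 0 < r then L * Q a r else 0)"

abbreviation heat :: "real \<Rightarrow> 'a cblinfun" where "heat \<equiv> heat_kernel cid 0"

text \<open>In the generators c r^(m + j) L (H + 1)^(a + m) exp (- r H), the m powers of r offset
  the m additional powers of H + 1, and j counts surplus powers. The Euler derivative raises m or j
  by one or keeps both.\<close>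

lemma singular_kernel_heat_kernel:
  assumes a: "0 \<le> a" "a < 1"
  shows "singular_kernel a (heat_kernel L a)"
proof -
  define g where "g c m j = (\<lambda>r. if 0 < r then (c * r ^ (m + j)) *\<^sub>R (L * Q (a + real m) r) else 0)"
    for c :: real and m j :: nat
  let ?G = "\<lambda>f. \<exists>c m j. f = g c m j"
  have deriv: "euler (g c m j) (\<lambda>r. g (c * real (m + j)) m j r + (g c m (Suc j) r + g (- c) (Suc m) j r))" for c m j
    unfolding euler_def
  proof (intro allI impI)
    fix r :: real assume r: "r > 0"
    have "((\<lambda>r. c * r ^ (m + j)) has_field_derivative c * (real (m + j) * r ^ (m + j - 1))) (at r)"
      by (auto intro!: derivative_eq_intros)
    moreover have "((\<lambda>r. L * Q (a + real m) r) has_vector_derivative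
        L * (Q (a + real m) r - Q (a + real m + 1) r)) (at r)"
      by (intro has_vector_derivative_mult_right Q_derivative r)
    ultimately have "((\<lambda>r. (c * r ^ (m + j)) *\<^sub>R (L * Q (a + real m) r)) has_vector_derivative
        (c * r ^ (m + j)) *\<^sub>R (L * (Q (a + real m) r - Q (a + real m + 1) r))
        + (c * (real (m + j) * r ^ (m + j - 1))) *\<^sub>R (L * Q (a + real m) r)) (at r)"
      by (rule has_vector_derivative_scaleR)
    then have "(g c m j has_vector_derivative
        (c * r ^ (m + j)) *\<^sub>R (L * (Q (a + real m) r - Q (a + real m + 1) r))
        + (c * (real (m + j) * r ^ (m + j - 1))) *\<^sub>R (L * Q (a + real m) r)) (at r)"
      by (rule has_vector_derivative_transform_within_open[of _ _ _ "{0<..}"]) (use r in \<open>auto simp: g_def\<close>)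
    moreover have "(c * r ^ (m + j)) *\<^sub>R (L * (Q (a + real m) r - Q (a + real m + 1) r))
        + (c * (real (m + j) * r ^ (m + j - 1))) *\<^sub>R (L * Q (a + real m) r)
        = (1 / r) *\<^sub>R (g (c * real (m + j)) m j r + (g c m (Suc j) r + g (- c) (Suc m) j r))"
    proof -
      have "real (m + j) * r ^ (m + j) / r = real (m + j) * r ^ (m + j - 1)"
        using r by (cases "m + j") auto
      then have "c * real (m + j) * r ^ (m + j) / r = c * (real (m + j) * r ^ (m + j - 1))"
        by (metis mult.assoc times_divide_eq_right)
      moreover have "Q (a + real (Suc m)) = Q (a + real m + 1)" by (simp add: algebra_simps)
      ultimately show ?thesis
        using r by (simp add: g_def scaleR_add_right right_diff_distrib scaleR_diff_right del: of_nat_Suc of_nat_add)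
    qed
    ultimately show "(g c m j has_vector_derivative
        (1 / r) *\<^sub>R (g (c * real (m + j)) m j r + (g c m (Suc j) r + g (- c) (Suc m) j r))) (at r)"
      by simp
  qed
  have "bounded_kernel a (g c m j)" for c m j
    unfolding bounded_kernel_def
  proof (intro conjI allI impI)
    show z: "g c m j r = 0" if "r \<le> 0" for r using that by (simp add: g_def)
    show "strong_measurable borel (g c m j)"
      by (rule strong_measurable_halfline[OF euler_continuous_on[OF deriv] z])
    fix T :: real assume T: "T > 0"
    obtain C where C: "C \<ge> 0" "\<And>t. t > 0 \<Longrightarrow> norm (Q (a + real m) t) \<le> C * exp t * t powr (- (a + real m))"
      using norm_Q_le[of "a + real m"] a by auto
    have "norm (g c m j r) \<le> (\<bar>c\<bar> * T ^ j * norm L * C * exp T) * r powr (- a)" if r: "0 < r" "r \<le> T" for r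
    proof -
      have "norm (g c m j r) \<le> \<bar>c * r ^ (m + j)\<bar> * (norm L * norm (Q (a + real m) r))"
        using r by (simp add: g_def mult_left_mono norm_mult_ineq)
      also have "\<dots> \<le> \<bar>c * r ^ (m + j)\<bar> * (norm L * (C * exp T * r powr (- (a + real m))))"
      proof (intro mult_left_mono)
        have "C * exp r * r powr (- (a + real m)) \<le> C * exp T * r powr (- (a + real m))"
          using r C(1) by (intro mult_right_mono mult_left_mono) auto
        then show "norm (Q (a + real m) r) \<le> C * exp T * r powr (- (a + real m))"
          using C(2)[OF r(1)] by linarith
      qed auto
      also have "\<dots> = (\<bar>c\<bar> * norm L * C * exp T) * (r ^ j * (r ^ m * r powr (- (a + real m))))"
        using r by (simp add: abs_mult power_add mult_ac)
      also have "r ^ m * r powr (- (a + real m)) = r powr (- a)"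
        using r by (simp add: powr_realpow[symmetric] powr_add[symmetric])
      also have "(\<bar>c\<bar> * norm L * C * exp T) * (r ^ j * r powr (- a))
          \<le> (\<bar>c\<bar> * norm L * C * exp T) * (T ^ j * r powr (- a))"
        using r C(1) by (intro mult_left_mono mult_right_mono power_mono) auto
      finally show ?thesis by (simp add: mult_ac)
    qed
    then show "\<exists>K\<ge>0. \<forall>r. 0 < r \<and> r \<le> T \<longrightarrow> norm (g c m j r) \<le> K * r powr (- a)"
      using C(1) T by (intro exI[of _ "\<bar>c\<bar> * T ^ j * norm L * C * exp T"]) auto
  qed
  moreover have "add_closure ?G (\<lambda>r. g (c * real (m + j)) m j r + (g c m (Suc j) r + g (- c) (Suc m) j r))" for c m j
    by (intro add_closure.add add_closure.base) blast+
  ultimately have main: "bounded_kernel a F \<and> (\<exists>F1. add_closure ?G F1 \<and> euler F F1)" if "?G F" for F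
    using that deriv by blast
  have "heat_kernel L a = g 1 0 0" by (auto simp: heat_kernel_def g_def)
  then have "add_closure ?G (heat_kernel L a)" by (intro add_closure.base) blast
  with singular_kernel_spanI[of a ?G, OF a main] show ?thesis by blast
qed

lemma heat_kernel_mult: "heat_kernel L a = (\<lambda>r. L * heat_kernel cid a r)"
  by (auto simp: heat_kernel_def)

text \<open>This factorization puts (H + 1)^-a directly to the right of an operator P, where the
  product with P is bounded.\<close>

lemma heat_eq:
  assumes "a \<ge> 0"
  shows "heat = (\<lambda>r. Q (- a) 0 * heat_kernel cid a r)"
  using assms by (auto simp: heat_kernel_def Q_mult admissible_def)


section \<open>The equation for convolutions with the heat semigroup\<close>

lemma bounded_kernel_times_id:
  assumes F: "bounded_kernel b F"
  shows "bounded_kernel b (\<lambda>q. q *\<^sub>R F q)"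
  unfolding bounded_kernel_def
proof (intro conjI allI impI)
  have "strong_measurable borel (\<lambda>q::real. q)"
    unfolding strong_measurable_def
  proof -
    obtain f :: "nat \<Rightarrow> real \<Rightarrow> real" where "\<And>i. simple_function borel (f i)" "\<And>x. (\<lambda>i. f i x) \<longlonglongrightarrow> x"
      using borel_measurable_implies_sequence_metric[of "\<lambda>x::real. x" borel 0] by auto
    then show "\<exists>s :: nat \<Rightarrow> real \<Rightarrow> real. (\<forall>i. simple_function borel (s i)) \<and> (\<forall>x\<in>space borel. (\<lambda>i. s i x) \<longlonglongrightarrow> x)"
      by (intro exI[of _ f]) auto
  qed
  then show "strong_measurable borel (\<lambda>q. q *\<^sub>R F q)"
    by (intro strong_measurable_bilinear[OF _ bounded_kernelD(1)[OF F] bounded_bilinear_scaleR])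
  show "r *\<^sub>R F r = 0" if "r \<le> 0" for r using bounded_kernelD(2)[OF F that] by simp
  fix T :: real assume T: "T > 0"
  obtain C where C: "C \<ge> 0" "\<forall>r. 0 < r \<and> r \<le> T \<longrightarrow> norm (F r) \<le> C * r powr (- b)"
    using bounded_kernelD(3)[OF F T] by blast
  have "norm (r *\<^sub>R F r) \<le> T * C * r powr (- b)" if r: "0 < r" "r \<le> T" for r
  proof -
    have "norm (r *\<^sub>R F r) \<le> T * (C * r powr (- b))"
      using C r T unfolding norm_scaleR by (intro mult_mono) auto
    then show ?thesis by (simp add: mult.assoc)
  qed
  then show "\<exists>C\<ge>0. \<forall>r. 0 < r \<and> r \<le> T \<longrightarrow> norm (r *\<^sub>R F r) \<le> C * r powr (- b)"
    using C T by (intro exI[of _ "T * C"]) auto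
qed

text \<open>Split r = q + (r - q) under the integral.\<close>

lemma conv_times_id:
  assumes F: "bounded_kernel a F" and G: "bounded_kernel b G"
    and a: "0 \<le> a" "a < 1" and b: "0 \<le> b" "b < 1"
  shows "r *\<^sub>R conv F G r = conv (\<lambda>q. q *\<^sub>R F q) G r + conv F (\<lambda>q. q *\<^sub>R G q) r"
proof -
  note F' = bounded_kernel_times_id[OF F] and G' = bounded_kernel_times_id[OF G]
  have "r *\<^sub>R conv F G r = bochner lborel (\<lambda>q. r *\<^sub>R (F q * G (r - q)))"
    unfolding conv_def by (rule bochner_scaleR[OF conv_integrable[OF F G a b], symmetric])
  also have "(\<lambda>q. r *\<^sub>R (F q * G (r - q))) = (\<lambda>q. q *\<^sub>R F q * G (r - q) + F q * ((r - q) *\<^sub>R G (r - q)))"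
    by (auto simp: fun_eq_iff algebra_simps)
  also have "bochner lborel \<dots> = conv (\<lambda>q. q *\<^sub>R F q) G r + conv F (\<lambda>q. q *\<^sub>R G q) r"
    unfolding conv_def by (rule bochner_add[OF conv_integrable[OF F' G a b] conv_integrable[OF F G' a b]])
  finally show ?thesis .
qed

lemma Q_continuous: "continuous_on {0<..} (Q a)"
  by (rule has_vector_derivative_continuous_halfline) (blast intro: Q_derivative)

text \<open>Integrating the derivative of \<open>q \<mapsto> (H + 1)\<^sup>-\<^sup>1 e\<^sup>-\<^sup>q\<^sup>H (r - q) G (r - q)\<close> over \<open>(0, r)\<close>; the resolvent
  makes the limit at \<open>q = 0\<close> exist in norm, the factor \<open>r - q\<close> the one at \<open>q = r\<close>.\<close>

lemma heat_integration_by_parts: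
  assumes G: "singular_kernel b G" and G1: "singular_kernel b G1" "euler G G1" and r: "r > 0"
  shows "r *\<^sub>R (Q (- 1) 0 * G r) = (cid - Q (- 1) 0) * conv heat (\<lambda>q. q *\<^sub>R G q) r
    + Q (- 1) 0 * conv heat (\<lambda>q. G q + G1 q) r"
proof -
  let ?R = "Q (- 1) 0"
  define mG where "mG q = q *\<^sub>R G q" for q
  \<comment> \<open>The ordinary derivative of q G(q), since q G'(q) is \<open>G1 q\<close>.\<close>
  define Y where "Y q = G q + G1 q" for q
  have hk: "singular_kernel 0 heat" by (rule singular_kernel_heat_kernel) auto
  note bkh = singular_kernelD(1)[OF hk]
  note b = singular_kernelD(2,3)[OF G]
  have bmG: "bounded_kernel b mG"
    unfolding mG_def[abs_def] by (rule bounded_kernel_times_id[OF singular_kernelD(1)[OF G]])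
  have bY: "bounded_kernel b Y"
    unfolding Y_def[abs_def] by (intro bounded_kernel_add singular_kernelD(1) G G1)
  define I where "I q = (cid - ?R) * (heat q * mG (r - q)) + ?R * (heat q * Y (r - q))" for q
  have i1: "bochner_integrable lborel (\<lambda>q. heat q * mG (r - q))"
    and i2: "bochner_integrable lborel (\<lambda>q. heat q * Y (r - q))"
    by (rule conv_integrable[OF bkh _ _ _ b]; simp add: bmG bY)+
  have Iint: "bochner_integrable lborel I"
    unfolding I_def[abs_def]
    by (intro bochner_integrable_add bochner_integrable_linear[OF i1 bounded_linear_mult_right]
        bochner_integrable_linear[OF i2 bounded_linear_mult_right])
  have I: "bochner lborel I = (cid - ?R) * conv heat mG r + ?R * conv heat Y r"
    unfolding I_def[abs_def] conv_def
    by (subst bochner_add[OF bochner_integrable_linear[OF i1 bounded_linear_mult_right]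
        bochner_integrable_linear[OF i2 bounded_linear_mult_right]])
      (simp add: bochner_mult_left[OF i1] bochner_mult_left[OF i2])
  have I0: "I q = 0" if "\<not> (0 < q \<and> q < r)" for q
    using that bounded_kernelD(2)[OF bmG, of "r - q"] bounded_kernelD(2)[OF bY, of "r - q"]
    by (auto simp: I_def heat_kernel_def)
  \<comment> \<open>Minus a primitive of \<open>I\<close>: the derivative of (H + 1)^-1 exp (- q H)
    is -(1 - R) exp (- q H), with R the resolvent, so no unbounded operator appears.\<close>
  define P where "P q = Q (- 1) q * mG (r - q)" for q
  have ad: "admissible (- 1) 0" "0 < q \<Longrightarrow> admissible c q" for c q by (auto simp: admissible_def)
  have mGderiv: "(mG has_vector_derivative Y s) (at s)" if s: "s > 0" for s
  proof -
    have "(G has_vector_derivative (1 / s) *\<^sub>R G1 s) (at s)" using G1(2) s by (simp add: euler_def)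
    then have "((\<lambda>q. q *\<^sub>R G q) has_vector_derivative s *\<^sub>R ((1 / s) *\<^sub>R G1 s) + 1 *\<^sub>R G s) (at s)"
      by (intro has_vector_derivative_scaleR DERIV_ident)
    then show ?thesis using s by (simp add: mG_def[abs_def] Y_def add.commute)
  qed
  have Pderiv: "(P has_vector_derivative - I q) (at q)" if q: "0 < q" "q < r" for q
  proof -
    have "((\<lambda>q. r - q) has_vector_derivative - 1) (at q)" by (auto intro!: derivative_eq_intros)
    from vector_diff_chain_at[OF this mGderiv, of ] q
    have "((\<lambda>q. mG (r - q)) has_vector_derivative - Y (r - q)) (at q)" by (simp add: o_def)
    moreover have "(Q (- 1) has_vector_derivative Q (- 1) q - Q (- 1 + 1) q) (at q)"
      by (rule Q_derivative[OF q(1)])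
    ultimately have "(P has_vector_derivative Q (- 1) q * (- Y (r - q)) + (Q (- 1) q - Q (- 1 + 1) q) * mG (r - q)) (at q)"
      unfolding P_def[abs_def] by (intro has_vector_derivative_mult)
    moreover have "Q (- 1) q * (- Y (r - q)) + (Q (- 1) q - Q (- 1 + 1) q) * mG (r - q) = - I q"
    proof -
      have "Q (- 1) q = ?R * Q 0 q" using Q_mult[OF ad(1) ad(2)[OF q(1)], of 0] by simp
      then show ?thesis
        using q by (simp add: I_def heat_kernel_def algebra_simps mult.assoc)
    qed
    ultimately show ?thesis by simp
  qed
  have G_cont: "continuous_on {0<..} G" "continuous_on {0<..} G1"
    using singular_kernelD(4)[OF G] singular_kernelD(4)[OF G1(1)] euler_continuous_on by blast+
  have Icont: "isCont I q" if q: "0 < q" "q < r" for q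
  proof -
    have "continuous_on {0<..<r} I"
    proof -
      have "continuous_on {0<..<r} (\<lambda>q. mG (r - q))" "continuous_on {0<..<r} (\<lambda>q. Y (r - q))"
        unfolding mG_def Y_def
        by (intro continuous_intros continuous_on_compose2[OF G_cont(1)] continuous_on_compose2[OF G_cont(2)]; auto)+
      moreover have "continuous_on {0<..<r} (Q 0)" by (rule continuous_on_subset[OF Q_continuous]) auto
      ultimately have "continuous_on {0<..<r} (\<lambda>q. (cid - ?R) * (Q 0 q * mG (r - q)) + ?R * (Q 0 q * Y (r - q)))"
        by (intro continuous_intros)
      then show ?thesis
        by (rule continuous_on_eq) (auto simp: I_def heat_kernel_def)
    qed
    then show ?thesis using q by (simp add: continuous_on_eq_continuous_at)
  qed
  have lim0: "(P \<longlongrightarrow> ?R * mG r) (at_right 0)"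
    unfolding P_def
  proof (intro tendsto_mult)
    show "(Q (- 1) \<longlongrightarrow> ?R) (at_right 0)"
    proof (rule LIM_zero_cancel, rule Lim_null_comparison)
      show "\<forall>\<^sub>F c in at_right 0. norm (Q (- 1) c - ?R) \<le> 2 * c"
        using resolvent_heat_bound by (auto simp: eventually_at_right_less intro: eventually_mono[OF eventually_at_right_less])
      show "((\<lambda>c. 2 * c) \<longlongrightarrow> 0) (at_right (0::real))" by (auto intro!: tendsto_eq_intros)
    qed
    have "isCont mG r" using mGderiv[OF r] by (rule has_vector_derivative_continuous)
    moreover have "((\<lambda>q. r - q) \<longlongrightarrow> r) (at_right (0::real))" by (auto intro!: tendsto_eq_intros)
    ultimately show "((\<lambda>q. mG (r - q)) \<longlongrightarrow> mG r) (at_right 0)" by (rule isCont_tendsto_compose)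
  qed
  have lim1: "(P \<longlongrightarrow> 0) (at_left r)"
  proof -
    obtain C where C: "C \<ge> 0" "\<forall>s. 0 < s \<and> s \<le> r \<longrightarrow> norm (G s) \<le> C * s powr (- b)"
      using bounded_kernelD(3)[OF singular_kernelD(1)[OF G] r] by blast
    show ?thesis
    proof (rule Lim_null_comparison)
      show "\<forall>\<^sub>F q in at_left r. norm (P q) \<le> (norm ?R + 2 * r) * (C * (r - q) powr (1 - b))"
        using eventually_at_left_real[OF r]
      proof eventually_elim
        case (elim q)
        then have q: "0 < q" "q < r" by auto
        have "norm (P q) \<le> norm (Q (- 1) q) * norm (mG (r - q))" unfolding P_def by (rule norm_mult_ineq)
        also have "\<dots> \<le> (norm ?R + 2 * r) * (C * (r - q) powr (1 - b))"
        proof (intro mult_mono)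
          have "norm (Q (- 1) q) \<le> norm ?R + norm (Q (- 1) q - ?R)"
            by (metis add_diff_cancel_left' add_diff_eq norm_triangle_ineq)
          then show "norm (Q (- 1) q) \<le> norm ?R + 2 * r" using resolvent_heat_bound[of q] q by simp
          have "norm (mG (r - q)) \<le> (r - q) * (C * (r - q) powr (- b))"
            using C q by (simp add: mG_def mult_left_mono)
          also have "\<dots> = C * (r - q) powr (1 - b)"
            using q powr_add[of "r - q" 1 "- b"] by simp
          finally show "norm (mG (r - q)) \<le> C * (r - q) powr (1 - b)" .
        qed (use r in auto)
        finally show ?case .
      qed
      have "((\<lambda>q. (r - q) powr (1 - b)) \<longlongrightarrow> (r - r) powr (1 - b)) (at_left r)"
        using b by (intro tendsto_powr' tendsto_intros)
          (auto intro: eventually_mono[OF eventually_at_left_real[OF r]])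
      then have "((\<lambda>q. (r - q) powr (1 - b)) \<longlongrightarrow> 0) (at_left r)" using b by simp
      then show "((\<lambda>q. (norm ?R + 2 * r) * (C * (r - q) powr (1 - b))) \<longlongrightarrow> 0) (at_left r)"
        by (intro tendsto_mult_right_zero)
    qed
  qed
  have "?R * mG r = bochner lborel I"
  proof (rule entry_eqI)
    fix x v
    have h: "has_bochner_integral lborel (\<lambda>q. entry x v (I q)) (entry x v (bochner lborel I))"
      by (rule bochner_integral_entry[OF Iint])
    interpret e: bounded_linear "entry x v" by (rule bounded_linear_entry)
    have ind: "(\<lambda>q. indicator (einterval (ereal 0) (ereal r)) q *\<^sub>R entry x v (- I q)) = (\<lambda>q. - entry x v (I q))"
    proof
      fix q
      have "entry x v (- I q) = - entry x v (I q)" by (simp add: entry_def cblinfun_simps cinner_simps)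
      then show "indicator (einterval (ereal 0) (ereal r)) q *\<^sub>R entry x v (- I q) = - entry x v (I q)"
        using I0[of q] e.zero by (cases "0 < q \<and> q < r") auto
    qed
    have "(LBINT q=ereal 0..ereal r. entry x v (- I q)) = entry x v 0 - entry x v (?R * mG r)"
    proof (rule interval_integral_FTC_integrable[where F = "\<lambda>q. entry x v (P q)"])
      show "((\<lambda>q. entry x v (P q)) has_vector_derivative entry x v (- I q)) (at q)"
        if "ereal 0 < ereal q" "ereal q < ereal r" for q
        using that by (intro e.has_vector_derivative Pderiv) auto
      show "isCont (\<lambda>q. entry x v (- I q)) q" if "ereal 0 < ereal q" "ereal q < ereal r" for q
        using that by (intro e.isCont continuous_minus Icont) auto
      show "set_integrable lborel (einterval (ereal 0) (ereal r)) (\<lambda>q. entry x v (- I q))"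
        unfolding set_integrable_def ind using h by (auto simp: has_bochner_integral_iff)
      show "(((\<lambda>q. entry x v (P q)) \<circ> real_of_ereal) \<longlongrightarrow> entry x v (?R * mG r)) (at_right (ereal 0))"
        unfolding ereal_tendsto_simps by (rule e.tendsto[OF lim0])
      show "(((\<lambda>q. entry x v (P q)) \<circ> real_of_ereal) \<longlongrightarrow> entry x v 0) (at_left (ereal r))"
        unfolding ereal_tendsto_simps by (rule e.tendsto[OF lim1])
    qed (use r in auto)
    moreover have "(LBINT q=ereal 0..ereal r. entry x v (- I q)) = - entry x v (bochner lborel I)"
      unfolding interval_lebesgue_integral_def set_lebesgue_integral_def ind
      using r h by (simp add: has_bochner_integral_iff)
    ultimately show "entry x v (?R * mG r) = entry x v (bochner lborel I)" by (simp add: e.zero)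
  qed
  then show ?thesis unfolding I by (simp add: mG_def[abs_def] Y_def[abs_def])
qed

text \<open>The derivative \<open>D\<close> exists by \<open>conv_euler\<close>, but contains the
  Euler derivative of the semigroup, thus a factor \<open>H\<close> under the integral.
  Multiplication by the resolvent removes it and leads to \<Phi> = R (\<Phi> + G - D), from which
  membership in the graph of \<open>H\<close> is read off.\<close>

lemma conv_heat_equation:
  assumes G: "singular_kernel b G" and r: "r > 0"
  shows "\<exists>D. (conv heat G has_vector_derivative D) (at r) \<and> (\<forall>x. (conv heat G r \<rhd> x, (G r - D) \<rhd> x) \<in> H)"
proof -
  let ?R = "Q (- 1) 0" and ?\<Phi> = "conv heat G r"
  obtain G1 where G1: "singular_kernel b G1" "euler G G1" using singular_kernelD(4)[OF G] by blast
  have hk: "singular_kernel 0 heat" by (rule singular_kernel_heat_kernel) auto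
  obtain S1 where S1: "singular_kernel 0 S1" "euler heat S1" using singular_kernelD(4)[OF hk] by blast
  note b = singular_kernelD(2,3)[OF G]
  note bk = singular_kernelD(1)[OF hk] singular_kernelD(1)[OF G] singular_kernelD(1)[OF G1(1)] singular_kernelD(1)[OF S1(1)]
  define D where "D = (1 / r) *\<^sub>R (?\<Phi> + (conv S1 G r + conv heat G1 r))"
  have deriv: "(conv heat G has_vector_derivative D) (at r)"
    using conv_euler[OF hk G S1 G1] r by (simp add: euler_def D_def)
  have ad: "admissible (- 1) 0" "0 < q \<Longrightarrow> admissible c q" for c q by (auto simp: admissible_def)
  \<comment> \<open>The Euler derivative of the semigroup is -q H exp (- q H), and R H = 1 - R makes
    it bounded.\<close>
  have RS1: "?R * S1 q = - (cid - ?R) * (q *\<^sub>R heat q)" for q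
  proof (cases "q > 0")
    case True
    have "(heat has_vector_derivative (1 / q) *\<^sub>R S1 q) (at q)" using S1(2) True by (simp add: euler_def)
    moreover have "(heat has_vector_derivative Q 0 q - Q (0 + 1) q) (at q)"
      by (rule has_vector_derivative_transform_within_open[OF Q_derivative[OF True], of "{0<..}"])
        (use True in \<open>auto simp: heat_kernel_def\<close>)
    ultimately have "(1 / q) *\<^sub>R S1 q = Q 0 q - Q 1 q"
      using vector_derivative_unique_at by fastforce
    then have "S1 q = q *\<^sub>R (Q 0 q - Q 1 q)"
      using True by (metis divide_self_if less_numeral_extra(3) mult.commute scaleR_one scaleR_scaleR times_divide_eq_right mult.right_neutral)
    moreover have "?R * Q 1 q = Q 0 q" using Q_mult[OF ad(1) ad(2)[OF True], of 1] by simp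
    ultimately have "?R * S1 q = q *\<^sub>R (?R * Q 0 q - Q 0 q)" by (simp add: right_diff_distrib)
    then show ?thesis
      using True by (simp add: heat_kernel_def algebra_simps)
  next
    case False
    then show ?thesis using bounded_kernelD(2)[OF bk(4), of q] by (simp add: heat_kernel_def)
  qed
  have e1: "?R * conv S1 G r = - (cid - ?R) * conv (\<lambda>q. q *\<^sub>R heat q) G r"
  proof -
    have "?R * conv S1 G r = conv (\<lambda>q. ?R * S1 q) G r"
      by (rule conv_mult_left[OF bk(4) bk(2) _ _ b, symmetric]) auto
    also have "\<dots> = - (cid - ?R) * conv (\<lambda>q. q *\<^sub>R heat q) G r"
      unfolding RS1 by (rule conv_mult_left[OF bounded_kernel_times_id[OF bk(1)] bk(2) _ _ b]) auto
    finally show ?thesis .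
  qed
  have e2: "r *\<^sub>R (?R * G r) = (cid - ?R) * conv heat (\<lambda>q. q *\<^sub>R G q) r + ?R * (?\<Phi> + conv heat G1 r)"
  proof -
    have "conv heat (\<lambda>q. G q + G1 q) r = ?\<Phi> + conv heat G1 r"
      unfolding conv_def distrib_left
      by (rule bochner_add) (rule conv_integrable[OF bk(1) _ _ _ b]; simp add: bk)+
    then show ?thesis using heat_integration_by_parts[OF G G1 r] by simp
  qed
  have e3: "r *\<^sub>R ?\<Phi> = conv (\<lambda>q. q *\<^sub>R heat q) G r + conv heat (\<lambda>q. q *\<^sub>R G q) r"
    by (rule conv_times_id[OF bk(1,2) _ _ b]) auto
  \<comment> \<open>The terms with weights q and r - q from \<open>e1\<close> and \<open>e2\<close>
    recombine by \<open>e3\<close> into the single weight r, which can then be cancelled.\<close>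
  have "r *\<^sub>R (?R * D) = ?R * ?\<Phi> + ?R * conv S1 G r + ?R * conv heat G1 r"
    using r by (simp add: D_def distrib_left add.assoc)
  also have "\<dots> = r *\<^sub>R (?R * G r) - (cid - ?R) * (r *\<^sub>R ?\<Phi>)"
    unfolding e1 e2 e3 by (simp add: distrib_left algebra_simps)
  also have "\<dots> = r *\<^sub>R (?R * G r - (cid - ?R) * ?\<Phi>)"
    by (simp add: scaleR_diff_right)
  finally have "?R * D = ?R * G r - (cid - ?R) * ?\<Phi>" using r by simp
  then have \<Phi>: "?\<Phi> = ?R * (?\<Phi> + G r - D)"
    by (simp add: algebra_simps)
  have "(?\<Phi> \<rhd> x, (G r - D) \<rhd> x) \<in> H" for x
  proof -
    have "?R \<rhd> (?\<Phi> + G r - D) \<rhd> x = ?\<Phi> \<rhd> x"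
      using \<Phi> by (metis times_cblinfun_apply)
    then show ?thesis
      using resolvent_mem_graph[of "(?\<Phi> + G r - D) \<rhd> x"] by (simp add: cblinfun_simps)
  qed
  with deriv show ?thesis by blast
qed

end


section \<open>Iterated integrals over the simplex\<close>

text \<open>The bounded counterpart of \<open>heat_word\<close>: defined at all times, with
  \<open>X\<close> the kernel of the first gap. Carrying \<open>X\<close> separately lets both the
  semigroup and a kernel with an operator in front play this role.\<close>

fun word :: "(real \<Rightarrow> 'a::chilbert_space cblinfun) \<Rightarrow> (real \<Rightarrow> 'a cblinfun) list \<Rightarrow>
    real \<Rightarrow> real \<Rightarrow> nat \<Rightarrow> (nat \<Rightarrow> real) \<Rightarrow> 'a cblinfun" where
  "word X [] t u k s = X (t - u)"
| "word X (W # Ws) t u k s = X (s k - u) * word W Ws t (s k) (Suc k) s"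

fun conv_word :: "(real \<Rightarrow> 'a::chilbert_space cblinfun) \<Rightarrow> (real \<Rightarrow> 'a cblinfun) list \<Rightarrow> real \<Rightarrow> 'a cblinfun" where
  "conv_word X [] = X"
| "conv_word X (W # Ws) = conv X (conv_word W Ws)"

text \<open>The open simplex, in the recursive shape of \<open>word\<close>.\<close>

fun chain :: "real \<Rightarrow> nat \<Rightarrow> real \<Rightarrow> nat \<Rightarrow> (nat \<Rightarrow> real) \<Rightarrow> bool" where
  "chain t 0 u k s \<longleftrightarrow> u < t"
| "chain t (Suc n) u k s \<longleftrightarrow> u < s k \<and> chain t n (s k) (Suc k) s"

lemma chain_bounds: "chain t n u k s \<Longrightarrow> u < t \<and> (\<forall>i. k \<le> i \<and> i < k + n \<longrightarrow> u < s i \<and> s i < t)"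
proof (induction n arbitrary: u k)
  case (Suc n)
  then have "u < s k" "s k < t" "\<And>i. Suc k \<le> i \<Longrightarrow> i < Suc k + n \<Longrightarrow> s k < s i \<and> s i < t"
    using Suc.IH[of "s k" "Suc k"] by auto
  then show ?case by (metis add_Suc add_Suc_right less_trans not_less_eq_eq order_antisym_conv)
qed simp

lemma chain_mono: "chain t n u k s \<Longrightarrow> k \<le> i \<Longrightarrow> i < j \<Longrightarrow> j < k + n \<Longrightarrow> s i < s j"
proof (induction n arbitrary: u k)
  case (Suc n)
  show ?case
  proof (cases "i = k")
    case True
    then show ?thesis using chain_bounds[of t n "s k" "Suc k" s] Suc by simp
  next
    case False
    then show ?thesis using Suc.IH[of "s k" "Suc k"] Suc.prems by simp
  qed
qed simp

lemma chainI:
  assumes "u < t" "\<And>i. k \<le> i \<Longrightarrow> i < k + n \<Longrightarrow> u < s i \<and> s i < t"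
    and "\<And>i j. k \<le> i \<Longrightarrow> i < j \<Longrightarrow> j < k + n \<Longrightarrow> s i < s j"
  shows "chain t n u k s"
  using assms
proof (induction n arbitrary: u k)
  case (Suc n)
  have "chain t n (s k) (Suc k) s"
    by (rule Suc.IH) (use Suc.prems in auto)
  then show ?case using Suc.prems by simp
qed simp

text \<open>The restriction to the simplex is built into the kernels, because outside the open
  simplex some gap is nonpositive.\<close>

lemma word_zero:
  assumes "\<forall>W\<in>set (X # Ws). \<forall>r\<le>0. W r = 0" "\<not> chain t (length Ws) u k s"
  shows "word X Ws t u k s = 0"
  using assms
proof (induction Ws arbitrary: X u k)
  case (Cons W Ws)
  show ?case
  proof (cases "u < s k")
    case True
    then have "word W Ws t (s k) (Suc k) s = 0" using Cons by (intro Cons.IH) auto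
    then show ?thesis by simp
  next
    case False
    then show ?thesis using Cons.prems by simp
  qed
qed auto

lemma word_cong: "(\<And>i. k \<le> i \<Longrightarrow> s i = s' i) \<Longrightarrow> word X Ws t u k s = word X Ws t u k s'"
proof (induction Ws arbitrary: X u k)
  case (Cons W Ws)
  have "word W Ws t (s' k) (Suc k) s = word W Ws t (s' k) (Suc k) s'"
    by (rule Cons.IH) (use Cons.prems in auto)
  then show ?case using Cons.prems[of k] by simp
qed simp

lemma word_mult_left: "word (\<lambda>r. L * X r) Ws t u k s = L * word X Ws t u k s"
  by (cases Ws) (auto simp: mult.assoc)

lemma word_measurable:
  assumes "\<forall>W\<in>set (X # Ws). strong_measurable borel W" "{k..<k + length Ws} \<subseteq> I"
    and "h \<in> borel_measurable (Pi\<^sub>M I (\<lambda>_. lborel))"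
  shows "strong_measurable (Pi\<^sub>M I (\<lambda>_. lborel)) (\<lambda>s. word X Ws t (h s) k s)"
  using assms
proof (induction Ws arbitrary: X k h)
  case Nil
  have "(\<lambda>s. t - h s) \<in> borel_measurable (Pi\<^sub>M I (\<lambda>_. lborel))"
    by (intro borel_measurable_diff borel_measurable_const Nil)
  then show ?case using Nil.prems(1) strong_measurable_lborel[of X "\<lambda>s. t - h s"] by simp
next
  case (Cons W Ws)
  have k: "k \<in> I" using Cons.prems(2) by auto
  have m: "(\<lambda>s :: nat \<Rightarrow> real. s k) \<in> borel_measurable (Pi\<^sub>M I (\<lambda>_. lborel))"
    using measurable_component_singleton[OF k, of "\<lambda>_. lborel :: real measure"] by simp
  have "strong_measurable (Pi\<^sub>M I (\<lambda>_. lborel)) (\<lambda>s. X (s k - h s))"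
    using Cons.prems(1) strong_measurable_lborel[of X "\<lambda>s. s k - h s", OF _ borel_measurable_diff[OF m Cons.prems(3)]]
    by simp
  moreover have "strong_measurable (Pi\<^sub>M I (\<lambda>_. lborel)) (\<lambda>s. word W Ws t (s k) (Suc k) s)"
    using Cons.prems m by (intro Cons.IH) auto
  ultimately show ?case by (simp add: strong_measurable_mult)
qed

interpretation lborel_product: product_sigma_finite "\<lambda>_ :: nat. lborel :: real measure"
  by (intro product_sigma_finite.intro) (rule sigma_finite_lborel)

text \<open>Integrate the remaining times first, then the first time as a scalar convolution. The
  bound must be uniform over all starting points \<open>u\<close> and positions \<open>k\<close>,
  since the inner integral starts at the outer variable.\<close>

lemma word_nn_bound:
  assumes "singular_kernel a X" "\<forall>W\<in>set Ws. \<exists>a. singular_kernel a W" and T: "T > 0"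
  shows "\<exists>C\<ge>0. \<forall>t u k. 0 < t - u \<and> t - u \<le> T \<longrightarrow>
    (\<integral>\<^sup>+ s. ennreal (norm (word X Ws t u k s)) \<partial>Pi\<^sub>M {k..<k + length Ws} (\<lambda>_. lborel)) \<le> ennreal (C * (t - u) powr (- a))"
  using assms(1,2)
proof (induction Ws arbitrary: X a)
  case Nil
  obtain C where "C \<ge> 0" "\<forall>r. 0 < r \<and> r \<le> T \<longrightarrow> norm (X r) \<le> C * r powr (- a)"
    using bounded_kernelD(3)[OF singular_kernelD(1)[OF Nil(1)] T] by blast
  then show ?case
    by (intro exI[of _ C]) (auto simp: PiM_empty intro!: ennreal_leI)
next
  case (Cons W Ws)
  obtain b where W: "singular_kernel b W" using Cons.prems by auto
  note a = singular_kernelD(2,3)[OF Cons.prems(1)] and b = singular_kernelD(2,3)[OF W]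
  note bX = singular_kernelD(1)[OF Cons.prems(1)]
  obtain C' where C': "C' \<ge> 0" "\<And>t u k. 0 < t - u \<Longrightarrow> t - u \<le> T \<Longrightarrow>
    (\<integral>\<^sup>+ s. ennreal (norm (word W Ws t u k s)) \<partial>Pi\<^sub>M {k..<k + length Ws} (\<lambda>_. lborel)) \<le> ennreal (C' * (t - u) powr (- b))"
    using Cons.IH[OF W] Cons.prems(2) by auto
  obtain C where C: "C \<ge> 0" "\<forall>r. 0 < r \<and> r \<le> T \<longrightarrow> norm (X r) \<le> C * r powr (- a)"
    using bounded_kernelD(3)[OF bX T] by blast
  obtain D where D: "D \<ge> 0" "\<forall>r>0. (\<integral>\<^sup>+ q. ennreal (indicator {0<..<r} q * (q powr (- a) * (r - q) powr (- b))) \<partial>lborel)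
      \<le> ennreal (D * r powr (1 - a - b))" using beta_nn_integral[OF a b] by blast
  define f where "f q = norm (X q)" for q
  \<comment> \<open>The inner bound is available for gaps up to \<open>T\<close> only; gaps inside
    an interval of length at most \<open>T\<close> do not exceed it, so the cutoff loses
    nothing.\<close>
  define g where "g q = (if 0 < q \<and> q \<le> T then C' * q powr (- b) else 0)" for q
  have f0: "f q = 0" if "q \<le> 0" for q using bounded_kernelD(2)[OF bX that] by (simp add: f_def)
  have [measurable]: "f \<in> borel_measurable borel"
    unfolding f_def[abs_def] by (rule strong_measurable_norm[OF bounded_kernelD(1)[OF bX]])
  have [measurable]: "g \<in> borel_measurable borel" unfolding g_def[abs_def] by measurable
  have sm: "\<forall>W\<in>set (X # W # Ws). strong_measurable borel W"
    "\<forall>W\<in>set (W # Ws). \<forall>r\<le>0. W r = 0"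
  proof -
    have "\<forall>W\<in>set (X # W # Ws). \<exists>a. singular_kernel a W" using Cons.prems by auto
    then have "\<forall>W\<in>set (X # W # Ws). \<exists>a. bounded_kernel a W" using singular_kernelD(1) by blast
    then show "\<forall>W\<in>set (X # W # Ws). strong_measurable borel W" "\<forall>W\<in>set (W # Ws). \<forall>r\<le>0. W r = 0"
      using bounded_kernelD(1,2) by (blast, meson list.set_intros(2))
  qed
  have bound: "(\<integral>\<^sup>+ s. ennreal (norm (word X (W # Ws) t u k s)) \<partial>Pi\<^sub>M {k..<k + length (W # Ws)} (\<lambda>_. lborel))
      \<le> ennreal (C * C' * D * (t - u) powr (1 - a - b))" if r: "0 < t - u" "t - u \<le> T" for t u k
  proof -
    have ins: "{k..<k + length (W # Ws)} = insert k {Suc k..<Suc k + length Ws}" by auto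
    have m: "(\<lambda>s. ennreal (norm (word X (W # Ws) t u k s))) \<in> borel_measurable (Pi\<^sub>M (insert k {Suc k..<Suc k + length Ws}) (\<lambda>_. lborel))"
      unfolding ins[symmetric]
      using strong_measurable_norm[OF word_measurable[OF sm(1), where h = "\<lambda>_. u" and k = k and t = t, OF order_refl]]
      by simp
    have m': "(\<lambda>x. ennreal (norm (word W Ws t y (Suc k) x))) \<in> borel_measurable (Pi\<^sub>M {Suc k..<Suc k + length Ws} (\<lambda>_. lborel))" for y
      using strong_measurable_norm[OF word_measurable[of W Ws "Suc k" _ "\<lambda>_. y", OF _ order_refl]] sm(1) by simp
    have upd: "word X (W # Ws) t u k (x(k := y)) = X (y - u) * word W Ws t y (Suc k) x" for x y
      using word_cong[of "Suc k" "x(k := y)" x W Ws t y] by simp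
    have inner: "(\<integral>\<^sup>+ x. ennreal (norm (word W Ws t y (Suc k) x)) \<partial>Pi\<^sub>M {Suc k..<Suc k + length Ws} (\<lambda>_. lborel)) \<le> ennreal (g (t - y))"
      if "u < y" for y
    proof (cases "y < t")
      case True
      then show ?thesis using C'(2)[of t y "Suc k"] that r by (simp add: g_def)
    next
      case False
      then have "word W Ws t y (Suc k) x = 0" for x
        by (intro word_zero[OF sm(2)]) (auto dest: chain_bounds)
      then show ?thesis by simp
    qed
    have "(\<integral>\<^sup>+ s. ennreal (norm (word X (W # Ws) t u k s)) \<partial>Pi\<^sub>M {k..<k + length (W # Ws)} (\<lambda>_. lborel))
        = (\<integral>\<^sup>+ y. (\<integral>\<^sup>+ x. ennreal (norm (word X (W # Ws) t u k (x(k := y)))) \<partial>Pi\<^sub>M {Suc k..<Suc k + length Ws} (\<lambda>_. lborel)) \<partial>lborel)"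
      unfolding ins by (rule lborel_product.product_nn_integral_insert_rev[OF _ _ m]) auto
    also have "\<dots> \<le> (\<integral>\<^sup>+ y. ennreal \<bar>f (- u + 1 * y) * g ((t - u) - (- u + 1 * y))\<bar> \<partial>lborel)"
    proof (rule nn_integral_mono)
      fix y
      have "(\<integral>\<^sup>+ x. ennreal (norm (word X (W # Ws) t u k (x(k := y)))) \<partial>Pi\<^sub>M {Suc k..<Suc k + length Ws} (\<lambda>_. lborel))
          \<le> (\<integral>\<^sup>+ x. ennreal (f (y - u)) * ennreal (norm (word W Ws t y (Suc k) x)) \<partial>Pi\<^sub>M {Suc k..<Suc k + length Ws} (\<lambda>_. lborel))"
        unfolding upd f_def by (intro nn_integral_mono) (simp add: norm_mult_ineq ennreal_leI flip: ennreal_mult)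
      also have "\<dots> = ennreal (f (y - u)) * (\<integral>\<^sup>+ x. ennreal (norm (word W Ws t y (Suc k) x)) \<partial>Pi\<^sub>M {Suc k..<Suc k + length Ws} (\<lambda>_. lborel))"
        by (rule nn_integral_cmult[OF m'])
      also have "\<dots> \<le> ennreal (f (y - u)) * ennreal (g (t - y))"
      proof (cases "u < y")
        case True
        then show ?thesis by (intro mult_left_mono inner) auto
      qed (simp add: f0)
      also have "\<dots> = ennreal \<bar>f (- u + 1 * y) * g ((t - u) - (- u + 1 * y))\<bar>"
        using C'(1) by (simp add: f_def g_def flip: ennreal_mult)
      finally show "(\<integral>\<^sup>+ x. ennreal (norm (word X (W # Ws) t u k (x(k := y)))) \<partial>Pi\<^sub>M {Suc k..<Suc k + length Ws} (\<lambda>_. lborel))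
          \<le> ennreal \<bar>f (- u + 1 * y) * g ((t - u) - (- u + 1 * y))\<bar>" .
    qed
    also have "\<dots> = (\<integral>\<^sup>+ q. ennreal \<bar>f q * g ((t - u) - q)\<bar> \<partial>lborel)"
      using nn_integral_real_affine[of "\<lambda>q. ennreal \<bar>f q * g ((t - u) - q)\<bar>" 1 "- u"] by simp
    also have "\<dots> \<le> ennreal (C * C' * D * (t - u) powr (1 - a - b))"
      using C C' r f0 by (intro conv_nn_bound[OF a b C(1) C'(1) _ _ _ _ D(2), where T = T])
        (auto simp: f_def g_def)
    finally show ?thesis .
  qed
  have le: "C * C' * D * r powr (1 - a - b) \<le> C * C' * D * T powr (1 - b) * r powr (- a)" if r: "0 < r" "r \<le> T" for r
  proof -
    have "r powr (1 - a - b) = r powr (1 - b) * r powr (- a)"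
      by (simp add: powr_add[symmetric] algebra_simps)
    moreover have "r powr (1 - b) \<le> T powr (1 - b)" using r b by (intro powr_mono2) auto
    ultimately have "C * C' * D * r powr (1 - a - b) \<le> C * C' * D * (T powr (1 - b) * r powr (- a))"
      using C(1) C'(1) D(1) by (intro mult_left_mono) (auto intro: mult_right_mono)
    then show ?thesis by (simp add: mult.assoc)
  qed
  have "\<forall>t u k. 0 < t - u \<and> t - u \<le> T \<longrightarrow>
      (\<integral>\<^sup>+ s. ennreal (norm (word X (W # Ws) t u k s)) \<partial>Pi\<^sub>M {k..<k + length (W # Ws)} (\<lambda>_. lborel))
      \<le> ennreal (C * C' * D * T powr (1 - b) * (t - u) powr (- a))"
    using order_trans[OF bound ennreal_leI[OF le]] by blast
  moreover have "0 \<le> C * C' * D * T powr (1 - b)" using C(1) C'(1) D(1) by simp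
  ultimately show ?case by blast
qed

lemma conv_word_kernel:
  assumes "singular_kernel a X" "\<forall>W\<in>set Ws. \<exists>a. singular_kernel a W"
  shows "singular_kernel a (conv_word X Ws)"
  using assms
proof (induction Ws arbitrary: X a)
  case (Cons W Ws)
  then obtain b where "singular_kernel b W" by auto
  then have "singular_kernel b (conv_word W Ws)" using Cons by auto
  then show ?case using singular_kernel_conv[OF Cons.prems(1)] by simp
qed simp

lemma word_integrable:
  assumes X: "singular_kernel a X" and Ws: "\<forall>W\<in>set Ws. \<exists>a. singular_kernel a W"
  shows "bochner_integrable (Pi\<^sub>M {k..<k + length Ws} (\<lambda>_. lborel)) (word X Ws t u k)"
  unfolding bochner_integrable_def
proof
  have sm: "\<forall>W\<in>set (X # Ws). strong_measurable borel W" "\<forall>W\<in>set (X # Ws). \<forall>r\<le>0. W r = 0"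
  proof -
    have "\<forall>W\<in>set (X # Ws). \<exists>a. singular_kernel a W" using X Ws by auto
    then have "\<forall>W\<in>set (X # Ws). \<exists>a. bounded_kernel a W" using singular_kernelD(1) by blast
    then show "\<forall>W\<in>set (X # Ws). strong_measurable borel W" "\<forall>W\<in>set (X # Ws). \<forall>r\<le>0. W r = 0"
      using bounded_kernelD(1,2) by blast+
  qed
  show "strong_measurable (Pi\<^sub>M {k..<k + length Ws} (\<lambda>_. lborel)) (word X Ws t u k)"
    using word_measurable[OF sm(1) order_refl, of "\<lambda>_. u"] by simp
  show "(\<integral>\<^sup>+ s. ennreal (norm (word X Ws t u k s)) \<partial>Pi\<^sub>M {k..<k + length Ws} (\<lambda>_. lborel)) < \<infinity>"
  proof (cases "u < t")
    case True
    then obtain C where "(\<integral>\<^sup>+ s. ennreal (norm (word X Ws t u k s)) \<partial>Pi\<^sub>M {k..<k + length Ws} (\<lambda>_. lborel))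
        \<le> ennreal (C * (t - u) powr (- a))"
      using word_nn_bound[OF X Ws, of "t - u"] by auto
    also have "\<dots> < \<infinity>" by simp
    finally show ?thesis .
  next
    case False
    then have "word X Ws t u k s = 0" for s
      by (intro word_zero[OF sm(2)]) (auto dest: chain_bounds)
    then show ?thesis by simp
  qed
qed

text \<open>Fubini for matrix entries splits off the first time. The inner integral is the shorter
  convolution by induction, and a translation by \<open>u\<close> turns the outer one into
  \<open>conv\<close>.\<close>

lemma word_bochner:
  assumes "singular_kernel a X" "\<forall>W\<in>set Ws. \<exists>a. singular_kernel a W"
  shows "bochner (Pi\<^sub>M {k..<k + length Ws} (\<lambda>_. lborel)) (word X Ws t u k) = conv_word X Ws (t - u)"
  using assms
proof (induction Ws arbitrary: X a u k)
  case Nil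
  show ?case
  proof (rule bochner_eqI[OF word_integrable[OF Nil]])
    show "has_bochner_integral (Pi\<^sub>M {k..<k + length []} (\<lambda>_. lborel)) (\<lambda>s. entry x v (word X [] t u k s))
        (entry x v (conv_word X [] (t - u)))" for x v
      by (simp add: PiM_empty has_bochner_integral_iff integrable_count_space lebesgue_integral_count_space_finite)
  qed
next
  case (Cons W Ws)
  obtain b where W: "singular_kernel b W" using Cons.prems by auto
  have Ws: "\<forall>W\<in>set Ws. \<exists>a. singular_kernel a W" using Cons.prems by auto
  have CW: "singular_kernel b (conv_word W Ws)" by (rule conv_word_kernel[OF W Ws])
  note a = singular_kernelD(2,3)[OF Cons.prems(1)] and b = singular_kernelD(2,3)[OF W]
  let ?I = "{Suc k..<Suc k + length Ws}"
  have ins: "{k..<k + length (W # Ws)} = {k} \<union> ?I" by auto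
  note int = word_integrable[OF Cons.prems, of k t u]
  have cint: "bochner_integrable lborel (\<lambda>q. X q * conv_word W Ws ((t - u) - q))"
    by (rule conv_integrable[OF singular_kernelD(1)[OF Cons.prems(1)] singular_kernelD(1)[OF CW] a b])
  show ?case
  proof (rule bochner_eqI[OF int])
    fix x v
    note h = bochner_integral_entry[OF int, of x v]
    have i: "integrable (Pi\<^sub>M ({k} \<union> ?I) (\<lambda>_. lborel)) (\<lambda>s. entry x v (word X (W # Ws) t u k s))"
      using h unfolding ins by (simp add: has_bochner_integral_iff)
    have inner: "(\<integral>z. entry x v (word X (W # Ws) t u k (merge {k} ?I (y, z))) \<partial>Pi\<^sub>M ?I (\<lambda>_. lborel))
        = entry x v (X (y k - u) * conv_word W Ws (t - y k))" for y
    proof -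
      have eq: "word X (W # Ws) t u k (merge {k} ?I (y, z)) = X (y k - u) * word W Ws t (y k) (Suc k) z"
        if z: "z \<in> space (Pi\<^sub>M ?I (\<lambda>_. lborel))" for z
      proof -
        have "merge {k} ?I (y, z) i = z i" if "Suc k \<le> i" for i
          using that z by (auto simp: merge_def space_PiM PiE_def extensional_def)
        then have "word W Ws t (y k) (Suc k) (merge {k} ?I (y, z)) = word W Ws t (y k) (Suc k) z"
          by (rule word_cong)
        then show ?thesis by (simp add: merge_def)
      qed
      \<comment> \<open>The operator in front depends only on the outer variable; its adjoint moves
        it onto the test vector, leaving an entry to which the induction hypothesis applies.\<close>
      obtain x' where x': "\<And>A. entry x v (X (y k - u) * A) = entry x' v A" using entry_mult_left by metis
      have "(\<integral>z. entry x v (word X (W # Ws) t u k (merge {k} ?I (y, z))) \<partial>Pi\<^sub>M ?I (\<lambda>_. lborel))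
          = (\<integral>z. entry x' v (word W Ws t (y k) (Suc k) z) \<partial>Pi\<^sub>M ?I (\<lambda>_. lborel))"
        by (rule Bochner_Integration.integral_cong[OF refl]) (simp only: eq x')
      also have "\<dots> = entry x' v (conv_word W Ws (t - y k))"
        using bochner_integral_entry[OF word_integrable[OF W Ws, of "Suc k" t "y k"], of x' v]
          Cons.IH[OF W Ws, of "Suc k" "y k"] by (simp add: has_bochner_integral_iff)
      finally show ?thesis by (simp add: x')
    qed
    have shift: "has_bochner_integral lborel (\<lambda>y. entry x v (X (y - u) * conv_word W Ws (t - y)))
        (entry x v (conv X (conv_word W Ws) (t - u)))"
      using lborel_has_bochner_integral_real_affine_iff[of 1 "\<lambda>q. entry x v (X q * conv_word W Ws ((t - u) - q))"
          "entry x v (conv X (conv_word W Ws) (t - u))" "- u"] bochner_integral_entry[OF cint, of x v]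
      by (simp add: conv_def)
    have "(\<integral>s. entry x v (word X (W # Ws) t u k s) \<partial>Pi\<^sub>M ({k} \<union> ?I) (\<lambda>_. lborel))
        = (\<integral>y. (\<integral>z. entry x v (word X (W # Ws) t u k (merge {k} ?I (y, z))) \<partial>Pi\<^sub>M ?I (\<lambda>_. lborel))
            \<partial>Pi\<^sub>M {k} (\<lambda>_. lborel))"
      by (rule lborel_product.product_integral_fold[OF _ _ _ i]) auto
    also have "\<dots> = (\<integral>y. entry x v (X (y k - u) * conv_word W Ws (t - y k)) \<partial>Pi\<^sub>M {k} (\<lambda>_. lborel))"
      by (simp only: inner)
    also have "\<dots> = (\<integral>y. entry x v (X (y - u) * conv_word W Ws (t - y)) \<partial>lborel)"
      using shift by (intro lborel_product.product_integral_singleton) (auto simp: has_bochner_integral_iff)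
    also have "\<dots> = entry x v (conv X (conv_word W Ws) (t - u))"
      using shift by (simp add: has_bochner_integral_iff)
    finally show "has_bochner_integral (Pi\<^sub>M {k..<k + length (W # Ws)} (\<lambda>_. lborel))
        (\<lambda>s. entry x v (word X (W # Ws) t u k s)) (entry x v (conv_word X (W # Ws) (t - u)))"
      using i unfolding ins by (simp add: has_bochner_integral_iff del: word.simps)
  qed
qed

text \<open>The set is the graph of a function of the other coordinates, so each of its fibres in
  direction \<open>i\<close> has at most one point; Fubini makes it null.\<close>

lemma AE_coordinate_neq:
  assumes I: "finite I" "i \<in> I" and g [measurable]: "g \<in> borel_measurable (Pi\<^sub>M I (\<lambda>_. lborel))"
    and ind: "\<And>s y. g (s(i := y)) = g s"
  shows "AE s in Pi\<^sub>M I (\<lambda>_ :: nat. lborel :: real measure). s i \<noteq> (g s :: real)"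
proof -
  let ?M = "Pi\<^sub>M I (\<lambda>_ :: nat. lborel :: real measure)"
  have [measurable]: "(\<lambda>s. s i) \<in> borel_measurable ?M"
    using measurable_component_singleton[OF I(2), of "\<lambda>_. lborel :: real measure"] by simp
  define N where "N = {s \<in> space ?M. s i = g s}"
  have N: "N \<in> sets ?M" unfolding N_def by measurable
  have ins: "I = insert i (I - {i})" using I by auto
  have "emeasure ?M N = (\<integral>\<^sup>+ s. indicator N s \<partial>?M)" using N by simp
  also have "\<dots> = (\<integral>\<^sup>+ x. (\<integral>\<^sup>+ y. indicator N (x(i := y)) \<partial>lborel) \<partial>Pi\<^sub>M (I - {i}) (\<lambda>_. lborel))"
    using I N by (subst ins, subst lborel_product.product_nn_integral_insert) (auto simp: insert_absorb)
  also have "\<dots> \<le> (\<integral>\<^sup>+ x. (\<integral>\<^sup>+ y. indicator {g x} y \<partial>lborel) \<partial>Pi\<^sub>M (I - {i}) (\<lambda>_. lborel))"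
    by (intro nn_integral_mono) (auto simp: N_def ind indicator_def)
  also have "\<dots> = 0" by simp
  finally have "emeasure ?M N = 0" by simp
  then show ?thesis using N by (intro AE_I[of _ _ N]) (auto simp: N_def)
qed

lemma AE_nondegenerate:
  "AE s in Pi\<^sub>M {..<n} (\<lambda>_ :: nat. lborel :: real measure).
    (\<forall>i\<in>{..<n}. s i \<noteq> 0 \<and> s i \<noteq> t \<and> (\<forall>j\<in>{..<n}. i \<noteq> j \<longrightarrow> s i \<noteq> s j))"
proof (intro AE_finite_allI finite_lessThan AE_conjI)
  fix i j :: nat assume ij: "i \<in> {..<n}" "j \<in> {..<n}"
  show "AE s in Pi\<^sub>M {..<n} (\<lambda>_ :: nat. lborel :: real measure). i \<noteq> j \<longrightarrow> s i \<noteq> s j"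
  proof (cases "i = j")
    case False
    have "(\<lambda>s. s j) \<in> borel_measurable (Pi\<^sub>M {..<n} (\<lambda>_ :: nat. lborel :: real measure))"
      using measurable_component_singleton[OF ij(2), of "\<lambda>_. lborel :: real measure"] by simp
    then have "AE s in Pi\<^sub>M {..<n} (\<lambda>_ :: nat. lborel :: real measure). s i \<noteq> s j"
      using ij False by (intro AE_coordinate_neq) auto
    then show ?thesis by auto
  qed simp
qed (intro AE_coordinate_neq; simp)+


section \<open>The iterated heat integrals\<close>

context nonneg_self_adjoint
begin

definition relatively_bounded :: "'a opgraph \<Rightarrow> real \<Rightarrow> 'a cblinfun \<Rightarrow> bool" where
  "relatively_bounded P a B \<longleftrightarrow> 0 \<le> a \<and> a < 1 \<and> graph_of B = P \<odot> shifted_power H (- a)"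

text \<open>Associativity of relation composition alone: \<open>P\<close> meets (H + 1)^-a first,
  where the product is an everywhere defined bounded operator.\<close>

lemma relatively_bounded_comp:
  assumes "relatively_bounded P a B"
  shows "P \<odot> graph_of (Q (- a) 0 * Y) = graph_of (B * Y)"
proof -
  have "P \<odot> graph_of (Q (- a) 0 * Y) = (P \<odot> graph_of (Q (- a) 0)) \<odot> graph_of Y"
    by (simp add: graph_of_op_comp[symmetric] op_comp_def O_assoc)
  also have "P \<odot> graph_of (Q (- a) 0) = graph_of B"
    using assms by (simp add: relatively_bounded_def shifted_power_eq)
  finally show ?thesis by (simp add: graph_of_op_comp)
qed

text \<open>Splitting (H + 1)^-a off the leading semigroup factor lets \<open>P\<close> act, and
  what remains is the kernel with \<open>B\<close> in front; the other factors are
  untouched.\<close>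

lemma relatively_bounded_word:
  assumes "relatively_bounded P a B"
  shows "P \<odot> graph_of (word heat Ws t u k s) = graph_of (word (heat_kernel B a) Ws t u k s)"
proof -
  have a: "0 \<le> a" using assms by (simp add: relatively_bounded_def)
  have "word heat Ws t u k s = Q (- a) 0 * word (heat_kernel cid a) Ws t u k s"
    by (subst heat_eq[OF a]) (rule word_mult_left)
  moreover have "word (heat_kernel B a) Ws t u k s = B * word (heat_kernel cid a) Ws t u k s"
    by (subst heat_kernel_mult) (rule word_mult_left)
  ultimately show ?thesis using relatively_bounded_comp[OF assms] by simp
qed

lemma conv_word_mult_left:
  assumes "singular_kernel a X" "\<forall>W\<in>set Ws. \<exists>a. singular_kernel a W"
  shows "conv_word (\<lambda>r. L * X r) Ws r = L * conv_word X Ws r"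
proof (cases Ws)
  case (Cons W Ws')
  obtain b where W: "singular_kernel b W" using assms Cons by auto
  have "singular_kernel b (conv_word W Ws')" using assms(2) Cons by (intro conv_word_kernel[OF W]) auto
  then show ?thesis
    using Cons conv_mult_left[OF singular_kernelD(1)[OF assms(1)] singular_kernelD(1) singular_kernelD(2,3)[OF assms(1)] singular_kernelD(2,3)]
    by auto
qed simp

text \<open>\<open>P\<close> passes through the integral by the same factorization: only left
  multiplication by bounded operators has to commute with integration.\<close>

lemma relatively_bounded_conv_word:
  assumes "relatively_bounded P a B" and Ws: "\<forall>W\<in>set Ws. \<exists>a. singular_kernel a W"
  shows "P \<odot> graph_of (conv_word heat Ws t) = graph_of (conv_word (heat_kernel B a) Ws t)"
proof -
  have a: "0 \<le> a" "a < 1" using assms by (auto simp: relatively_bounded_def)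
  note hk = singular_kernel_heat_kernel[OF a, of cid]
  have "conv_word heat Ws t = Q (- a) 0 * conv_word (heat_kernel cid a) Ws t"
    by (subst heat_eq[OF a(1)]) (rule conv_word_mult_left[OF hk Ws])
  moreover have "conv_word (heat_kernel B a) Ws t = B * conv_word (heat_kernel cid a) Ws t"
    by (subst heat_kernel_mult) (rule conv_word_mult_left[OF hk Ws])
  ultimately show ?thesis using relatively_bounded_comp[OF assms(1)] by simp
qed

text \<open>Strictly increasing times make every gap positive, so each operator stands in front of a
  semigroup factor that smooths enough for it.\<close>

lemma heat_word_eq:
  assumes "\<forall>P\<in>set Ps. relatively_bounded P (\<alpha> P) (\<beta> P)" "chain t (length Ps) u k s"
  shows "heat_word H t s u k Ps = graph_of (word heat (map (\<lambda>P. heat_kernel (\<beta> P) (\<alpha> P)) Ps) t u k s)"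
  using assms
proof (induction Ps arbitrary: u k)
  case Nil
  then show ?case by (simp add: heat_semigroup_eq heat_kernel_def)
next
  case (Cons P Ps)
  let ?Ws = "map (\<lambda>P. heat_kernel (\<beta> P) (\<alpha> P)) Ps"
  have u: "u < s k" using Cons.prems by simp
  have "heat_word H t s (s k) (Suc k) Ps = graph_of (word heat ?Ws t (s k) (Suc k) s)"
    using Cons by auto
  then have "P \<odot> heat_word H t s (s k) (Suc k) Ps
      = graph_of (word (heat_kernel (\<beta> P) (\<alpha> P)) ?Ws t (s k) (Suc k) s)"
    using Cons.prems by (simp add: relatively_bounded_word)
  moreover have "heat_semigroup H (s k - u) = graph_of (heat (s k - u))"
    using u by (simp add: heat_semigroup_eq heat_kernel_def)
  ultimately show ?case by (simp add: graph_of_op_comp)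
qed

text \<open>The closed simplex and the strict chains differ only where a time equals 0,
  \<open>t\<close> or another time, which is a null set; off the chains the word vanishes as the
  indicator does.\<close>

lemma Phi_eq_conv_word:
  assumes P: "\<forall>P\<in>set Ps. relatively_bounded P (\<alpha> P) (\<beta> P)" and t: "t > 0"
  shows "Phi H t Ps = conv_word heat (map (\<lambda>P. heat_kernel (\<beta> P) (\<alpha> P)) Ps) t"
proof -
  let ?Ws = "map (\<lambda>P. heat_kernel (\<beta> P) (\<alpha> P)) Ps" and ?n = "length Ps"
  let ?M = "Pi\<^sub>M {..<?n} (\<lambda>_ :: nat. lborel :: real measure)"
  have hk: "singular_kernel 0 heat" by (rule singular_kernel_heat_kernel) auto
  have Ws: "\<forall>W\<in>set ?Ws. \<exists>a. singular_kernel a W"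
    using P singular_kernel_heat_kernel unfolding relatively_bounded_def by fastforce
  have vanish: "\<forall>W\<in>set (heat # ?Ws). \<forall>r\<le>0. W r = 0" by (auto simp: heat_kernel_def)
  have "AE s in ?M. indicator (simplex_at ?n t) s *\<^sub>R bounded_part (heat_word H t s 0 0 Ps) = word heat ?Ws t 0 0 s"
    using AE_nondegenerate[of ?n t]
  proof eventually_elim
    case (elim s)
    show ?case
    proof (cases "chain t ?n 0 0 s")
      case True
      have "0 \<le> s i \<and> s i \<le> t" if "i < ?n" for i
        using chain_bounds[OF True] that by (auto intro: less_imp_le)
      moreover have "s i \<le> s j" if "i \<le> j" "j < ?n" for i j
        using chain_mono[OF True, of i j] that by (cases "i = j") auto
      ultimately have "s \<in> simplex_at ?n t" by (simp add: simplex_at_def)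
      then show ?thesis using heat_word_eq[OF P True] by simp
    next
      case False
      have "s \<notin> simplex_at ?n t"
      proof
        assume s: "s \<in> simplex_at ?n t"
        have "chain t ?n 0 0 s"
        proof (rule chainI[OF t])
          show "0 < s i \<and> s i < t" if "0 \<le> i" "i < 0 + ?n" for i
            using s elim that by (auto simp: simplex_at_def order.strict_iff_order)
          show "s i < s j" if "0 \<le> i" "i < j" "j < 0 + ?n" for i j
            using s elim that by (auto simp: simplex_at_def order.strict_iff_order)
        qed
        then show False using False by simp
      qed
      moreover have "word heat ?Ws t 0 0 s = 0" by (rule word_zero[OF vanish]) (use False in simp)
      ultimately show ?thesis by simp
    qed
  qed
  then have "Phi H t Ps = bochner ?M (word heat ?Ws t 0 0)"
    unfolding Phi_def using t by (simp add: bochner_cong_AE)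
  also have "\<dots> = conv_word heat ?Ws (t - 0)"
    using word_bochner[OF hk Ws, of 0 t 0] by (simp add: atLeast0LessThan)
  finally show ?thesis by simp
qed

theorem iterated_heat_integral:
  assumes Ps: "\<forall>Q'\<in>set (P # Ps). \<exists>a B. relatively_bounded Q' a B"
  shows "smooth_on {0<..} (\<lambda>t. Phi H t (P # Ps))"
    and "continuous (at 0 within {0..}) (\<lambda>t. Phi H t (P # Ps))"
    and "t \<ge> 0 \<Longrightarrow> range (cblinfun_apply (Phi H t (P # Ps))) \<subseteq> Domain H"
    and "t > 0 \<Longrightarrow> \<exists>A B. graph_of A = H \<odot> graph_of (Phi H t (P # Ps)) \<and>
      graph_of B = P \<odot> (if Ps = [] then heat_semigroup H t else graph_of (Phi H t Ps)) \<and>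
      ((\<lambda>t. Phi H t (P # Ps)) has_vector_derivative (- A + B)) (at t)"
proof -
  obtain \<alpha> \<beta> where rb: "\<forall>P\<in>set (P # Ps). relatively_bounded P (\<alpha> P) (\<beta> P)" using Ps by metis
  let ?Ws = "map (\<lambda>P. heat_kernel (\<beta> P) (\<alpha> P)) Ps"
  have Ws: "\<forall>W\<in>set ?Ws. \<exists>a. singular_kernel a W"
    using rb singular_kernel_heat_kernel unfolding relatively_bounded_def by fastforce
  have \<alpha>: "0 \<le> \<alpha> P" "\<alpha> P < 1" using rb by (auto simp: relatively_bounded_def)
  \<comment> \<open>Everything except the leading semigroup factor. Its value at \<open>t\<close> is
    \<open>P\<close> applied to the shorter integral, which is the second summand of the
    equation.\<close>
  define G where "G = conv_word (heat_kernel (\<beta> P) (\<alpha> P)) ?Ws"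
  have G: "singular_kernel (\<alpha> P) G"
    unfolding G_def by (rule conv_word_kernel[OF singular_kernel_heat_kernel[OF \<alpha>] Ws])
  have hk: "singular_kernel 0 heat" by (rule singular_kernel_heat_kernel) auto
  have Phi: "Phi H t (P # Ps) = conv heat G t" for t
  proof (cases "t > 0")
    case True
    then show ?thesis using Phi_eq_conv_word[OF rb] by (simp add: G_def)
  next
    case False
    then show ?thesis
      using conv_nonpos[OF singular_kernelD(1)[OF hk] singular_kernelD(1)[OF G]] by (simp add: Phi_def)
  qed
  show "smooth_on {0<..} (\<lambda>t. Phi H t (P # Ps))"
    unfolding Phi using singular_kernel_smooth[OF singular_kernel_conv[OF hk G]] by simp
  show "continuous (at 0 within {0..}) (\<lambda>t. Phi H t (P # Ps))"
  proof -
    \<comment> \<open>The semigroup has order 0, so the convolution is O(r^(1 - a)) with a the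
      exponent of the first operator; as a < 1 it tends to 0.\<close>
    obtain C where C: "C \<ge> 0" "\<forall>r. 0 < r \<and> r \<le> 1 \<longrightarrow> norm (conv heat G r) \<le> C * r powr (1 - 0 - \<alpha> P)"
      using conv_bound[OF singular_kernelD(1)[OF hk] singular_kernelD(1)[OF G] _ _ \<alpha>, of 1] by auto
    have z: "conv heat G 0 = 0"
      by (rule conv_nonpos[OF singular_kernelD(1)[OF hk] singular_kernelD(1)[OF G]]) simp
    have "(conv heat G \<longlongrightarrow> 0) (at_right 0)"
    proof (rule Lim_null_comparison)
      show "\<forall>\<^sub>F r in at_right 0. norm (conv heat G r) \<le> C * r powr (1 - \<alpha> P)"
        using eventually_at_right_real[OF zero_less_one] by eventually_elim (use C in auto)
      have "((\<lambda>r. r powr (1 - \<alpha> P)) \<longlongrightarrow> 0 powr (1 - \<alpha> P)) (at_right 0)"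
        using \<alpha> by (intro tendsto_powr' tendsto_ident_at tendsto_const)
          (auto intro: eventually_mono[OF eventually_at_right_less])
      then show "((\<lambda>r. C * r powr (1 - \<alpha> P)) \<longlongrightarrow> 0) (at_right 0)"
        using \<alpha> by (intro tendsto_mult_right_zero) simp
    qed
    then show ?thesis
      unfolding Phi continuous_within z by (simp add: at_within_Ici_at_right)
  qed
  have eq: "\<exists>D. (conv heat G has_vector_derivative D) (at t) \<and> (\<forall>x. (conv heat G t \<rhd> x, (G t - D) \<rhd> x) \<in> H)"
    if "t > 0" for t
    using conv_heat_equation[OF G that] .
  show "range (cblinfun_apply (Phi H t (P # Ps))) \<subseteq> Domain H" if t: "t \<ge> 0"
  proof (cases "t = 0")
    case True
    have "(0, 0) \<in> H" using H_linear by (simp add: linear_operator_def)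
    then show ?thesis using True by (auto simp: Phi_def)
  next
    case False
    then show ?thesis using eq[of t] t unfolding Phi by auto
  qed
  show "\<exists>A B. graph_of A = H \<odot> graph_of (Phi H t (P # Ps)) \<and>
      graph_of B = P \<odot> (if Ps = [] then heat_semigroup H t else graph_of (Phi H t Ps)) \<and>
      ((\<lambda>t. Phi H t (P # Ps)) has_vector_derivative (- A + B)) (at t)" if t: "t > 0"
  proof -
    obtain D where D: "(conv heat G has_vector_derivative D) (at t)"
      "\<And>x. (conv heat G t \<rhd> x, (G t - D) \<rhd> x) \<in> H" using eq[OF t] by blast
    have "graph_of (G t - D) = H \<odot> graph_of (Phi H t (P # Ps))"
      unfolding Phi op_comp_def using D(2) single_valued_linear_operator[OF H_linear]
      by (auto simp: graph_of_iff relcomp_unfold set_eq_iff)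
    moreover have "graph_of (G t) = P \<odot> (if Ps = [] then heat_semigroup H t else graph_of (Phi H t Ps))"
    proof -
      \<comment> \<open>For an empty tail the convolution is the semigroup itself, in accordance
        with the convention for n = 1.\<close>
      have "(if Ps = [] then heat_semigroup H t else graph_of (Phi H t Ps)) = graph_of (conv_word heat ?Ws t)"
        using t rb Phi_eq_conv_word[of Ps \<alpha> \<beta> t] by (auto simp: heat_semigroup_eq heat_kernel_def)
      then show ?thesis
        using relatively_bounded_conv_word[of P "\<alpha> P" "\<beta> P" ?Ws t] rb Ws by (simp add: G_def)
    qed
    moreover have "((\<lambda>t. Phi H t (P # Ps)) has_vector_derivative (- (G t - D) + G t)) (at t)"
      unfolding Phi using D(1) by simp
    ultimately show ?thesis by blast
  qed
qed

end

theorem corollary2p5: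
  fixes H P :: "'a::chilbert_space opgraph" and Ps :: "'a opgraph list"
  assumes "self_adjoint H" and "nonneg_operator H"
    and "\<forall>Q\<in>set (P # Ps). closed_operator Q \<and> densely_defined Q"
    and "\<forall>Q\<in>set (P # Ps). \<exists>a::real. 0 < a \<and> a < 1 \<and> is_bounded (Q \<odot> shifted_power H (- a))"
  shows "(smooth_on {0<..} (\<lambda>t. Phi H t (P # Ps)) \<and>
          continuous (at 0 within {0..}) (\<lambda>t. Phi H t (P # Ps))) \<and>
         (\<forall>t\<ge>0. range (cblinfun_apply (Phi H t (P # Ps))) \<subseteq> Domain H) \<and>
         (\<forall>t>0. \<exists>A B.
            graph_of A = H \<odot> graph_of (Phi H t (P # Ps)) \<and>
            graph_of B = P \<odot> (if Ps = [] then heat_semigroup H t else graph_of (Phi H t Ps)) \<and>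
            ((\<lambda>t. Phi H t (P # Ps)) has_vector_derivative (- A + B)) (at t))"
proof -
  interpret nonneg_self_adjoint H by standard (fact assms)+
  have "\<forall>Q\<in>set (P # Ps). \<exists>a B. relatively_bounded Q a B"
  proof
    fix Q assume "Q \<in> set (P # Ps)"
    then obtain a where "0 < a" "a < 1" "is_bounded (Q \<odot> shifted_power H (- a))" using assms(4) by blast
    then show "\<exists>a B. relatively_bounded Q a B"
      unfolding relatively_bounded_def is_bounded_def by (intro exI[of _ a]) auto
  qed
  note this[THEN iterated_heat_integral(1)] this[THEN iterated_heat_integral(2)]
    this[THEN iterated_heat_integral(3)] this[THEN iterated_heat_integral(4)]
  then show ?thesis by blast
qed

end
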